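(* Let $T>1$ and let $e=(1,0,0)\in\mathbb{R}^3$. For $k=1,2$, let $\mathfrak{P}^{(k)}=\big(\beta^{(k)}_{ij}\big)_{1\le i,j\le 2}$ be a $2\times 2$ matrix-valued function on $\mathbb{R}^3$ with real-valued entries $\beta^{(k)}_{ij}\in C^\infty(\mathbb{R}^3)$, and let $\overrightarrow{U}^{(k)}=\begin{bmatrix} U^{(k)}_1 \\ U^{(k)}_2 \end{bmatrix}$ solve the initial value problem $$\begin{cases}\left(\Box I_{2\times 2}-\mathfrak{P}^{(k)}(x)\right)\overrightarrow{U}^{(k)}(t,x)=\delta(t,x)\begin{bmatrix}1\\1\end{bmatrix}, & (t,x)\in\mathbb{R}\times\mathbb{R}^3,\\ \overrightarrow{U}^{(k)}(t,x)=\overrightarrow{0}, & (t,x)\in(-\infty,0)\times\mathbb{R}^3.\end{cases}$$ Suppose that $\beta^{(1)}_{ij}(x)\ge\beta^{(2)}_{ij}(x)$ for every $x\in\mathbb{R}^3$ and all $1\le i,j\le 2$, and that $$\overrightarrow{U}^{(1)}(t,e)=\overrightarrow{U}^{(2)}(t,e)\quad\text{for each } t\in(0,T].$$ Then $\mathfrak{P}^{(1)}(x)=\mathfrak{P}^{(2)}(x)$ for every $x\in\mathbb{R}^3$ with $|x|+|x-e|\le T$.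
   Context: Here $\Box=\partial_t^2-\Delta_x$ is the wave operator on $\mathbb{R}\times\mathbb{R}^3$, $I_{2\times2}$ is the identity matrix, and $\delta(t,x)$ is the Dirac delta distribution on $\mathbb{R}\times\mathbb{R}^3$ concentrated at $(t,x)=(0,0)$. The initial value problem is understood in the sense of distributions. Its unique solution has the form $$\overrightarrow{U}^{(k)}(t,x)=\frac{\delta(t-|x|)}{4\pi|x|}\begin{bmatrix}1\\1\end{bmatrix}+\mathscr{H}(t-|x|)\,\overrightarrow{R}^{(k)}(t,x),$$ where $\mathscr{H}$ is the Heaviside function and $\overrightarrow{R}^{(k)}$ is a $C^1$ solution in the region $t>|x|$ (up to the cone $t=|x|$) of $(\Box I_{2\times2}-\mathfrak{P}^{(k)})\overrightarrow{R}^{(k)}=\overrightarrow{0}$ with $\overrightarrow{R}^{(k)}(|x|,x)=\frac{1}{8\pi}\int_0^1\mathfrak{P}^{(k)}(sx)\begin{bmatrix}1\\1\end{bmatrix}ds$. Both solutions have the same singular term and vanish at $x=e$ for $t<|e|=1$; the equality $\overrightarrow{U}^{(1)}(t,e)=\overrightarrow{U}^{(2)}(t,e)$ for $t\in(0,T]$ is understood as $\overrightarrow{R}^{(1)}(t,e)=\overrightarrow{R}^{(2)}(t,e)$ for all $t\in(1,T]$. *)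

theory Defs
  imports "HOL-Analysis.Analysis"
begin

section \<open>Smooth functions and distributions\<close>

definition dir_deriv ::
    "'a::euclidean_space \<Rightarrow> ('a \<Rightarrow> 'b::real_normed_vector) \<Rightarrow> 'a \<Rightarrow> 'b" where
  "dir_deriv v f x = frechet_derivative f (at x) v"

primrec times_cont_diff ::
    "nat \<Rightarrow> ('a::euclidean_space \<Rightarrow> 'b::real_normed_vector) \<Rightarrow> bool" where
  "times_cont_diff 0 f \<longleftrightarrow> continuous_on UNIV f"
| "times_cont_diff (Suc n) f \<longleftrightarrow>
     (\<forall>x. f differentiable (at x)) \<and> (\<forall>v. times_cont_diff n (dir_deriv v f))"

definition smooth :: "('a::euclidean_space \<Rightarrow> 'b::real_normed_vector) \<Rightarrow> bool" where
  "smooth f \<longleftrightarrow> (\<forall>n. times_cont_diff n f)"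

definition supp :: "('a::topological_space \<Rightarrow> 'b::zero) \<Rightarrow> 'a set" where
  "supp f = closure {x. f x \<noteq> 0}"

definition test_fun :: "('a::euclidean_space \<Rightarrow> real) \<Rightarrow> bool" where
  "test_fun \<phi> \<longleftrightarrow> smooth \<phi> \<and> compact (supp \<phi>)"

text \<open>The sum of the sup norms of the iterated partial derivatives of order at most \<open>N\<close>;
  a list \<open>[b\<^sub>1, \<dots>, b\<^sub>k]\<close> of basis vectors stands for the derivative along
  \<open>b\<^sub>k\<close>, \<open>\<dots>\<close>, \<open>b\<^sub>1\<close>.\<close>

definition Ck_seminorm :: "nat \<Rightarrow> ('a::euclidean_space \<Rightarrow> real) \<Rightarrow> real" where
  "Ck_seminorm N \<phi> =
     (\<Sum>bs \<in> {bs. set bs \<subseteq> Basis \<and> length bs \<le> N}. SUP x. \<bar>foldr dir_deriv bs \<phi> x\<bar>)"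

text \<open>A distribution is represented by a functional on all functions, of which only the values
  on test functions are relevant. Continuity on the space of test functions is expressed by the
  usual seminorm estimate on each compact set.\<close>

definition distribution :: "(('a::euclidean_space \<Rightarrow> real) \<Rightarrow> real) \<Rightarrow> bool" where
  "distribution u \<longleftrightarrow>
     (\<forall>\<phi> \<psi> a b. test_fun \<phi> \<longrightarrow> test_fun \<psi> \<longrightarrow>
        u (\<lambda>x. a * \<phi> x + b * \<psi> x) = a * u \<phi> + b * u \<psi>) \<and>
     (\<forall>K. compact K \<longrightarrow>
        (\<exists>N C. \<forall>\<phi>. test_fun \<phi> \<longrightarrow> supp \<phi> \<subseteq> K \<longrightarrow> \<bar>u \<phi>\<bar> \<le> C * Ck_seminorm N \<phi>))"


section \<open>The wave equation with a matrix potential\<close>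

type_synonym spacetime = "real \<times> (real ^ 3)"
type_synonym potential = "real ^ 3 \<Rightarrow> real ^ 2 ^ 2"
type_synonym vec_distribution = "2 \<Rightarrow> (spacetime \<Rightarrow> real) \<Rightarrow> real"

definition wave_op :: "(spacetime \<Rightarrow> real) \<Rightarrow> spacetime \<Rightarrow> real" where
  "wave_op f z =
     dir_deriv (1, 0) (dir_deriv (1, 0) f) z
     - (\<Sum>b\<in>Basis. dir_deriv (0, b) (dir_deriv (0, b) f) z)"

text \<open>Here \<open>\<box>u\<close> is \<open>\<phi> \<mapsto> u (\<box>\<phi>)\<close>, since \<open>\<box>\<close> is its own formal transpose, and the product of
  \<open>u\<close> with a smooth function \<open>\<beta>\<close> is \<open>\<phi> \<mapsto> u (\<beta> \<phi>)\<close>.\<close>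

definition solves_ivp :: "potential \<Rightarrow> vec_distribution \<Rightarrow> bool" where
  "solves_ivp P U \<longleftrightarrow>
     (\<forall>i. distribution (U i)) \<and>
     (\<forall>i \<phi>. test_fun \<phi> \<longrightarrow>
        U i (wave_op \<phi>) - (\<Sum>j\<in>UNIV. U j (\<lambda>(t, x). P x $ i $ j * \<phi> (t, x))) = \<phi> (0, 0)) \<and>
     (\<forall>i \<phi>. test_fun \<phi> \<longrightarrow> supp \<phi> \<subseteq> {(t, x). t < 0} \<longrightarrow> U i \<phi> = 0)"


section \<open>The regular part of the solution\<close>

definition inside_cone :: "spacetime set" where
  "inside_cone = {(t, x). norm x < t}"

definition closed_cone :: "spacetime set" where
  "closed_cone = {(t, x). norm x \<le> t}"

definition C1_up_to_cone :: "(spacetime \<Rightarrow> real ^ 2) \<Rightarrow> bool" where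
  "C1_up_to_cone R \<longleftrightarrow>
     continuous_on closed_cone R \<and>
     (\<forall>z\<in>inside_cone. R differentiable (at z)) \<and>
     (\<forall>v. \<exists>g. continuous_on closed_cone g \<and> (\<forall>z\<in>inside_cone. g z = dir_deriv v R z))"

text \<open>As \<open>R\<close> is only required to be continuously differentiable, the equation
  \<open>(\<box> - P) R = 0\<close> inside the cone is meant in the sense of distributions.\<close>

definition solves_characteristic_bvp :: "potential \<Rightarrow> (spacetime \<Rightarrow> real ^ 2) \<Rightarrow> bool" where
  "solves_characteristic_bvp P R \<longleftrightarrow>
     C1_up_to_cone R \<and>
     (\<forall>i \<phi>. test_fun \<phi> \<longrightarrow> supp \<phi> \<subseteq> inside_cone \<longrightarrow>
        (LINT (t, x):inside_cone|lborel.
           R (t, x) $ i * wave_op \<phi> (t, x) - (P x *v R (t, x)) $ i * \<phi> (t, x)) = 0) \<and>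
     (\<forall>x. R (norm x, x) = (1 / (8 * pi)) *\<^sub>R integral {0..1} (\<lambda>s. P (s *\<^sub>R x) *v vec 1))"

text \<open>The distribution \<open>\<delta>(t - |x|) / (4\<pi>|x|)\<close>.\<close>

definition cone_delta :: "(spacetime \<Rightarrow> real) \<Rightarrow> real" where
  "cone_delta \<phi> = (LINT x|lborel. \<phi> (norm x, x) / (4 * pi * norm x))"

text \<open>\<open>R\<close> is the regular part of the solution \<open>U\<close>:
  \<open>U = \<delta>(t - |x|) / (4\<pi>|x|) [1, 1] + H(t - |x|) R\<close>, with \<open>R\<close> as above. This determines
  \<open>R\<close> on the closed cone.\<close>

definition regular_part ::
    "potential \<Rightarrow> vec_distribution \<Rightarrow> (spacetime \<Rightarrow> real ^ 2) \<Rightarrow> bool" where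
  "regular_part P U R \<longleftrightarrow>
     solves_characteristic_bvp P R \<and>
     (\<forall>i \<phi>. test_fun \<phi> \<longrightarrow>
        U i \<phi> = cone_delta \<phi> + (LINT z:inside_cone|lborel. R z $ i * \<phi> z))"

end

theory Submission
  imports Defs
begin

text \<open>
  Let \<open>R = R1 - R2\<close>, let \<open>D \<ge> 0\<close> be a row sum of \<open>P1 - P2\<close>, and let \<open>E\<close> be the backward
  fundamental solution of the wave operator, so that \<open>E g \<ge> 0\<close> for \<open>g \<ge> 0\<close>. Testing the difference
  of the two equations with \<open>E g\<close> expresses the integral of \<open>R g\<close> as an integral of \<open>D\<close>
  against \<open>E g\<close> over the light cone plus an integral of \<open>P1 R1 - P2 R2\<close> against \<open>E g\<close>. For
  \<open>g(t, x) = k(t) \<rho>(x)\<close>, with \<open>\<rho>\<close> concentrated near \<open>e\<close>, the former integral is small by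
  hypothesis. If \<open>k\<close> decays like \<open>exp (- l t)\<close>, then \<open>E (E g) \<le> C / l E g\<close>; by positivity of \<open>E\<close>,
  testing with \<open>E (p E g)\<close> for \<open>p\<close> close to the sign of \<open>R\<close> bounds the integral of \<open>|R| E g\<close> by
  \<open>C / l\<close> times the surface integral of \<open>D\<close>. For large \<open>l\<close> all remaining terms are absorbed,
  which leaves a bound of the surface integral by the data and hence \<open>D = 0\<close>.
\<close>

section \<open>Smooth functions\<close>

text \<open>Unknowns depending on three variables are tested by functions of time alone, recorded on
  the line x = e. What compensates for this is the sign of \<open>P1 - P2\<close>. Row sums enter
  because the singular part is the same in both components, so the potentials act on it through P
  [1, 1]; as the entries of the difference are nonnegative, zero row sums give equality. The
  functions R are only C1 and satisfy their equation weakly, so all estimates are dual: every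
  derivative falls on a smooth test function, and the sign of R has to be replaced by a polynomial.
  The order of choices matters. The bound M on the coefficients depends neither on l nor on \<rho>,
  so l is fixed before \<rho> is concentrated. Data and surface term are then both measured in
  multiples of the mass of \<rho>, which cancels. The ellipsoid |x| + |x - e| <= T consists of the
  points x such that a signal from 0, scattered at x, reaches e by time T: only from such points
  (|x|, x) does the forward cone meet the line x = e no later than T.\<close>

lemma dir_deriv_eqI:
  "(f has_derivative f') (at x) \<Longrightarrow> dir_deriv v f x = f' v"
  unfolding dir_deriv_def using frechet_derivative_at by metis

lemma times_cont_diff_SucD: "times_cont_diff (Suc n) f \<Longrightarrow> times_cont_diff n f"
proof (induction n arbitrary: f)
  case 0
  then show ?case
    by (auto intro!: continuous_at_imp_continuous_on differentiable_imp_continuous_within)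
next
  case (Suc n)
  then show ?case by (metis times_cont_diff.simps(2))
qed

text \<open>Replaces induction on the order for families closed under differentiation; the
  constants, the multiples of \<open>exp\<close> and the cone integrals are treated this
  way.\<close>

lemma smooth_coinduct:
  assumes "f \<in> S" and "\<And>g x. g \<in> S \<Longrightarrow> g differentiable (at x)"
    and "\<And>g v. g \<in> S \<Longrightarrow> dir_deriv v g \<in> S"
  shows "smooth f"
proof -
  have "g \<in> S \<Longrightarrow> times_cont_diff n g" for n g
  proof (induction n arbitrary: g)
    case 0
    then show ?case using assms(2)
      by (auto intro!: continuous_at_imp_continuous_on differentiable_imp_continuous_within)
  qed (use assms in auto)
  with assms(1) show ?thesis by (simp add: smooth_def)
qed

lemma smooth_differentiable: "smooth f \<Longrightarrow> f differentiable (at x)"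
  unfolding smooth_def by (metis times_cont_diff.simps(2))

lemma smooth_has_derivative: "smooth f \<Longrightarrow> (f has_derivative (\<lambda>v. dir_deriv v f x)) (at x)"
  using smooth_differentiable[of f x] unfolding dir_deriv_def
  by (simp add: frechet_derivative_works)

lemma smooth_dir_deriv: "smooth f \<Longrightarrow> smooth (dir_deriv v f)"
  unfolding smooth_def by (metis times_cont_diff.simps(2))

lemma smooth_continuous_on: "smooth f \<Longrightarrow> continuous_on S f"
  unfolding smooth_def by (metis continuous_on_subset subset_UNIV times_cont_diff.simps(1))

lemma times_cont_diff_const: "times_cont_diff n (\<lambda>x. c)"
proof -
  have "smooth (\<lambda>x::'a::euclidean_space. c)"
  proof (rule smooth_coinduct[of _ "range (\<lambda>c x. c)"])
    fix g :: "'a \<Rightarrow> 'b" and v assume "g \<in> range (\<lambda>c x. c)"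
    then obtain c where "g = (\<lambda>x. c)" by auto
    then have "dir_deriv v g = (\<lambda>x. 0)" by (auto intro!: ext dir_deriv_eqI derivative_eq_intros)
    then show "dir_deriv v g \<in> range (\<lambda>c x. c)" by auto
  qed auto
  then show ?thesis by (simp add: smooth_def)
qed

lemma smooth_const [simp]: "smooth (\<lambda>x. c)"
  by (simp add: smooth_def times_cont_diff_const)

lemma smooth_linear: 
  assumes "bounded_linear f" shows "smooth f"
proof -
  have "dir_deriv v f = (\<lambda>x. f v)" for v
    by (auto intro!: ext dir_deriv_eqI bounded_linear_imp_has_derivative assms)
  then have "times_cont_diff (Suc n) f" for n
    using assms by (auto simp: times_cont_diff_const bounded_linear_imp_differentiable)
  then show ?thesis unfolding smooth_def by (auto intro: times_cont_diff_SucD)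
qed

lemma times_cont_diff_add:
  assumes "times_cont_diff n f" "times_cont_diff n g"
  shows "times_cont_diff n (\<lambda>x. f x + g x)"
  using assms
proof (induction n arbitrary: f g)
  case (Suc n)
  then have D: "((\<lambda>x. f x + g x) has_derivative (\<lambda>v. dir_deriv v f x + dir_deriv v g x)) (at x)" for x
    unfolding dir_deriv_def by (intro has_derivative_add frechet_derivative_works[THEN iffD1]) auto
  then have "dir_deriv v (\<lambda>x. f x + g x) = (\<lambda>x. dir_deriv v f x + dir_deriv v g x)" for v
    by (auto intro!: ext dir_deriv_eqI)
  with Suc D show ?case by (auto simp: differentiable_def)
qed (simp add: continuous_on_add)

lemma dir_deriv_mult:
  fixes f g :: "'a::euclidean_space \<Rightarrow> real"
  assumes "f differentiable at x" "g differentiable at x"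
  shows "dir_deriv v (\<lambda>x. f x * g x) x = f x * dir_deriv v g x + dir_deriv v f x * g x"
  unfolding dir_deriv_def using assms[THEN frechet_derivative_works[THEN iffD1]]
  by (intro dir_deriv_eqI[unfolded dir_deriv_def] derivative_eq_intros) auto

lemma times_cont_diff_mult:
  fixes f g :: "'a::euclidean_space \<Rightarrow> real"
  assumes "times_cont_diff n f" "times_cont_diff n g"
  shows "times_cont_diff n (\<lambda>x. f x * g x)"
  using assms
proof (induction n arbitrary: f g)
  case (Suc n)
  then have "dir_deriv v (\<lambda>x. f x * g x) = (\<lambda>x. f x * dir_deriv v g x + dir_deriv v f x * g x)" for v
    by (auto intro!: ext dir_deriv_mult)
  moreover have "times_cont_diff n f" "times_cont_diff n g"
    using Suc.prems times_cont_diff_SucD by blast+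
  ultimately show ?case using Suc by (auto intro!: times_cont_diff_add)
qed (simp add: continuous_on_mult)

lemma times_cont_diff_compose_linear:
  assumes "times_cont_diff n f" "bounded_linear A"
  shows "times_cont_diff n (\<lambda>x. f (A x))"
  using assms
proof (induction n arbitrary: f)
  case 0
  then show ?case
    by (auto intro: continuous_on_compose2[of UNIV] linear_continuous_on)
next
  case (Suc n)
  have *: "((\<lambda>x. f (A x)) has_derivative (\<lambda>v. dir_deriv (A v) f (A x))) (at x)" for x
    using Suc.prems
    by (auto intro!: has_derivative_compose[of A] bounded_linear_imp_has_derivative
        simp: dir_deriv_def frechet_derivative_works[symmetric])
  then have "dir_deriv v (\<lambda>x. f (A x)) = (\<lambda>x. dir_deriv (A v) f (A x))" for v
    by (auto intro!: ext dir_deriv_eqI)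
  with Suc * show ?case by (auto simp: differentiable_def)
qed

text \<open>The chain rule brings in the derivative of \<open>h\<close> at \<open>q x\<close>, so
  the induction has to vary \<open>h\<close>; full smoothness of \<open>h\<close> makes its
  derivative admissible again.\<close>

lemma times_cont_diff_compose_real:
  fixes h :: "real \<Rightarrow> real"
  assumes "smooth h" "times_cont_diff n q"
  shows "times_cont_diff n (\<lambda>x. h (q x))"
  using assms
proof (induction n arbitrary: h)
  case 0
  then show ?case
    by (auto intro: continuous_on_compose2[of UNIV] smooth_continuous_on)
next
  case (Suc n)
  have *: "((\<lambda>x. h (q x)) has_derivative (\<lambda>v. dir_deriv v q x * dir_deriv 1 h (q x))) (at x)" for x
  proof -
    have "((\<lambda>x. h (q x)) has_derivative (\<lambda>v. dir_deriv (dir_deriv v q x) h (q x))) (at x)"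
    proof -
      have "(q has_derivative (\<lambda>v. dir_deriv v q x)) (at x)"
        using Suc.prems by (auto simp: dir_deriv_def frechet_derivative_works[symmetric])
      then show ?thesis
        by (rule has_derivative_compose[OF _ smooth_has_derivative[OF Suc.prems(1)]])
    qed
    moreover have scale: "dir_deriv a h y = a * dir_deriv 1 h y" for a y
      using linear_frechet_derivative[OF smooth_differentiable[OF Suc.prems(1)]]
        linear_scale[of "frechet_derivative h (at y)" a 1]
      by (simp add: dir_deriv_def)
    have "(\<lambda>v. dir_deriv (dir_deriv v q x) h (q x)) = (\<lambda>v. dir_deriv v q x * dir_deriv 1 h (q x))"
      by (rule ext) (rule scale)
    ultimately show ?thesis by metis
  qed
  then have "dir_deriv v (\<lambda>x. h (q x)) = (\<lambda>x. dir_deriv v q x * dir_deriv 1 h (q x))" for v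
    by (auto intro!: ext dir_deriv_eqI)
  moreover have "times_cont_diff n (\<lambda>x. dir_deriv 1 h (q x))"
    by (rule Suc.IH[OF smooth_dir_deriv[OF Suc.prems(1)] times_cont_diff_SucD[OF Suc.prems(2)]])
  ultimately show ?case using Suc.prems * by (auto simp: differentiable_def intro!: times_cont_diff_mult)
qed

lemma smooth_add: "smooth f \<Longrightarrow> smooth g \<Longrightarrow> smooth (\<lambda>x. f x + g x)"
  by (simp add: smooth_def times_cont_diff_add)

lemma smooth_mult: "smooth f \<Longrightarrow> smooth g \<Longrightarrow> smooth (\<lambda>x. f x * g x :: real)"
  by (simp add: smooth_def times_cont_diff_mult)

lemma smooth_cmult: "smooth f \<Longrightarrow> smooth (\<lambda>x. c * f x :: real)"
  by (simp add: smooth_mult)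

lemma smooth_diff: "smooth f \<Longrightarrow> smooth g \<Longrightarrow> smooth (\<lambda>x. f x - g x :: real)"
  using smooth_add[of f "\<lambda>x. (-1) * g x"] smooth_cmult[of g "-1"] by simp

lemma smooth_sum: "finite I \<Longrightarrow> (\<And>i. i \<in> I \<Longrightarrow> smooth (f i)) \<Longrightarrow> smooth (\<lambda>x. \<Sum>i\<in>I. f i x)"
  by (induction I rule: finite_induct) (auto intro: smooth_add)

lemma smooth_compose_linear: "smooth f \<Longrightarrow> bounded_linear A \<Longrightarrow> smooth (\<lambda>x. f (A x))"
  by (simp add: smooth_def times_cont_diff_compose_linear)

lemma smooth_compose_real: "smooth h \<Longrightarrow> smooth q \<Longrightarrow> smooth (\<lambda>x. h (q x))"
  for h :: "real \<Rightarrow> real"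
  using times_cont_diff_compose_real unfolding smooth_def[of q] smooth_def[of "\<lambda>x. h (q x)"] by blast

lemma smooth_real_polynomial_function: "real_polynomial_function p \<Longrightarrow> smooth p"
  by (induction rule: real_polynomial_function.induct)
     (auto intro: smooth_linear smooth_add smooth_mult)

lemma smooth_norm_square: "smooth (\<lambda>x. (norm x)\<^sup>2)"
proof -
  have "smooth (\<lambda>x::'a. \<Sum>b\<in>Basis. (x \<bullet> b) * (x \<bullet> b))"
    by (intro smooth_sum smooth_mult smooth_linear bounded_linear_inner_left) auto
  then show ?thesis by (simp add: power2_norm_eq_inner euclidean_inner[symmetric])
qed

section \<open>Smooth functions of one real variable\<close>

lemma DERIV_imp_smooth:
  fixes h :: "real \<Rightarrow> real"
  assumes "\<And>x. (h has_real_derivative h' x) (at x)" "smooth h'"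
  shows "smooth h"
proof -
  have "(h has_derivative (\<lambda>v. h' x * v)) (at x)" for x
    using assms(1)[of x] by (simp add: has_field_derivative_def)
  then have "h differentiable (at x)" "dir_deriv v h = (\<lambda>x. h' x * v)" for x v
    by (auto intro!: ext dir_deriv_eqI simp: differentiable_def)
  then have "times_cont_diff (Suc n) h" for n
    using smooth_mult[OF assms(2) smooth_const] by (simp add: smooth_def)
  then show ?thesis unfolding smooth_def by (auto intro: times_cont_diff_SucD)
qed

lemma smooth_exp_scale: "smooth (\<lambda>s::real. exp (c * s))"
proof -
  have "smooth (exp :: real \<Rightarrow> real)"
  proof (rule smooth_coinduct[of _ "range (\<lambda>a x. a * exp x)"])
    show "exp \<in> range (\<lambda>a x. a * exp x :: real)" by (auto intro: image_eqI[of _ _ 1])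
  next
    fix g :: "real \<Rightarrow> real" and v assume "g \<in> range (\<lambda>a x. a * exp x)"
    then obtain a where "g = (\<lambda>x. a * exp x)" by auto
    then have "dir_deriv v g = (\<lambda>x. (a * v) * exp x)"
      by (auto intro!: ext dir_deriv_eqI derivative_eq_intros)
    then show "dir_deriv v g \<in> range (\<lambda>a x. a * exp x)" by auto
  qed (auto intro!: derivative_intros field_differentiable_imp_differentiable field_differentiable_within_exp)
  then show ?thesis by (rule smooth_compose_linear) (rule bounded_linear_mult_right)
qed


text \<open>The powers are built in because the derivative of \<open>bump k\<close> is a combination
  of \<open>bump (k + 1)\<close> and \<open>bump (k + 2)\<close>: one induction then gives
  smoothness of the whole family. The member \<open>bump 0\<close> is the standard flat function and
  \<open>bump 2\<close> its derivative.\<close>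

definition bump :: "nat \<Rightarrow> real \<Rightarrow> real" where
  "bump k s = (if s \<le> 0 then 0 else exp (- 1 / s) / s ^ k)"

lemma bump_nonneg: "bump k s \<ge> 0" and bump_pos_iff: "bump k s > 0 \<longleftrightarrow> s > 0"
  by (auto simp: bump_def)

lemma bump_nonpos [simp]: "s \<le> 0 \<Longrightarrow> bump k s = 0"
  by (simp add: bump_def)

lemma bump_tendsto_0: "(bump k \<longlongrightarrow> 0) (at_right 0)"
proof -
  have "((\<lambda>s. (inverse s) ^ k / exp (inverse s)) \<longlongrightarrow> (0::real)) (at_right 0)"
    using tendsto_power_div_exp_0 filterlim_inverse_at_top_right by (rule filterlim_compose)
  then show ?thesis
  proof (rule Lim_transform_eventually)
    show "\<forall>\<^sub>F s in at_right 0. inverse s ^ k / exp (inverse s) = bump k s"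
      by (rule eventually_at_rightI[of 0 1])
         (auto simp: bump_def exp_minus field_simps)
  qed
qed

lemma bump_deriv: "(bump k has_real_derivative bump (k + 2) s - k * bump (k + 1) s) (at s)"
proof -
  consider "s < 0" | "s = 0" | "s > 0" by linarith
  then show ?thesis
  proof cases
    case 1
    have "((\<lambda>s. 0) has_real_derivative 0) (at s)" by simp
    then have "(bump k has_real_derivative 0) (at s)"
      by (rule DERIV_cong_ev[THEN iffD1, rotated 3])
         (use 1 in \<open>auto intro!: eventually_mono[OF eventually_nhds_in_open[of "{..<0}"]]\<close>)
    then show ?thesis using 1 by simp
  next
    case 2
    \<comment> \<open>The right difference quotient at 0 is again a member of the family,
      \<open>bump (k + 1)\<close>, so the exponential makes it tend to 0.\<close>
    have "((\<lambda>h. (bump k (0 + h) - bump k 0) / h) \<longlongrightarrow> 0) (at_right 0)"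
    proof (rule Lim_transform_eventually[OF bump_tendsto_0[of "k + 1"]])
      show "\<forall>\<^sub>F s in at_right 0. bump (k + 1) s = (bump k (0 + s) - bump k 0) / s"
        by (rule eventually_at_rightI[of 0 1]) (auto simp: bump_def field_simps)
    qed
    moreover have "((\<lambda>h. (bump k (0 + h) - bump k 0) / h) \<longlongrightarrow> 0) (at_left 0)"
      by (rule Lim_transform_eventually[OF tendsto_const], rule eventually_at_leftI[of "-1"]) auto
    ultimately show ?thesis using 2 by (simp add: DERIV_def filterlim_split_at)
  next
    case 3
    have "((\<lambda>s. exp (- 1 / s) / s ^ k) has_real_derivative bump (k + 2) s - k * bump (k + 1) s) (at s)"
    proof -
      have k: "real k * s ^ (k - 1) = real k * s ^ k / s" using 3 by (cases k) auto
      have "((\<lambda>s. exp (- 1 / s) / s ^ k) has_real_derivative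
          ((1 / s\<^sup>2) * exp (- 1 / s) * s ^ k - exp (- 1 / s) * (real k * s ^ (k - 1))) / (s ^ k * s ^ k)) (at s)"
        using 3 by (auto intro!: derivative_eq_intros simp: power2_eq_square)
      then show ?thesis unfolding k
        by (rule DERIV_cong) (use 3 in \<open>simp add: bump_def field_simps power2_eq_square\<close>)
    qed
    then show ?thesis
      by (rule DERIV_cong_ev[THEN iffD1, rotated 3])
         (use 3 in \<open>auto intro!: eventually_mono[OF eventually_nhds_in_open[of "{0<..}"]] simp: bump_def\<close>)
  qed
qed

lemma smooth_bump: "smooth (bump k)"
proof -
  have "times_cont_diff n (bump k)" for n
  proof (induction n arbitrary: k)
    case 0
    show ?case
      by (simp, rule DERIV_continuous_on, rule has_field_derivative_at_within, rule bump_deriv)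
  next
    case (Suc n)
    have D: "(bump k has_derivative (\<lambda>v. bump (k + 2) s * v + (- real k * v) * bump (k + 1) s)) (at s)" for s
      using bump_deriv[of k s] unfolding has_field_derivative_def
      by (rule has_derivative_eq_rhs) (auto simp: fun_eq_iff algebra_simps)
    then have "dir_deriv v (bump k) = (\<lambda>s. bump (k + 2) s * v + (- real k * v) * bump (k + 1) s)" for v
      by (auto intro!: ext dir_deriv_eqI)
    moreover have "times_cont_diff n (\<lambda>s. bump (k + 2) s * v + (- real k * v) * bump (k + 1) s)" for v
      by (rule times_cont_diff_add; rule times_cont_diff_mult) (rule Suc times_cont_diff_const)+
    ultimately show ?case using D by (auto simp: differentiable_def)
  qed
  then show ?thesis by (simp add: smooth_def)
qed

lemma integral_eq_zeroI: "(\<And>x. x \<in> S \<Longrightarrow> f x = 0) \<Longrightarrow> integral S f = 0"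
  by (metis Henstock_Kurzweil_Integration.integral_cong integral_0)

lemma smooth_step_exists:
  obtains S :: "real \<Rightarrow> real" where "smooth S" "\<And>s. s \<le> 0 \<Longrightarrow> S s = 0" "\<And>s. s \<ge> 1 \<Longrightarrow> S s = 1"
proof -
  \<comment> \<open>Positive exactly on (0, 1) and flat at both ends; the step is its normalised
    primitive.\<close>
  define \<beta> where "\<beta> s = bump 0 s * bump 0 (1 - s)" for s
  have sm: "smooth \<beta>"
    using smooth_diff[OF smooth_const[of 1] smooth_linear[OF bounded_linear_ident]]
    unfolding \<beta>_def by (intro smooth_mult smooth_bump smooth_compose_real[of "bump 0" "\<lambda>s. 1 - s"]) auto
  have c: "continuous_on S \<beta>" for S by (rule smooth_continuous_on[OF sm])
  have z: "\<beta> s = 0" if "s \<le> 0 \<or> s \<ge> 1" for s using that by (auto simp: \<beta>_def)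
  define I where "I = integral {0..1} \<beta>"
  have I: "I > 0"
  proof -
    have "I \<noteq> 0"
    proof
      assume "I = 0"
      then have "(\<beta> has_integral 0) (cbox 0 1)"
        unfolding I_def using integrable_continuous_real[OF c, of 0 1]
        by (metis box_real(2) has_integral_integral)
      then have "\<beta> (1/2) = 0"
        by (rule has_integral_0_cbox_imp_0[OF c, rotated]) (auto simp: \<beta>_def bump_nonneg)
      then show False by (simp add: \<beta>_def bump_def)
    qed
    moreover have "I \<ge> 0" unfolding I_def
      by (intro integral_nonneg integrable_continuous_real c) (auto simp: \<beta>_def bump_nonneg)
    ultimately show ?thesis by simp
  qed
  \<comment> \<open>Starting at -1 makes 0 an interior point, so the fundamental theorem gives a
    two-sided derivative there as well.\<close>
  define G where "G s = integral {-1..s} \<beta>" for s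
  define S where "S s = (if s \<le> 0 then 0 else G s / I)" for s
  have GD: "(G has_real_derivative \<beta> s) (at s)" if "s > -1" for s
  proof -
    have "(G has_real_derivative \<beta> s) (at s within {-1..s+1})"
      unfolding G_def by (rule integral_has_real_derivative[OF c]) (use that in auto)
    moreover have "at s within {-1..s+1} = at s"
      by (rule at_within_interior) (use that in auto)
    ultimately show ?thesis by simp
  qed
  have G0: "G s = 0" if "s \<le> 0" for s
    unfolding G_def by (rule integral_eq_zeroI) (use that z in auto)
  have SD: "(S has_real_derivative \<beta> s / I) (at s)" for s
  proof (cases "s > -1")
    case True
    have "((\<lambda>s. G s / I) has_real_derivative \<beta> s / I) (at s)"
      by (intro DERIV_cdivide GD True)
    then show ?thesis
      by (rule DERIV_cong_ev[THEN iffD1, rotated 3]) (auto simp: S_def G0)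
  next
    case False
    have "((\<lambda>s. 0) has_real_derivative 0) (at s)" by simp
    then have "(S has_real_derivative 0) (at s)"
      by (rule DERIV_cong_ev[THEN iffD1, rotated 3])
         (use False in \<open>auto intro!: eventually_mono[OF eventually_nhds_in_open[of "{..<0}"]] simp: S_def\<close>)
    with False z show ?thesis by simp
  qed
  show ?thesis
  proof
    show "smooth S"
      by (rule DERIV_imp_smooth[OF SD]) (use smooth_cmult[OF sm, of "1/I"] in simp)
    show "S s = 0" if "s \<le> 0" for s using that by (simp add: S_def)
    show "S s = 1" if "s \<ge> 1" for s
    proof -
      have i: "\<beta> integrable_on {a..b}" for a b by (intro integrable_continuous_real c)
      have "G s = integral {-1..0} \<beta> + integral {0..1} \<beta> + integral {1..s} \<beta>"
        unfolding G_def using that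
          Henstock_Kurzweil_Integration.integral_combine[of "-1" 0 s \<beta>] 
          Henstock_Kurzweil_Integration.integral_combine[of 0 1 s \<beta>] i by simp
      also have "integral {-1..0} \<beta> = 0" by (rule integral_eq_zeroI) (use z in auto)
      also have "integral {1..s} \<beta> = 0" by (rule integral_eq_zeroI) (use z in auto)
      finally show ?thesis using that I by (simp add: S_def I_def)
    qed
  qed
qed

section \<open>Symmetry of second derivatives\<close>

lemma linear_dir_deriv: "smooth f \<Longrightarrow> linear (\<lambda>v. dir_deriv v f x)"
  unfolding dir_deriv_def by (intro linear_frechet_derivative smooth_differentiable)

lemma dir_deriv_line:
  assumes "smooth f"
  shows "((\<lambda>t. f (x + t *\<^sub>R v)) has_vector_derivative dir_deriv v f (x + t *\<^sub>R v)) (at t)"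
proof -
  have "((\<lambda>t. x + t *\<^sub>R v) has_derivative (\<lambda>s. s *\<^sub>R v)) (at t)"
    by (auto intro!: derivative_eq_intros)
  then have "((\<lambda>t. f (x + t *\<^sub>R v)) has_derivative (\<lambda>s. dir_deriv (s *\<^sub>R v) f (x + t *\<^sub>R v))) (at t)"
    by (rule has_derivative_compose[OF _ smooth_has_derivative[OF assms]])
  then show ?thesis
    by (simp add: has_vector_derivative_def linear_scale[OF linear_dir_deriv[OF assms]])
qed

text \<open>Both iterated derivatives are limits of the same second difference over the
  parallelogram with sides h u and h v, divided by h^2. The mean value theorem, applied once in each
  direction, turns this difference into a derivative at an intermediate point, and the difference is
  symmetric in \<open>u\<close> and \<open>v\<close>.\<close>

lemma dir_deriv_commute:
  fixes f :: "'a::euclidean_space \<Rightarrow> real"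
  assumes f: "smooth f"
  shows "dir_deriv u (dir_deriv v f) x = dir_deriv v (dir_deriv u f) x"
proof -
  have line: "((\<lambda>t. g (y + t *\<^sub>R w)) has_real_derivative dir_deriv w g (y + t *\<^sub>R w)) (at t)"
    if "smooth g" for g :: "'a \<Rightarrow> real" and y w t
    using dir_deriv_line[OF that] by (simp add: has_real_derivative_iff_has_vector_derivative)
  have mean: "\<exists>s t. 0 < s \<and> s < h \<and> 0 < t \<and> t < h \<and>
      f (x + h *\<^sub>R u + h *\<^sub>R v) - f (x + h *\<^sub>R u) - f (x + h *\<^sub>R v) + f x
        = h * h * dir_deriv v (dir_deriv u f) (x + s *\<^sub>R u + t *\<^sub>R v)"
    if "h > 0" for u v h
  proof -
    define \<phi> where "\<phi> s = f (x + s *\<^sub>R u + h *\<^sub>R v) - f (x + s *\<^sub>R u)" for s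
    have \<phi>: "(\<phi> has_real_derivative dir_deriv u f (x + s *\<^sub>R u + h *\<^sub>R v) - dir_deriv u f (x + s *\<^sub>R u)) (at s)" for s
      unfolding \<phi>_def using line[OF f, of "x + h *\<^sub>R v" u s] line[OF f, of x u s]
      by (auto intro!: DERIV_diff simp: algebra_simps)
    obtain s where s: "0 < s" "s < h" and es: "\<phi> h - \<phi> 0 = (h - 0) * 
        (dir_deriv u f (x + s *\<^sub>R u + h *\<^sub>R v) - dir_deriv u f (x + s *\<^sub>R u))"
      using MVT2[OF \<open>0 < h\<close> \<phi>] by blast
    obtain t where t: "0 < t" "t < h" and et:
        "dir_deriv u f (x + s *\<^sub>R u + h *\<^sub>R v) - dir_deriv u f (x + s *\<^sub>R u + 0 *\<^sub>R v)
          = (h - 0) * dir_deriv v (dir_deriv u f) (x + s *\<^sub>R u + t *\<^sub>R v)"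
      using MVT2[OF \<open>0 < h\<close> line[OF smooth_dir_deriv[OF f, of u]]] by blast
    show ?thesis
      using s t es et by (intro exI[of _ s] exI[of _ t]) (simp add: \<phi>_def algebra_simps)
  qed
  define a where "a n = (1::real) / Suc n" for n
  have a0: "a \<longlonglongrightarrow> 0" unfolding a_def by (rule LIMSEQ_Suc[OF lim_1_over_n])
  have apos: "a n > 0" for n by (simp add: a_def)
  have lim: "(\<lambda>n. (f (x + a n *\<^sub>R u + a n *\<^sub>R v) - f (x + a n *\<^sub>R u) - f (x + a n *\<^sub>R v) + f x) / (a n * a n))
      \<longlonglongrightarrow> dir_deriv v (dir_deriv u f) x" for u v
  proof -
    have "\<forall>n. \<exists>s t. 0 < s \<and> s < a n \<and> 0 < t \<and> t < a n \<and>
      f (x + a n *\<^sub>R u + a n *\<^sub>R v) - f (x + a n *\<^sub>R u) - f (x + a n *\<^sub>R v) + f x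
        = a n * a n * dir_deriv v (dir_deriv u f) (x + s *\<^sub>R u + t *\<^sub>R v)"
      using mean apos by blast
    then obtain s t where st: "\<And>n. 0 < s n \<and> s n < a n \<and> 0 < t n \<and> t n < a n \<and>
      f (x + a n *\<^sub>R u + a n *\<^sub>R v) - f (x + a n *\<^sub>R u) - f (x + a n *\<^sub>R v) + f x
        = a n * a n * dir_deriv v (dir_deriv u f) (x + s n *\<^sub>R u + t n *\<^sub>R v)" by metis
    have s0: "s \<longlonglongrightarrow> 0" and t0: "t \<longlonglongrightarrow> 0"
      by (rule tendsto_sandwich[OF _ _ tendsto_const a0]; use st in \<open>auto intro!: always_eventually less_imp_le\<close>)+
    have "continuous (at x) (dir_deriv v (dir_deriv u f))"
      using smooth_continuous_on[OF smooth_dir_deriv[OF smooth_dir_deriv[OF f]], of UNIV]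
      by (simp add: continuous_on_eq_continuous_at)
    then have "(\<lambda>n. dir_deriv v (dir_deriv u f) (x + s n *\<^sub>R u + t n *\<^sub>R v)) \<longlonglongrightarrow> dir_deriv v (dir_deriv u f) x"
      by (rule isCont_tendsto_compose) (auto intro!: tendsto_eq_intros s0 t0)
    moreover have "dir_deriv v (dir_deriv u f) (x + s n *\<^sub>R u + t n *\<^sub>R v)
       = (f (x + a n *\<^sub>R u + a n *\<^sub>R v) - f (x + a n *\<^sub>R u) - f (x + a n *\<^sub>R v) + f x) / (a n * a n)" for n
      using st[of n] apos[of n] by (simp add: field_simps)
    ultimately show ?thesis by simp
  qed
  show ?thesis
    by (rule LIMSEQ_unique[OF lim[of v u]]) (use lim[of u v] in \<open>simp add: algebra_simps\<close>)
qed

section \<open>Integrals over light cones\<close>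

text \<open>One-sided substitute for compact support. On forward cones it confines everything to a
  compact set, and it survives differentiation and integration over forward cones, whereas the
  latter destroys compact support.\<close>

definition vanishes_after :: "real \<Rightarrow> (real \<times> 'a \<Rightarrow> real) \<Rightarrow> bool" where
  "vanishes_after T g \<longleftrightarrow> (\<forall>t x. t > T \<longrightarrow> g (t, x) = 0)"

lemma vanishes_afterD: "vanishes_after T g \<Longrightarrow> fst p > T \<Longrightarrow> g p = 0"
  by (cases p) (auto simp: vanishes_after_def)

lemma dir_deriv_cong_open:
  assumes "open S" "x \<in> S" "\<And>y. y \<in> S \<Longrightarrow> f y = g y"
  shows "dir_deriv v f x = dir_deriv v g x"
proof -
  have "(f has_derivative D) (at x) \<longleftrightarrow> (g has_derivative D) (at x)" for D
    using has_derivative_transform_within_open[OF _ assms(1,2), of f D UNIV g]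
      has_derivative_transform_within_open[OF _ assms(1,2), of g D UNIV f] assms(3) by auto
  then show ?thesis by (simp add: dir_deriv_def frechet_derivative_def)
qed

lemma vanishes_after_dir_deriv:
  fixes g :: "real \<times> 'a::euclidean_space \<Rightarrow> real"
  assumes "vanishes_after T g"
  shows "vanishes_after T (dir_deriv v g)"
  unfolding vanishes_after_def
proof (intro allI impI)
  fix t and x :: 'a assume "t > T"
  have "open {p::real \<times> 'a. fst p > T}"
    by (intro open_Collect_less continuous_intros)
  then have "dir_deriv v g (t, x) = dir_deriv v (\<lambda>_. 0) (t, x)"
    by (rule dir_deriv_cong_open) (use assms vanishes_afterD \<open>t > T\<close> in auto)
  also have "\<dots> = 0" by (rule dir_deriv_eqI[where f'="\<lambda>_. 0"]) auto
  finally show "dir_deriv v g (t, x) = 0" .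
qed

definition locally_integrable :: "('a::euclidean_space \<Rightarrow> real) \<Rightarrow> bool" where
  "locally_integrable m \<longleftrightarrow>
     m \<in> borel_measurable borel \<and> (\<forall>r. set_integrable lborel (cball 0 r) m)"

text \<open>Integration over the forward light cone with vertex \<open>p\<close>; for \<open>m z = 1 / norm z\<close> in
  three dimensions this is \<open>4\<pi>\<close> times the backward fundamental solution applied to \<open>g\<close>.\<close>

definition cone_integral ::
    "('a::euclidean_space \<Rightarrow> real) \<Rightarrow> (real \<times> 'a \<Rightarrow> real) \<Rightarrow> real \<times> 'a \<Rightarrow> real" where
  "cone_integral m g p = (LINT z|lborel. g (p + (norm z, z)) * m z)"

lemma norm_cone_le: "norm (norm z, z) \<le> 2 * norm z"
  using norm_triangle_ineq[of "(norm z, 0)" "(0, z)"] by (simp add: norm_Pair)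

lemma integrable_locally_mult:
  fixes f :: "'a::euclidean_space \<Rightarrow> real"
  assumes "locally_integrable m" "continuous_on UNIV f" "\<And>z. norm z > r \<Longrightarrow> f z = 0"
  shows "integrable lborel (\<lambda>z. f z * m z)"
proof -
  have "bounded (f ` cball 0 r)"
    by (intro compact_imp_bounded compact_continuous_image continuous_on_subset[OF assms(2)]) auto
  then obtain B where B: "\<And>z. norm z \<le> r \<Longrightarrow> \<bar>f z\<bar> \<le> B"
    unfolding bounded_iff by (metis imageI mem_cball_0 real_norm_def)
  have "integrable lborel (\<lambda>z. B * (indicator (cball 0 r) z *\<^sub>R m z))"
    using assms(1) unfolding locally_integrable_def set_integrable_def by auto
  then show ?thesis
  proof (rule Bochner_Integration.integrable_bound)
    show "(\<lambda>z. f z * m z) \<in> borel_measurable lborel"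
      using assms(1) borel_measurable_continuous_onI[OF assms(2)]
      by (auto simp: locally_integrable_def)
    show "AE z in lborel. norm (f z * m z) \<le> norm (B * (indicator (cball 0 r) z *\<^sub>R m z))"
    proof (intro AE_I2)
      fix z
      show "norm (f z * m z) \<le> norm (B * (indicator (cball 0 r) z *\<^sub>R m z))"
      proof (cases "norm z \<le> r")
        case True
        then have "\<bar>f z\<bar> \<le> \<bar>B\<bar>" using B[of z] by linarith
        then show ?thesis using True by (simp add: abs_mult mult_right_mono)
      qed (use assms(3) in auto)
    qed
  qed
qed

lemma continuous_on_cone:
  fixes g :: "real \<times> 'a::euclidean_space \<Rightarrow> real" and s :: "'a \<Rightarrow> real"
  assumes "continuous_on UNIV g" "continuous_on UNIV s"
  shows "continuous_on UNIV (\<lambda>z. g (p + (s z, z)))"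
proof -
  have "continuous_on UNIV (\<lambda>z. p + (s z, z))"
    by (intro continuous_on_add continuous_on_const continuous_on_Pair assms(2) continuous_on_id)
  then show ?thesis by (rule continuous_on_compose2[OF assms(1)]) auto
qed

lemma cone_integrable:
  assumes "locally_integrable m" "continuous_on UNIV g" "vanishes_after T g"
  shows "integrable lborel (\<lambda>z. g (p + (norm z, z)) * m z)"
proof (rule integrable_locally_mult[OF assms(1), of _ "T - fst p"])
  show "continuous_on UNIV (\<lambda>z. g (p + (norm z, z)))"
    by (intro continuous_on_cone assms continuous_intros)
  show "g (p + (norm z, z)) = 0" if "norm z > T - fst p" for z
    by (rule vanishes_afterD[OF assms(3)]) (use that in auto)
qed

text \<open>Supplies the domination needed to differentiate under the cone integral. Linearity in
  the direction reduces the bound to finitely many continuous functions on a ball, one for each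
  basis vector.\<close>

lemma smooth_local_Lipschitz:
  fixes g :: "'a::euclidean_space \<Rightarrow> real"
  assumes g: "smooth g"
  obtains L where "L \<ge> 0" "\<And>q v. norm (q - p) \<le> r \<Longrightarrow> \<bar>dir_deriv v g q\<bar> \<le> L * norm v"
    "\<And>q q'. norm (q - p) \<le> r \<Longrightarrow> norm (q' - p) \<le> r \<Longrightarrow> \<bar>g q - g q'\<bar> \<le> L * norm (q - q')"
proof -
  have "\<exists>B. \<forall>q\<in>cball p r. \<bar>dir_deriv b g q\<bar> \<le> B" for b
  proof -
    have "bounded (dir_deriv b g ` cball p r)"
      by (intro compact_imp_bounded compact_continuous_image smooth_continuous_on smooth_dir_deriv g) auto
    then show ?thesis unfolding bounded_iff by auto
  qed
  then obtain B where B: "\<And>b q. q \<in> cball p r \<Longrightarrow> \<bar>dir_deriv b g q\<bar> \<le> B b" by metis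
  define L where "L = (\<Sum>b\<in>Basis. \<bar>B b\<bar>)"
  have L0: "L \<ge> 0" by (simp add: L_def sum_nonneg)
  have D: "\<bar>dir_deriv v g q\<bar> \<le> L * norm v" if "norm (q - p) \<le> r" for q v
  proof -
    have q: "q \<in> cball p r" using that by (simp add: dist_norm norm_minus_commute)
    have "dir_deriv v g q = dir_deriv (\<Sum>b\<in>Basis. (v \<bullet> b) *\<^sub>R b) g q"
      by (simp add: euclidean_representation)
    also have "\<dots> = (\<Sum>b\<in>Basis. (v \<bullet> b) * dir_deriv b g q)"
      by (simp add: linear_sum[OF linear_dir_deriv[OF g]] linear_scale[OF linear_dir_deriv[OF g]])
    also have "\<bar>\<dots>\<bar> \<le> (\<Sum>b\<in>Basis. norm v * \<bar>B b\<bar>)"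
    proof (intro order.trans[OF sum_abs] sum_mono)
      fix b :: 'a assume "b \<in> Basis"
      then have "\<bar>v \<bullet> b\<bar> \<le> norm v" by (rule Basis_le_norm)
      moreover have "\<bar>dir_deriv b g q\<bar> \<le> \<bar>B b\<bar>" using B[OF q, of b] by linarith
      ultimately show "\<bar>v \<bullet> b * dir_deriv b g q\<bar> \<le> norm v * \<bar>B b\<bar>"
        by (simp add: abs_mult mult_mono)
    qed
    finally show ?thesis by (simp add: L_def sum_distrib_left mult.commute)
  qed
  show ?thesis
  proof
    fix q q' assume *: "norm (q - p) \<le> r" "norm (q' - p) \<le> r"
    have "norm (g q - g q') \<le> L * norm (q - q')"
    proof (rule differentiable_bound[of "cball p r"])
      show "(g has_derivative (\<lambda>v. dir_deriv v g x)) (at x within cball p r)" for x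
        by (rule has_derivative_at_withinI[OF smooth_has_derivative[OF g]])
      show "onorm (\<lambda>v. dir_deriv v g x) \<le> L" if "x \<in> cball p r" for x
        by (rule onorm_le) (use D[of x] that in \<open>auto simp: dist_norm norm_minus_commute\<close>)
    qed (use * in \<open>auto simp: dist_norm norm_minus_commute\<close>)
    then show "\<bar>g q - g q'\<bar> \<le> L * norm (q - q')" by simp
  qed (use L0 D in auto)
qed

text \<open>Dominated convergence for the remainder divided by |h|. For |h| <= 1 all integrands
  vanish outside one fixed ball, on which the quotient is bounded by twice a Lipschitz constant and
  \<open>m\<close> is integrable.\<close>

lemma cone_integral_has_derivative:
  assumes m: "locally_integrable m" and g: "smooth g" and T: "vanishes_after T g"
  shows "(cone_integral m g has_derivative (\<lambda>v. cone_integral m (dir_deriv v g) p)) (at p)"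
proof -
  have gi: "integrable lborel (\<lambda>z. g (q + (norm z, z)) * m z)" for q
    by (rule cone_integrable[OF m smooth_continuous_on[OF g] T])
  have di: "integrable lborel (\<lambda>z. dir_deriv v g (q + (norm z, z)) * m z)" for q v
    by (rule cone_integrable[OF m smooth_continuous_on[OF smooth_dir_deriv[OF g]] vanishes_after_dir_deriv[OF T]])
  have lin: "linear (\<lambda>v. cone_integral m (dir_deriv v g) p)"
  proof (rule linearI)
    show "cone_integral m (dir_deriv (u + v) g) p = cone_integral m (dir_deriv u g) p + cone_integral m (dir_deriv v g) p" for u v
      unfolding cone_integral_def
      by (subst Bochner_Integration.integral_add[symmetric, OF di di])
         (simp add: linear_add[OF linear_dir_deriv[OF g]] algebra_simps)
    show "cone_integral m (dir_deriv (c *\<^sub>R v) g) p = c *\<^sub>R cone_integral m (dir_deriv v g) p" for c v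
      unfolding cone_integral_def
      by (simp add: linear_scale[OF linear_dir_deriv[OF g]] mult.assoc)
  qed
  \<comment> \<open>For |h| <= 1 nothing contributes beyond this radius. The points p + h + (|z|, z)
    with |z| <= r lie within 1 + 2 r of p, the 2 coming from \<open>norm_cone_le\<close>.\<close>
  define r where "r = T - fst p + 1"
  obtain L where L: "L \<ge> 0" "\<And>q v. norm (q - p) \<le> 1 + 2 * r \<Longrightarrow> \<bar>dir_deriv v g q\<bar> \<le> L * norm v"
    "\<And>q q'. norm (q - p) \<le> 1 + 2 * r \<Longrightarrow> norm (q' - p) \<le> 1 + 2 * r \<Longrightarrow> \<bar>g q - g q'\<bar> \<le> L * norm (q - q')"
    using smooth_local_Lipschitz[OF g] by metis
  define Q where "Q h z = (g (p + h + (norm z, z)) - g (p + (norm z, z)) - dir_deriv h g (p + (norm z, z))) / norm h" for h z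
  have Qi: "(cone_integral m g (p + h) - cone_integral m g p - cone_integral m (dir_deriv h g) p) / norm h
      = (LINT z|lborel. Q h z * m z)" for h
    unfolding cone_integral_def Q_def
    by (subst Bochner_Integration.integral_diff[symmetric, OF gi gi],
        subst Bochner_Integration.integral_diff[symmetric, OF Bochner_Integration.integrable_diff[OF gi gi] di],
        subst integral_divide_zero[symmetric]) (simp add: algebra_simps diff_divide_distrib)
  have Q0: "((\<lambda>h. Q h z) \<longlongrightarrow> 0) (at 0)" for z
  proof -
    have "((\<lambda>h. norm (g (p + (norm z, z) + h) - g (p + (norm z, z)) - dir_deriv h g (p + (norm z, z))) / norm h) \<longlongrightarrow> 0) (at 0)"
      using smooth_has_derivative[OF g, of "p + (norm z, z)"] unfolding has_derivative_at by simp
    then have "((\<lambda>h. norm (Q h z)) \<longlongrightarrow> 0) (at 0)"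
      by (simp add: Q_def add.assoc add.commute[of "(norm z, z)"] abs_divide)
    then show ?thesis by (rule tendsto_norm_zero_cancel)
  qed
  have Qb: "\<bar>Q h z * m z\<bar> \<le> 2 * L * (indicator (cball 0 r) z *\<^sub>R \<bar>m z\<bar>)" if "norm h \<le> 1" "h \<noteq> 0" for h z
  proof (cases "norm z \<le> r")
    case True
    have n: "norm (p + h + (norm z, z) - p) \<le> 1 + 2 * r" "norm (p + (norm z, z) - p) \<le> 1 + 2 * r"
      using norm_triangle_ineq[of h "(norm z, z)"] norm_cone_le[of z] True that by auto
    have "\<bar>g (p + h + (norm z, z)) - g (p + (norm z, z))\<bar> \<le> L * norm h"
      using L(3)[OF n] by simp
    moreover have "\<bar>dir_deriv h g (p + (norm z, z))\<bar> \<le> L * norm h"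
      by (rule L(2)[OF n(2)])
    ultimately have "\<bar>Q h z\<bar> \<le> 2 * L"
      using that by (simp add: Q_def abs_divide divide_le_eq)
    then show ?thesis using True by (simp add: abs_mult mult_right_mono)
  next
    case False
    have "\<bar>fst h\<bar> \<le> 1" using norm_fst_le[of "fst h" "snd h"] that by simp
    then have "g (p + h + (norm z, z)) = 0" "g (p + (norm z, z)) = 0" "dir_deriv h g (p + (norm z, z)) = 0"
      using False by (auto intro!: vanishes_afterD[OF T] vanishes_afterD[OF vanishes_after_dir_deriv[OF T]] simp: r_def)
    then show ?thesis using L(1) by (simp add: Q_def)
  qed
  have "((\<lambda>h. LINT z|lborel. Q h z * m z) \<longlongrightarrow> 0) (at 0)"
    unfolding tendsto_at_iff_sequentially
  proof (intro allI impI)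
    fix X :: "nat \<Rightarrow> real \<times> 'a" assume X: "\<forall>i. X i \<in> UNIV - {0}" "X \<longlonglongrightarrow> 0"
    from X(2) obtain N where N: "\<And>n. n \<ge> N \<Longrightarrow> norm (X n) < 1"
      unfolding LIMSEQ_iff by (metis diff_zero zero_less_one)
    have "(\<lambda>n. LINT z|lborel. Q (X (n + N)) z * m z) \<longlonglongrightarrow> (LINT z|(lborel::'a measure). (0::real))"
    proof (rule integral_dominated_convergence[where w="\<lambda>z. 2 * L * (indicator (cball 0 r) z *\<^sub>R \<bar>m z\<bar>)"])
      show "integrable lborel (\<lambda>z. 2 * L * (indicator (cball 0 r) z *\<^sub>R \<bar>m z\<bar>))"
        using m set_integrable_abs[of lborel "cball 0 r" m]
        unfolding locally_integrable_def set_integrable_def by auto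
      have meas: "(\<lambda>z. a (q + (norm z, z))) \<in> borel_measurable lborel" if "continuous_on UNIV a" 
        for a :: "real \<times> 'a \<Rightarrow> real" and q
        using borel_measurable_continuous_onI[OF continuous_on_cone[OF that, of norm q]]
        by (simp add: continuous_on_norm_id)
      have "(\<lambda>z. Q h z) \<in> borel_measurable lborel" for h
        unfolding Q_def
        by (intro borel_measurable_divide borel_measurable_diff meas smooth_continuous_on smooth_dir_deriv g) auto
      then show "(\<lambda>z. Q (X (n + N)) z * m z) \<in> borel_measurable lborel" for n
        using m by (intro borel_measurable_times) (auto simp: locally_integrable_def)
      have "(\<lambda>n. Q (X (n + N)) z) \<longlonglongrightarrow> 0" for z
        using Q0[of z] X LIMSEQ_ignore_initial_segment[of _ 0 N]
        unfolding tendsto_at_iff_sequentially comp_def by blast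
      then show "AE z in lborel. (\<lambda>n. Q (X (n + N)) z * m z) \<longlonglongrightarrow> 0"
        by (auto intro!: AE_I2 tendsto_mult_left_zero)
      show "AE z in lborel. norm (Q (X (n + N)) z * m z) \<le> 2 * L * (indicator (cball 0 r) z *\<^sub>R \<bar>m z\<bar>)" for n
        using Qb[of "X (n + N)"] N[of "n + N"] X(1) by (auto simp: less_imp_le)
    qed auto
    then have "(\<lambda>n. LINT z|lborel. Q (X (n + N)) z * m z) \<longlonglongrightarrow> 0" by simp
    then show "((\<lambda>h. LINT z|lborel. Q h z * m z) \<circ> X) \<longlonglongrightarrow> 0"
      unfolding comp_def by (rule LIMSEQ_offset)
  qed
  then have "((\<lambda>h. norm (LINT z|lborel. Q h z * m z)) \<longlongrightarrow> 0) (at 0)"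
    by (rule tendsto_norm_zero)
  then have "((\<lambda>h. norm (cone_integral m g (p + h) - cone_integral m g p - cone_integral m (dir_deriv h g) p) / norm h) \<longlongrightarrow> 0) (at 0)"
    unfolding Qi[symmetric] by simp
  then show ?thesis
    unfolding has_derivative_at using lin by (simp add: linear_conv_bounded_linear)
qed

lemma dir_deriv_cone_integral:
  assumes "locally_integrable m" "smooth g" "vanishes_after T g"
  shows "dir_deriv v (cone_integral m g) = cone_integral m (dir_deriv v g)"
  by (intro ext dir_deriv_eqI) (rule cone_integral_has_derivative[OF assms])

lemma smooth_cone_integral:
  assumes "locally_integrable m" "smooth g" "vanishes_after T g"
  shows "smooth (cone_integral m g)"
proof (rule smooth_coinduct[of _ "cone_integral m ` {g. smooth g \<and> vanishes_after T g}"])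
  fix f v assume "f \<in> cone_integral m ` {g. smooth g \<and> vanishes_after T g}"
  then obtain g where g: "f = cone_integral m g" "smooth g" "vanishes_after T g" by auto
  show "f differentiable at x" for x
    using cone_integral_has_derivative[OF assms(1) g(2,3), of x] g(1) unfolding differentiable_def by blast
  show "dir_deriv v f \<in> cone_integral m ` {g. smooth g \<and> vanishes_after T g}"
    using g(1) dir_deriv_cone_integral[OF assms(1) g(2,3)] smooth_dir_deriv[OF g(2), of v]
      vanishes_after_dir_deriv[OF g(3), of v] by auto
qed (use assms in auto)

lemma vanishes_after_cone_integral:
  assumes "vanishes_after T g" shows "vanishes_after T (cone_integral m g)"
  unfolding vanishes_after_def cone_integral_def
proof (intro allI impI)
  fix t :: real and x :: 'a assume "t > T"
  then have "t + norm z > T" for z :: 'a using norm_ge_zero[of z] by linarith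
  then have "g ((t, x) + (norm z, z)) = 0" for z
    by (intro vanishes_afterD[OF assms]) simp
  then show "(LINT z|lborel. g ((t, x) + (norm z, z)) * m z) = 0" by simp
qed

lemma integral_translation:
  fixes f :: "'a::euclidean_space \<Rightarrow> real"
  assumes "f \<in> borel_measurable borel"
  shows "(LINT z|lborel. f (z + c)) = (LINT z|lborel. f z)"
proof -
  have "(LINT z|distr lborel borel ((+) c). f z) = (LINT z|lborel. f (c + z))"
    by (rule integral_distr) (use assms in auto)
  then show ?thesis by (simp add: lborel_distr_plus add.commute)
qed

lemma integrable_continuous_bounded_support:
  fixes f :: "'a::euclidean_space \<Rightarrow> real"
  assumes "continuous_on UNIV f" "\<And>z. norm z > r \<Longrightarrow> f z = 0"
  shows "integrable lborel f"
proof -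
  have "integrable lborel (\<lambda>z. indicator (cball 0 r) z *\<^sub>R f z)"
    by (intro borel_integrable_compact continuous_on_subset[OF assms(1)]) auto
  moreover have "(\<lambda>z. indicator (cball 0 r) z *\<^sub>R f z) = f"
    using assms(2) by (auto simp: indicator_def fun_eq_iff not_le)
  ultimately show ?thesis by simp
qed

text \<open>The difference quotients in direction \<open>b\<close> have integral 0 by translation invariance.\<close>

lemma integral_directional_derivative_eq_0:
  fixes X Y :: "'a::euclidean_space \<Rightarrow> real"
  assumes deriv: "\<And>z. ((\<lambda>t. X (z + t *\<^sub>R b)) has_real_derivative Y z) (at 0)"
    and cX: "continuous_on UNIV X" and cY: "continuous_on UNIV Y"
    and sX: "\<And>z. norm z > r \<Longrightarrow> X z = 0" and sY: "\<And>z. norm z > r \<Longrightarrow> Y z = 0"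
  shows "(LINT z|lborel. Y z) = 0"
proof -
  define a where "a n = (1::real) / Suc n" for n
  have a0: "a \<longlonglongrightarrow> 0" unfolding a_def by (rule LIMSEQ_Suc[OF lim_1_over_n])
  have apos: "a n > 0" "a n \<le> 1" for n by (auto simp: a_def)
  have deriv': "((\<lambda>t. X (z + t *\<^sub>R b)) has_real_derivative Y (z + t *\<^sub>R b)) (at t)" for z t
    using deriv[of "z + t *\<^sub>R b"] DERIV_shift[of "\<lambda>t. X (z + t *\<^sub>R b)" "Y (z + t *\<^sub>R b)" 0 t]
    by (simp add: algebra_simps)
  define D where "D n z = (X (z + a n *\<^sub>R b) - X z) / a n" for n z
  have Xi: "integrable lborel X" by (rule integrable_continuous_bounded_support[OF cX sX])
  have mX: "X \<in> borel_measurable borel" by (rule borel_measurable_continuous_onI[OF cX])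
  have "(LINT z|lborel. D n z) = 0" for n
  proof -
    have "integrable lborel (\<lambda>z. X (z + a n *\<^sub>R b))"
    proof (rule integrable_continuous_bounded_support)
      show "continuous_on UNIV (\<lambda>z. X (z + a n *\<^sub>R b))"
        by (rule continuous_on_compose2[OF cX]) (auto intro!: continuous_intros)
      show "X (z + a n *\<^sub>R b) = 0" if "norm z > r + norm (a n *\<^sub>R b)" for z
        using norm_triangle_ineq4[of "z + a n *\<^sub>R b" "a n *\<^sub>R b"] that by (intro sX) simp
    qed
    then show ?thesis unfolding D_def integral_divide_zero
      by (subst Bochner_Integration.integral_diff) (auto simp: Xi integral_translation[OF mX])
  qed
  moreover have "(\<lambda>n. LINT z|lborel. D n z) \<longlonglongrightarrow> (LINT z|lborel. Y z)"
  proof -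
    have "bounded (Y ` cball 0 r)"
      by (intro compact_imp_bounded compact_continuous_image continuous_on_subset[OF cY]) auto
    then obtain B where B: "\<And>z. norm z \<le> r \<Longrightarrow> \<bar>Y z\<bar> \<le> B"
      unfolding bounded_iff by (metis imageI mem_cball_0 real_norm_def)
    have B': "\<bar>Y z\<bar> \<le> \<bar>B\<bar>" for z using B[of z] sY[of z] by (cases "norm z \<le> r") auto
    define w where "w z = indicator (cball 0 (r + norm b)) z *\<^sub>R \<bar>B\<bar>" for z :: 'a
    show ?thesis
    proof (rule integral_dominated_convergence[where w=w])
      show "integrable lborel w" unfolding w_def
        by (intro borel_integrable_compact continuous_intros) auto
      show "Y \<in> borel_measurable lborel" using borel_measurable_continuous_onI[OF cY] by simp
      show "D n \<in> borel_measurable lborel" for n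
        unfolding D_def using mX by measurable
      have "(\<lambda>n. D n z) \<longlonglongrightarrow> Y z" for z
      proof -
        have "((\<lambda>h. (X (z + h *\<^sub>R b) - X z) / h) \<longlongrightarrow> Y z) (at 0)"
          using deriv[of z] by (simp add: DERIV_def)
        moreover have "filterlim a (at 0) sequentially"
          unfolding filterlim_at using a0 apos by (auto intro!: always_eventually simp: less_imp_neq[symmetric])
        ultimately show ?thesis unfolding D_def by (rule filterlim_compose)
      qed
      then show "AE z in lborel. (\<lambda>n. D n z) \<longlonglongrightarrow> Y z" by simp
      have "\<bar>D n z\<bar> \<le> w z" for n z
      proof (cases "norm z \<le> r + norm b")
        case True
        \<comment> \<open>By the mean value theorem the difference quotient is a value of
          \<open>Y\<close>, hence bounded uniformly in n; this is the domination.\<close>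
        obtain t where "X (z + a n *\<^sub>R b) - X (z + 0 *\<^sub>R b) = (a n - 0) * Y (z + t *\<^sub>R b)"
          using MVT2[OF apos(1)[of n], of "\<lambda>t. X (z + t *\<^sub>R b)" "\<lambda>t. Y (z + t *\<^sub>R b)"] deriv' by blast
        then have "D n z = Y (z + t *\<^sub>R b)" using apos(1)[of n] by (simp add: D_def)
        then show ?thesis using True B' by (simp add: w_def)
      next
        case False
        have "norm (a n *\<^sub>R b) \<le> norm b" using apos[of n] by (simp add: mult_left_le_one_le)
        then have "X (z + a n *\<^sub>R b) = 0"
          using norm_triangle_ineq4[of "z + a n *\<^sub>R b" "a n *\<^sub>R b"] False by (intro sX) simp
        moreover have "X z = 0" using False norm_ge_zero[of b] by (intro sX) linarith
        ultimately show ?thesis by (simp add: D_def w_def)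
      qed
      then show "AE z in lborel. norm (D n z) \<le> w z" for n by simp
    qed
  qed
  ultimately show ?thesis using LIMSEQ_unique[OF _ tendsto_const[of 0]] by simp
qed

section \<open>The divergence theorem on hyperboloids\<close>

text \<open>Dyadic substitute for polar coordinates: |f| is dominated almost everywhere by a series
  of constants times indicators of balls, and a ball of radius r has volume proportional to r^d. The
  origin is left out so that \<open>f\<close> may be singular there.\<close>

lemma integrable_ball_cover:
  fixes f :: "'a::euclidean_space \<Rightarrow> real"
  assumes "f \<in> borel_measurable borel" and c: "\<And>n. c n \<ge> 0" and r: "\<And>n. r n \<ge> 0"
    and cover: "\<And>z. z \<noteq> 0 \<Longrightarrow> f z \<noteq> 0 \<Longrightarrow> \<exists>n. norm z \<le> r n \<and> \<bar>f z\<bar> \<le> c n"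
    and sm: "summable (\<lambda>n. c n * r n ^ DIM('a))"
  shows "integrable lborel f"
proof (rule integrableI_bounded)
  show "f \<in> borel_measurable lborel" using assms(1) by simp
  have "(\<integral>\<^sup>+ z. ennreal (norm (f z)) \<partial>lborel) \<le> (\<integral>\<^sup>+ z. (\<Sum>n. ennreal (c n) * indicator (cball 0 (r n)) z) \<partial>(lborel :: 'a measure))"
  proof (rule nn_integral_mono_AE)
    have "AE z in lborel. z \<noteq> (0::'a)" by (rule AE_lborel_singleton)
    then show "AE z in lborel. ennreal (norm (f z)) \<le> (\<Sum>n. ennreal (c n) * indicator (cball 0 (r n)) z)"
    proof eventually_elim
      fix z :: 'a assume z: "z \<noteq> 0"
      show "ennreal (norm (f z)) \<le> (\<Sum>n. ennreal (c n) * indicator (cball 0 (r n)) z)"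
      proof (cases "f z = 0")
        case False
        with cover z obtain n where n: "norm z \<le> r n" "\<bar>f z\<bar> \<le> c n" by blast
        then have "ennreal (norm (f z)) \<le> (\<Sum>n<Suc n. ennreal (c n) * indicator (cball 0 (r n)) z)"
          by (auto intro: add_increasing ennreal_leI)
        also have "\<dots> \<le> (\<Sum>n. ennreal (c n) * indicator (cball 0 (r n)) z)"
          by (rule sum_le_suminf) auto
        finally show ?thesis .
      qed simp
    qed
  qed
  also have "\<dots> = (\<Sum>n. \<integral>\<^sup>+ z. ennreal (c n) * indicator (cball 0 (r n)) z \<partial>(lborel :: 'a measure))"
  proof (rule nn_integral_suminf)
    have [measurable]: "cball (0::'a) (r n) \<in> sets borel" for n by simp
    show "(\<lambda>z::'a. ennreal (c n) * indicator (cball 0 (r n)) z) \<in> borel_measurable lborel" for n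
      by measurable
  qed
  also have "\<dots> = (\<Sum>n. ennreal (unit_ball_vol (real DIM('a)) * (c n * r n ^ DIM('a))))"
    using c r by (intro suminf_cong)
      (simp add: nn_integral_cmult_indicator emeasure_cball ennreal_mult'' mult.left_commute)
  also have "\<dots> < \<infinity>"
    using c r by (subst suminf_ennreal2) (auto intro!: summable_mult sm)
  finally show "(\<integral>\<^sup>+ z. ennreal (norm (f z)) \<partial>lborel) < \<infinity>" .
qed

lemma power_two_interval:
  fixes x :: real assumes "x \<ge> 1"
  obtains n :: nat where "2 ^ n \<le> x" "x < 2 ^ Suc n"
proof -
  obtain N :: nat where "x < 2 ^ N" using real_arch_pow[of 2 x] by auto
  then have ex: "\<exists>n. x < 2 ^ n" by blast
  define k where "k = (LEAST n. x < 2 ^ n)"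
  have k: "x < 2 ^ k" unfolding k_def by (rule LeastI_ex[OF ex])
  with assms have "k \<noteq> 0" by (cases k) auto
  then obtain n where n: "k = Suc n" by (cases k) auto
  then have "\<not> x < 2 ^ n" using not_less_Least[of n "\<lambda>n. x < 2 ^ n"] k_def by auto
  with n k show ?thesis by (intro that[of n]) auto
qed

text \<open>On the shell 2^(-n-1) < |z| <= 2^(-n) the function is below 4^(n+1), while the enclosing
  ball has volume of order 8^(-n), so the products are summable. Outside the unit ball the function
  is at most 1.\<close>

lemma locally_integrable_inverse_norm_square:
  "locally_integrable (\<lambda>z::real^3. 1 / (norm z)\<^sup>2)"
  unfolding locally_integrable_def set_integrable_def
proof (intro conjI allI)
  fix r :: real
  define A where "A z = (if norm z < 1 then 1 / (norm z)\<^sup>2 else 0)" for z :: "real^3"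
  have Ai: "integrable lborel A"
  proof (rule integrable_ball_cover[of _ "\<lambda>n. 4 ^ Suc n" "\<lambda>n. (1/2) ^ n"])
    fix z :: "real^3" assume z: "z \<noteq> 0" "A z \<noteq> 0"
    then have z1: "norm z < 1" by (auto simp: A_def split: if_splits)
    obtain n where n: "2 ^ n \<le> 1 / norm z" "1 / norm z < 2 ^ Suc n"
      using power_two_interval[of "1 / norm z"] z1 z by auto
    have "norm z \<le> (1/2) ^ n" using n(1) z by (simp add: field_simps power_divide)
    moreover have "(1 / norm z)\<^sup>2 \<le> (2 ^ Suc n)\<^sup>2" using n(2) by (intro power_mono) auto
    then have "\<bar>A z\<bar> \<le> 4 ^ Suc n" using z1
      by (simp add: A_def power_divide power_mult[symmetric] mult.commute[of _ 2] power_mult)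
    ultimately show "\<exists>n. norm z \<le> (1/2) ^ n \<and> \<bar>A z\<bar> \<le> 4 ^ Suc n" by blast
  next
    have "(\<lambda>n. 4 ^ Suc n * ((1/2) ^ n) ^ DIM(real^3)) = (\<lambda>n. 4 * (1/2::real) ^ n)"
    proof
      fix n
      have "(((1/2) ^ n) ^ 3 :: real) = (1/8) ^ n" by (simp add: power3_eq_cube power_mult_distrib[symmetric])
      then show "4 ^ Suc n * ((1/2) ^ n) ^ DIM(real^3) = 4 * (1/2::real) ^ n"
        by (simp add: power_mult_distrib[symmetric])
    qed
    then show "summable (\<lambda>n. 4 ^ Suc n * ((1/2::real) ^ n) ^ DIM(real^3))"
      by (simp only:) (intro summable_mult summable_geometric, simp)
    show "A \<in> borel_measurable borel" unfolding A_def[abs_def] by measurable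
  qed auto
  have "integrable lborel (\<lambda>z::real^3. indicator (cball 0 r) z *\<^sub>R (1::real))"
    by (intro borel_integrable_compact continuous_intros) auto
  from Bochner_Integration.integrable_add[OF this Ai]
  show "integrable lborel (\<lambda>z::real^3. indicator (cball 0 r) z *\<^sub>R (1 / (norm z)\<^sup>2))"
  proof (rule Bochner_Integration.integrable_bound; (intro AE_I2)?)
    fix z :: "real^3"
    show "norm (indicator (cball 0 r) z *\<^sub>R (1 / (norm z)\<^sup>2)) \<le> norm (indicator (cball 0 r) z *\<^sub>R 1 + A z)"
    proof (cases "norm z < 1")
      case False
      then have "1 / (norm z)\<^sup>2 \<le> 1" by (simp add: divide_le_eq_1)
      then show ?thesis using False by (auto simp: indicator_def A_def)
    qed (auto simp: indicator_def A_def)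
  next
    show "(\<lambda>z::real^3. indicator (cball 0 r) z *\<^sub>R (1 / (norm z)\<^sup>2)) \<in> borel_measurable lborel"
      by (auto intro!: borel_measurable_divide borel_measurable_indicator)
  qed
qed auto

lemma locally_integrable_mono:
  assumes "locally_integrable m" "n \<in> borel_measurable borel"
    and "\<And>r. \<exists>C. \<forall>z. norm z \<le> r \<longrightarrow> \<bar>n z\<bar> \<le> C * \<bar>m z\<bar>"
  shows "locally_integrable n"
  unfolding locally_integrable_def set_integrable_def
proof (intro conjI allI)
  fix r
  obtain C where C: "\<And>z. norm z \<le> r \<Longrightarrow> \<bar>n z\<bar> \<le> C * \<bar>m z\<bar>" using assms(3) by blast
  have "integrable lborel (\<lambda>z. C * (indicator (cball 0 r) z *\<^sub>R m z))"
    using assms(1) unfolding locally_integrable_def set_integrable_def by auto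
  then show "integrable lborel (\<lambda>z. indicator (cball 0 r) z *\<^sub>R n z)"
  proof (rule Bochner_Integration.integrable_bound; (intro AE_I2)?)
    fix z
    have "\<bar>n z\<bar> \<le> \<bar>C\<bar> * \<bar>m z\<bar>" if "norm z \<le> r"
      using C[OF that] abs_ge_self[of C] mult_right_mono[of C "\<bar>C\<bar>" "\<bar>m z\<bar>"] by auto
    then show "norm (indicator (cball 0 r) z *\<^sub>R n z) \<le> norm (C * (indicator (cball 0 r) z *\<^sub>R m z))"
      by (auto simp: indicator_def abs_mult)
  next
    show "(\<lambda>z. indicator (cball 0 r) z *\<^sub>R n z) \<in> borel_measurable lborel"
      using assms(2) by (auto intro!: borel_measurable_times borel_measurable_indicator)
  qed
qed (rule assms(2))

lemma locally_integrable_inverse_norm: "locally_integrable (\<lambda>z::real^3. 1 / norm z)"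
proof (rule locally_integrable_mono[OF locally_integrable_inverse_norm_square])
  show "\<exists>C. \<forall>z::real^3. norm z \<le> r \<longrightarrow> \<bar>1 / norm z\<bar> \<le> C * \<bar>1 / (norm z)\<^sup>2\<bar>" for r
    by (rule exI[of _ r]) (auto simp: power2_eq_square divide_simps mult_right_mono)
qed auto

lemma locally_integrable_1: "locally_integrable (\<lambda>z::real^3. 1)"
  unfolding locally_integrable_def set_integrable_def
proof (intro conjI allI)
  show "integrable lborel (\<lambda>z::real^3. indicator (cball 0 r) z *\<^sub>R (1::real))" for r
    by (intro borel_integrable_compact continuous_intros) auto
qed auto

text \<open>The divergence theorem for the field
  \<open>(m(s) g\<^sub>t + m'(s) g) z / s - m(s) \<nabla>g\<close>, where \<open>s\<close> is a smooth approximation of \<open>norm z\<close> and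
  \<open>g\<close> is evaluated on the hyperboloid \<open>p + (s, z)\<close>.\<close>

lemma hyperboloid_identity:
  fixes g :: "real \<times> 'a::euclidean_space \<Rightarrow> real" and \<epsilon> :: real and m m' m'' :: "real \<Rightarrow> real"
  assumes eps: "\<epsilon> > 0" and g: "smooth g" and T: "vanishes_after T g"
    and m: "\<And>\<sigma>. \<sigma> > 0 \<Longrightarrow> (m has_real_derivative m' \<sigma>) (at \<sigma>)"
    and m': "\<And>\<sigma>. \<sigma> > 0 \<Longrightarrow> (m' has_real_derivative m'' \<sigma>) (at \<sigma>)"
    and m'': "continuous_on {0<..} m''"
  defines "s \<equiv> \<lambda>z::'a. sqrt ((norm z)\<^sup>2 + \<epsilon>\<^sup>2)"
  shows "(LINT z|lborel.
      m (s z) * ((norm z)\<^sup>2 * (1 / s z) ^ 2 * dir_deriv (1, 0) (dir_deriv (1, 0) g) (p + (s z, z))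
         - (\<Sum>b\<in>Basis. dir_deriv (0, b) (dir_deriv (0, b) g) (p + (s z, z))))
      + dir_deriv (1, 0) g (p + (s z, z)) * (m (s z) * (DIM('a) * (1 / s z) - (norm z)\<^sup>2 * (1 / s z) ^ 3)
          + 2 * m' (s z) * (norm z)\<^sup>2 * (1 / s z) ^ 2)
      + g (p + (s z, z)) * (DIM('a) * m' (s z) * (1 / s z) - m' (s z) * (norm z)\<^sup>2 * (1 / s z) ^ 3
          + m'' (s z) * (norm z)\<^sup>2 * (1 / s z) ^ 2)) = 0"
    (is "integral\<^sup>L lborel ?I = 0")
proof -
  have spos: "s z > 0" for z unfolding s_def using eps by (simp add: add_nonneg_pos)
  have sge: "s z \<ge> norm z" for z unfolding s_def by (rule real_le_rsqrt) simp
  have cs: "continuous_on UNIV s" unfolding s_def by (intro continuous_intros)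
  have cm: "continuous_on UNIV (\<lambda>z. f (s z))" if "continuous_on {0<..} f" for f :: "real \<Rightarrow> real"
    by (rule continuous_on_compose2[OF that cs]) (use spos in auto)
  have cd: "continuous_on {0<..} f" if "\<And>\<sigma>. \<sigma> > 0 \<Longrightarrow> (f has_real_derivative f' \<sigma>) (at \<sigma>)"
    for f f' :: "real \<Rightarrow> real"
    by (rule DERIV_continuous_on, rule has_field_derivative_at_within, rule that, simp)
  note cms = cm[OF cd[OF m]] cm[OF cd[OF m']] cm[OF m'']
  have cu: "continuous_on UNIV (\<lambda>z. 1 / s z)"
    by (intro continuous_intros cs) (use spos in \<open>auto simp: less_imp_neq[symmetric]\<close>)
  have ca: "continuous_on UNIV (\<lambda>z. a (p + (s z, z)))" if "smooth a" for a :: "real \<times> 'a \<Rightarrow> real"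
    by (rule continuous_on_cone[OF smooth_continuous_on[OF that] cs])
  have ds: "((\<lambda>t. s (z + t *\<^sub>R b)) has_real_derivative (z \<bullet> b) * (1 / s z)) (at 0)" for z b
  proof -
    have "((\<lambda>t. sqrt ((norm z)\<^sup>2 + 2 * t * (z \<bullet> b) + t\<^sup>2 * (norm b)\<^sup>2 + \<epsilon>\<^sup>2)) has_real_derivative
        (z \<bullet> b) * (1 / s z)) (at 0)"
      using spos[of z] by (auto intro!: derivative_eq_intros simp: s_def real_sqrt_gt_0_iff field_simps)
    moreover have "(norm (z + t *\<^sub>R b))\<^sup>2 = (norm z)\<^sup>2 + 2 * t * (z \<bullet> b) + t\<^sup>2 * (norm b)\<^sup>2" for t
      unfolding power2_norm_eq_inner by (simp add: inner_simps inner_commute power2_eq_square algebra_simps)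
    ultimately show ?thesis by (simp add: s_def)
  qed
  have du: "((\<lambda>t. 1 / s (z + t *\<^sub>R b)) has_real_derivative - (z \<bullet> b) * (1 / s z) ^ 3) (at 0)" for z b
    using spos[of z] by (auto intro!: derivative_eq_intros ds simp: power3_eq_cube)
  have dm: "((\<lambda>t. f (s (z + t *\<^sub>R b))) has_real_derivative f' (s z) * ((z \<bullet> b) * (1 / s z))) (at 0)"
    if "\<And>\<sigma>. \<sigma> > 0 \<Longrightarrow> (f has_real_derivative f' \<sigma>) (at \<sigma>)" for f f' z b
    using DERIV_chain2[OF _ ds, of f "f' (s z)" z b] that[OF spos[of z]] by simp
  have dc: "((\<lambda>t. (z + t *\<^sub>R b) \<bullet> b) has_real_derivative 1) (at 0)" if "b \<in> Basis" for z b :: 'a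
    using that by (auto intro!: derivative_eq_intros simp: inner_add_left)
  have da: "((\<lambda>t. a (p + (s (z + t *\<^sub>R b), z + t *\<^sub>R b))) has_real_derivative
      ((z \<bullet> b) * (1 / s z)) * dir_deriv (1, 0) a (p + (s z, z)) + dir_deriv (0, b) a (p + (s z, z))) (at 0)"
    if a: "smooth a" for a :: "real \<times> 'a \<Rightarrow> real" and z b
  proof -
    have "((\<lambda>t. s (z + t *\<^sub>R b)) has_derivative (\<lambda>h. ((z \<bullet> b) * (1 / s z)) * h)) (at 0)"
      using ds by (rule has_field_derivative_imp_has_derivative)
    then have "((\<lambda>t. p + (s (z + t *\<^sub>R b), z + t *\<^sub>R b)) has_derivative
        (\<lambda>h. (((z \<bullet> b) * (1 / s z)) * h, h *\<^sub>R b))) (at 0)"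
      by (auto intro!: derivative_eq_intros)
    from has_derivative_compose[OF this smooth_has_derivative[OF a]]
    have "((\<lambda>t. a (p + (s (z + t *\<^sub>R b), z + t *\<^sub>R b))) has_derivative
        (\<lambda>h. dir_deriv (((z \<bullet> b) * (1 / s z)) * h, h *\<^sub>R b) a (p + (s z, z)))) (at 0)" by simp
    moreover have e: "dir_deriv (c * h, h *\<^sub>R b) a q = (c * dir_deriv (1, 0) a q + dir_deriv (0, b) a q) * h" for c h q
    proof -
      have "(c * h, h *\<^sub>R b) = (c * h) *\<^sub>R (1, 0) + h *\<^sub>R (0, b)" by simp
      then show ?thesis
        by (simp only: linear_add[OF linear_dir_deriv[OF a]] linear_scale[OF linear_dir_deriv[OF a]])
           (simp add: algebra_simps)
    qed
    ultimately show ?thesis unfolding has_field_derivative_def by (simp only: e)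
  qed
  let ?at = "\<lambda>a z. a (p + (s z, z)) :: real"
  \<comment> \<open>\<open>X b\<close> is the component of the field along \<open>b\<close> and
    \<open>Y b\<close> its derivative in that direction, so the sum of the \<open>Y b\<close> is the
    divergence.\<close>
  define X where "X b z = (z \<bullet> b) * (1 / s z) * m (s z) * ?at (dir_deriv (1, 0) g) z
     - m (s z) * ?at (dir_deriv (0, b) g) z + (z \<bullet> b) * (1 / s z) * m' (s z) * ?at g z" for b z
  define Y where "Y b z = (1 / s z) * (m (s z) * ?at (dir_deriv (1, 0) g) z + m' (s z) * ?at g z)
     + (z \<bullet> b) ^ 2 * ((1 / s z) ^ 2 * (m (s z) * ?at (dir_deriv (1, 0) (dir_deriv (1, 0) g)) z
           + 2 * m' (s z) * ?at (dir_deriv (1, 0) g) z + m'' (s z) * ?at g z)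
         - (1 / s z) ^ 3 * (m (s z) * ?at (dir_deriv (1, 0) g) z + m' (s z) * ?at g z))
     - m (s z) * ?at (dir_deriv (0, b) (dir_deriv (0, b) g)) z" for b z
  note cas = ca[OF g] ca[OF smooth_dir_deriv[OF g]] ca[OF smooth_dir_deriv[OF smooth_dir_deriv[OF g]]]
  note conts = continuous_on_add continuous_on_diff continuous_on_mult continuous_on_power
    continuous_on_inner continuous_on_id continuous_on_const cms cu cas
  have zero: "?at a z = 0" if "vanishes_after T a" "norm z > T - fst p" for a z
    by (rule vanishes_afterD[OF that(1)]) (use that(2) sge[of z] in auto)
  note van = T vanishes_after_dir_deriv[OF T] vanishes_after_dir_deriv[OF vanishes_after_dir_deriv[OF T]]
  have cY: "continuous_on UNIV (Y b)" for b
    unfolding Y_def by (intro conts)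
  have sY: "Y b z = 0" if "norm z > T - fst p" for b z
    using that by (simp add: Y_def zero van)
  have Y0: "(LINT z|lborel. Y b z) = 0" if b: "b \<in> Basis" for b
  proof (rule integral_directional_derivative_eq_0)
    show "((\<lambda>t. X b (z + t *\<^sub>R b)) has_real_derivative Y b z) (at 0)" for z
    proof -
      \<comment> \<open>Mixed derivatives in time and space arise once from the term with g_t and
        once from the gradient term, with opposite signs and in opposite order; symmetry lets them
        cancel.\<close>
      have c: "dir_deriv (1, 0) (dir_deriv (0, b) g) = dir_deriv (0, b) (dir_deriv (1, 0) g)"
        by (intro ext dir_deriv_commute g)
      show ?thesis
        unfolding X_def
        by (rule derivative_eq_intros dc[OF b] du dm[OF m] dm[OF m'] da[OF smooth_dir_deriv[OF g]] da[OF g] refl | assumption)+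
           (simp add: Y_def c algebra_simps power2_eq_square power3_eq_cube)
    qed
    show "continuous_on UNIV (X b)"
      unfolding X_def by (intro conts)
    show "X b z = 0" if "norm z > T - fst p" for z
      using that by (simp add: X_def zero van)
  qed (use cY sY in auto)
  have "?I z = (\<Sum>b\<in>Basis. Y b z)" for z
  proof -
    have "(\<Sum>b\<in>Basis. (z \<bullet> b) ^ 2) = (norm z)\<^sup>2"
      unfolding power2_norm_eq_inner by (subst euclidean_inner) (simp add: power2_eq_square)
    then show ?thesis
      unfolding Y_def sum.distrib sum_subtractf sum_distrib_left[symmetric] sum_distrib_right[symmetric] sum_constant
      by (simp only:) (simp add: algebra_simps)
  qed
  then have "integral\<^sup>L lborel ?I = (LINT z|lborel. (\<Sum>b\<in>Basis. Y b z))" by simp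
  also have "\<dots> = (\<Sum>b\<in>Basis. LINT z|lborel. Y b z)"
    by (rule Bochner_Integration.integral_sum) (rule integrable_continuous_bounded_support[OF cY sY])
  also have "\<dots> = 0" using Y0 by simp
  finally show ?thesis .
qed

section \<open>The backward fundamental solution\<close>

text \<open>Uniformity in \<epsilon> is the point: the hyperboloids stay within time 1 above the
  cone, so one ball and one bound serve as majorant for the whole limit.\<close>

lemma hyperboloid_bound:
  fixes a :: "real \<times> 'a::euclidean_space \<Rightarrow> real"
  assumes "smooth a" and T: "vanishes_after T a"
  obtains B r where "B \<ge> 0"
    "\<And>\<epsilon> z. 0 \<le> \<epsilon> \<Longrightarrow> \<epsilon> \<le> 1 \<Longrightarrow>
      \<bar>a (p + (sqrt ((norm z)\<^sup>2 + \<epsilon>\<^sup>2), z))\<bar> \<le> B * indicator (cball 0 r) z"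
proof -
  define r where "r = \<bar>T - fst p\<bar>"
  have "bounded (a ` cball p (2 * r + 1))"
    by (intro compact_imp_bounded compact_continuous_image smooth_continuous_on assms) auto
  then obtain B where B: "\<And>q. norm (q - p) \<le> 2 * r + 1 \<Longrightarrow> \<bar>a q\<bar> \<le> B"
    unfolding bounded_iff by (metis imageI mem_cball dist_norm dist_commute real_norm_def)
  show ?thesis
  proof (rule that[of "\<bar>B\<bar>" r])
    fix \<epsilon> :: real and z :: 'a assume e: "0 \<le> \<epsilon>" "\<epsilon> \<le> 1"
    define s where "s = sqrt ((norm z)\<^sup>2 + \<epsilon>\<^sup>2)"
    have s: "norm z \<le> s" "s \<le> norm z + \<epsilon>"
      unfolding s_def using e by (auto intro: real_le_rsqrt sqrt_sum_squares_le_sum)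
    show "\<bar>a (p + (sqrt ((norm z)\<^sup>2 + \<epsilon>\<^sup>2), z))\<bar> \<le> \<bar>B\<bar> * indicator (cball 0 r) z"
    proof (cases "norm z \<le> r")
      case True
      have "norm (s, z) \<le> norm z + norm z + \<epsilon>"
        using norm_triangle_ineq[of "(s, 0)" "(0, z)"] s norm_ge_zero[of z] by (simp add: norm_Pair)
      then have "\<bar>a (p + (s, z))\<bar> \<le> B" using True e by (intro B) simp
      then show ?thesis using True by (simp add: s_def)
    next
      case False
      then have "a (p + (s, z)) = 0" using s by (intro vanishes_afterD[OF T]) (simp add: r_def)
      then show ?thesis by (simp add: s_def)
    qed
  qed simp
qed

abbreviation hyp :: "nat \<Rightarrow> 'a::real_normed_vector \<Rightarrow> real" where
  "hyp n z \<equiv> sqrt ((norm z)\<^sup>2 + (1 / Suc n)\<^sup>2)"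

lemma hyp_pos: "hyp n z > 0"
  by (simp add: add_nonneg_pos)

lemma inverse_hyp_le: "1 / hyp n z \<le> 1 / norm z" if "z \<noteq> 0"
  using that hyp_pos[of z n] by (intro divide_left_mono real_le_rsqrt) auto

lemma inverse_hyp_le2: "1 / Suc n * (1 / hyp n z) \<le> 1"
proof -
  have "1 / Suc n \<le> hyp n z" by (rule real_le_rsqrt) simp
  then show ?thesis using hyp_pos[of z n] by (simp add: field_simps)
qed

lemma norm_inverse_hyp_le: "norm z * (1 / hyp n z) \<le> 1"
proof -
  have "norm z \<le> hyp n z" by (rule real_le_rsqrt) simp
  then show ?thesis using hyp_pos[of z n] by (simp add: field_simps)
qed

lemma inverse_Suc_tendsto: "(\<lambda>n. 1 / real (Suc n)) \<longlonglongrightarrow> 0"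
  by (rule LIMSEQ_Suc[OF lim_1_over_n])

lemma hyp_tendsto: "(\<lambda>n. hyp n z) \<longlonglongrightarrow> norm z"
proof -
  have "(\<lambda>n. hyp n z) \<longlonglongrightarrow> sqrt ((norm z)\<^sup>2 + 0\<^sup>2)"
    by (intro tendsto_intros inverse_Suc_tendsto)
  then show ?thesis by simp
qed

text \<open>Dominated convergence as the hyperboloids with \<epsilon> = 1/(n+1) approach the light
  cone. Limit and majorant are required only off the vertex, a null set, because the weights to be
  inserted may blow up there.\<close>

lemma hyperboloid_limit:
  fixes a :: "real \<times> 'a::euclidean_space \<Rightarrow> real" and \<phi> :: "nat \<Rightarrow> 'a \<Rightarrow> real"
  assumes a: "smooth a" and T: "vanishes_after T a" and M: "locally_integrable M"
    and ms: "\<And>n. \<phi> n \<in> borel_measurable borel" "\<phi>' \<in> borel_measurable borel"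
    and lim: "\<And>z. z \<noteq> 0 \<Longrightarrow> (\<lambda>n. \<phi> n z) \<longlonglongrightarrow> \<phi>' z"
    and bd: "\<And>n z. z \<noteq> 0 \<Longrightarrow> \<bar>\<phi> n z\<bar> \<le> M z"
  shows "integrable lborel (\<lambda>z. a (p + (hyp n z, z)) * \<phi> n z)"
    and "(\<lambda>n. LINT z|lborel. a (p + (hyp n z, z)) * \<phi> n z) \<longlonglongrightarrow> cone_integral \<phi>' a p"
proof -
  obtain B r where B: "B \<ge> 0" "\<And>\<epsilon> z. 0 \<le> \<epsilon> \<Longrightarrow> \<epsilon> \<le> 1 \<Longrightarrow>
      \<bar>a (p + (sqrt ((norm z)\<^sup>2 + \<epsilon>\<^sup>2), z))\<bar> \<le> B * indicator (cball 0 r) z"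
    using hyperboloid_bound[OF a T, where p=p] by metis
  have AE0: "AE z in lborel. z \<noteq> (0::'a)" by (rule AE_lborel_singleton)
  have ca: "continuous_on UNIV (\<lambda>z. a (p + (hyp n z, z)))" for n
    by (rule continuous_on_cone[OF smooth_continuous_on[OF a]]) (intro continuous_intros)
  have ca': "continuous_on UNIV (\<lambda>z. a (p + (norm z, z)))"
    by (rule continuous_on_cone[OF smooth_continuous_on[OF a]]) (intro continuous_intros)
  note meas = borel_measurable_continuous_onI[OF ca] borel_measurable_continuous_onI[OF ca']
  have W: "integrable lborel (\<lambda>z. B * (indicator (cball 0 r) z *\<^sub>R M z))"
    using M unfolding locally_integrable_def set_integrable_def by auto
  have m: "(\<lambda>z. a (p + (hyp n z, z)) * \<phi> n z) \<in> borel_measurable lborel" for n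
    using meas(1)[of n] ms(1)[of n] by auto
  have bound: "AE z in lborel. norm (a (p + (hyp n z, z)) * \<phi> n z) \<le> B * (indicator (cball 0 r) z *\<^sub>R M z)" for n
    using AE0
  proof eventually_elim
    fix z :: 'a assume z: "z \<noteq> 0"
    have "\<bar>a (p + (hyp n z, z))\<bar> * \<bar>\<phi> n z\<bar> \<le> (B * indicator (cball 0 r) z) * M z"
      using B bd[OF z] by (intro mult_mono) auto
    then show "norm (a (p + (hyp n z, z)) * \<phi> n z) \<le> B * (indicator (cball 0 r) z *\<^sub>R M z)"
      by (simp add: abs_mult mult.assoc)
  qed
  show "integrable lborel (\<lambda>z. a (p + (hyp n z, z)) * \<phi> n z)"
    by (rule Bochner_Integration.integrable_bound[OF W m]) (use bound[of n] in eventually_elim, auto)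
  show "(\<lambda>n. LINT z|lborel. a (p + (hyp n z, z)) * \<phi> n z) \<longlonglongrightarrow> cone_integral \<phi>' a p"
    unfolding cone_integral_def
  proof (rule integral_dominated_convergence[OF _ m W _ bound])
    show "(\<lambda>z. a (p + (norm z, z)) * \<phi>' z) \<in> borel_measurable lborel" using meas(2) ms(2) by auto
    show "AE z in lborel. (\<lambda>n. a (p + (hyp n z, z)) * \<phi> n z) \<longlonglongrightarrow> a (p + (norm z, z)) * \<phi>' z"
      using AE0
    proof eventually_elim
      fix z :: 'a assume z: "z \<noteq> 0"
      have "isCont a (p + (norm z, z))"
        using smooth_differentiable[OF a] by (rule differentiable_imp_continuous_within)
      then have "(\<lambda>n. a (p + (hyp n z, z))) \<longlonglongrightarrow> a (p + (norm z, z))"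
        by (rule isCont_tendsto_compose) (intro tendsto_intros hyp_tendsto)
      then show "(\<lambda>n. a (p + (hyp n z, z)) * \<phi> n z) \<longlonglongrightarrow> a (p + (norm z, z)) * \<phi>' z"
        by (rule tendsto_mult) (rule lim[OF z])
    qed
  qed
qed

definition laplace :: "(spacetime \<Rightarrow> real) \<Rightarrow> spacetime \<Rightarrow> real" where
  "laplace g q = (\<Sum>b\<in>Basis. dir_deriv (0, b) (dir_deriv (0, b) g) q)"

lemma wave_op_laplace: "wave_op g q = dir_deriv (1, 0) (dir_deriv (1, 0) g) q - laplace g q"
  by (simp add: wave_op_def laplace_def)

lemma smooth_laplace: "smooth g \<Longrightarrow> smooth (laplace g)"
  unfolding laplace_def[abs_def] by (intro smooth_sum smooth_dir_deriv) auto

lemma vanishes_after_laplace: "vanishes_after T g \<Longrightarrow> vanishes_after T (laplace g)"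
  using vanishes_after_dir_deriv[OF vanishes_after_dir_deriv, of T g]
  unfolding laplace_def[abs_def] vanishes_after_def[of T "\<lambda>q. sum (f q) B" for f B]
  by (auto simp: vanishes_after_def)

lemma smooth_wave_op: "smooth g \<Longrightarrow> smooth (wave_op g)"
  unfolding wave_op_laplace[abs_def] by (intro smooth_diff smooth_dir_deriv smooth_laplace)

lemma vanishes_after_wave_op: "vanishes_after T g \<Longrightarrow> vanishes_after T (wave_op g)"
  using vanishes_after_laplace[of T g] vanishes_after_dir_deriv[OF vanishes_after_dir_deriv[of T g]]
  by (auto simp: vanishes_after_def wave_op_laplace)

text \<open>Integration over the forward cone commutes with translations of the vertex, hence with
  differential operators with constant coefficients.\<close>

lemma wave_op_cone_integral:
  assumes m: "locally_integrable m" and g: "smooth g" and T: "vanishes_after T g"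
  shows "wave_op (cone_integral m g) = cone_integral m (wave_op g)"
proof
  fix p :: spacetime
  have 2: "dir_deriv u (dir_deriv v (cone_integral m g)) = cone_integral m (dir_deriv u (dir_deriv v g))" for u v
    by (simp add: dir_deriv_cone_integral[OF m g T]
        dir_deriv_cone_integral[OF m smooth_dir_deriv[OF g] vanishes_after_dir_deriv[OF T]])
  have i: "integrable lborel (\<lambda>z. dir_deriv u (dir_deriv v g) (p + (norm z, z)) * m z)" for u v
    by (rule cone_integrable[OF m smooth_continuous_on[OF smooth_dir_deriv[OF smooth_dir_deriv[OF g]]]
        vanishes_after_dir_deriv[OF vanishes_after_dir_deriv[OF T]]])
  show "wave_op (cone_integral m g) p = cone_integral m (wave_op g) p"
    unfolding wave_op_def 2
    unfolding cone_integral_def left_diff_distrib sum_distrib_right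
    by (subst Bochner_Integration.integral_diff) (auto intro!: i Bochner_Integration.integrable_sum
        simp: Bochner_Integration.integral_sum[OF i])
qed

text \<open>The hyperboloid identity with m = 1, in the limit \<epsilon> -> 0. This weight is too
  mild to leave a point mass at the vertex; the factor 3/s - |z|^2/s^3 tends to 2/|z|, which
  produces the fundamental solution on the right. The formula serves to compute the fundamental
  solution applied twice.\<close>

lemma cone_integral_1_wave_op:
  assumes h: "smooth h" and T: "vanishes_after T h"
  shows "cone_integral (\<lambda>_. 1) (wave_op h) p = - 2 * cone_integral (\<lambda>z. 1 / norm z) (dir_deriv (1, 0) h) p"
proof -
  let ?tt = "dir_deriv (1, 0) (dir_deriv (1, 0) h)"
  let ?t = "dir_deriv (1, 0) h"
  let ?w1 = "\<lambda>n z. (norm z)\<^sup>2 * (1 / hyp n z) ^ 2"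
  let ?w3 = "\<lambda>n z. 3 * (1 / hyp n z) - (norm z)\<^sup>2 * (1 / hyp n z) ^ 3"
  note htt = smooth_dir_deriv[OF smooth_dir_deriv[OF h]] vanishes_after_dir_deriv[OF vanishes_after_dir_deriv[OF T]]
  note ht = smooth_dir_deriv[OF h] vanishes_after_dir_deriv[OF T]
  note hl = smooth_laplace[OF h] vanishes_after_laplace[OF T]
  have sq: "(norm z)\<^sup>2 * (1 / hyp n z) ^ 2 \<le> 1" for n and z :: "real^3"
    using power_mono[OF norm_inverse_hyp_le[of z n], of 2] hyp_pos[of z n]
    by (simp add: power_mult_distrib[symmetric])
  have u0: "1 / hyp n z \<ge> 0" for n and z :: "real^3" using hyp_pos[of z n] by simp
  have b3: "\<bar>?w3 n z\<bar> \<le> 3 * (1 / norm z)" if "z \<noteq> 0" for n and z :: "real^3"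
  proof -
    have "(norm z)\<^sup>2 * (1 / hyp n z) ^ 3 = ((norm z)\<^sup>2 * (1 / hyp n z) ^ 2) * (1 / hyp n z)"
      by (simp add: power3_eq_cube power2_eq_square)
    moreover have "\<dots> \<le> 1 / hyp n z" using mult_right_mono[OF sq u0] by simp
    moreover have "0 \<le> (norm z)\<^sup>2 * (1 / hyp n z) ^ 3" using u0 by (intro mult_nonneg_nonneg zero_le_power) auto
    ultimately show ?thesis using inverse_hyp_le[OF that, of n] u0[of z n] by linarith
  qed
  have l1: "(\<lambda>n. ?w1 n z) \<longlonglongrightarrow> 1" if "z \<noteq> 0" for z :: "real^3"
  proof -
    have "(\<lambda>n. ?w1 n z) \<longlonglongrightarrow> (norm z)\<^sup>2 * (1 / norm z) ^ 2"
      by (intro tendsto_intros hyp_tendsto) (use that in auto)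
    then show ?thesis using that by (simp add: power_divide)
  qed
  have l3: "(\<lambda>n. ?w3 n z) \<longlonglongrightarrow> 2 * (1 / norm z)" if "z \<noteq> 0" for z :: "real^3"
  proof -
    have "(\<lambda>n. ?w3 n z) \<longlonglongrightarrow> 3 * (1 / norm z) - (norm z)\<^sup>2 * (1 / norm z) ^ 3"
      by (intro tendsto_intros hyp_tendsto) (use that in auto)
    moreover have "3 * (1 / norm z) - (norm z)\<^sup>2 * (1 / norm z) ^ 3 = 2 * (1 / norm z)"
      using that by (simp add: field_simps power2_eq_square power3_eq_cube)
    ultimately show ?thesis by simp
  qed
  note L1 = hyperboloid_limit[OF htt locally_integrable_1, where \<phi> = ?w1 and \<phi>'="\<lambda>_. 1" and p=p, OF _ _ l1]
  note L2 = hyperboloid_limit[OF hl locally_integrable_1, where \<phi> = "\<lambda>_ _. 1" and \<phi>'="\<lambda>_. 1" and p=p]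
  have M3: "locally_integrable (\<lambda>z::real^3. 3 * (1 / norm z))"
    by (rule locally_integrable_mono[OF locally_integrable_inverse_norm]) (auto intro!: exI[of _ 3])
  note L3 = hyperboloid_limit[OF ht M3, where \<phi> = ?w3 and \<phi>'="\<lambda>z. 2 * (1 / norm z)" and p=p, OF _ _ l3 b3]
  have I1: "integrable lborel (\<lambda>z. ?tt (p + (hyp n z, z)) * ?w1 n z)"
    and T1: "(\<lambda>n. LINT z|lborel. ?tt (p + (hyp n z, z)) * ?w1 n z) \<longlonglongrightarrow> cone_integral (\<lambda>_. 1) ?tt p" for n
    by (rule L1; use sq in \<open>auto simp: abs_mult\<close>)+
  have I2: "integrable lborel (\<lambda>z. laplace h (p + (hyp n z, z)) * 1)"
    and T2: "(\<lambda>n. LINT z|lborel. laplace h (p + (hyp n z, z)) * 1) \<longlonglongrightarrow> cone_integral (\<lambda>_. 1) (laplace h) p" for n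
    by (rule L2; simp)+
  have I3: "integrable lborel (\<lambda>z. ?t (p + (hyp n z, z)) * ?w3 n z)"
    and T3: "(\<lambda>n. LINT z|lborel. ?t (p + (hyp n z, z)) * ?w3 n z) \<longlonglongrightarrow> cone_integral (\<lambda>z. 2 * (1 / norm z)) ?t p" for n
    by (rule L3; simp)+
  have "(LINT z|lborel. ?tt (p + (hyp n z, z)) * ?w1 n z) - (LINT z|lborel. laplace h (p + (hyp n z, z)) * 1)
     + (LINT z|lborel. ?t (p + (hyp n z, z)) * ?w3 n z) = 0" for n
    using hyperboloid_identity[of "1 / Suc n" h T "\<lambda>_. 1" "\<lambda>_. 0" "\<lambda>_. 0" p, OF _ h T]
    unfolding Bochner_Integration.integral_diff[OF I1 I2, symmetric]
      Bochner_Integration.integral_add[OF Bochner_Integration.integrable_diff[OF I1 I2] I3, symmetric]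
    by (simp add: laplace_def mult.commute)
  then have "(\<lambda>n. 0) \<longlonglongrightarrow> cone_integral (\<lambda>_. 1) ?tt p - cone_integral (\<lambda>_. 1) (laplace h) p + cone_integral (\<lambda>z. 2 * (1 / norm z)) ?t p"
    using tendsto_add[OF tendsto_diff[OF T1 T2] T3] by simp
  then have "0 = cone_integral (\<lambda>_. 1) ?tt p - cone_integral (\<lambda>_. 1) (laplace h) p + cone_integral (\<lambda>z. 2 * (1 / norm z)) ?t p"
    by (simp add: LIMSEQ_const_iff)
  moreover have "cone_integral (\<lambda>_. 1) ?tt p - cone_integral (\<lambda>_. 1) (laplace h) p = cone_integral (\<lambda>_. 1) (wave_op h) p"
    unfolding cone_integral_def wave_op_laplace
    using cone_integrable[OF locally_integrable_1 smooth_continuous_on[OF htt(1)] htt(2), where p=p]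
      cone_integrable[OF locally_integrable_1 smooth_continuous_on[OF hl(1)] hl(2), where p=p]
    by simp
  moreover have "cone_integral (\<lambda>z. 2 * (1 / norm z)) ?t p = 2 * cone_integral (\<lambda>z. 1 / norm z) ?t p"
    unfolding cone_integral_def
    by (subst Bochner_Integration.integral_mult_right_zero[symmetric]) (simp add: mult_ac)
  ultimately show ?thesis by simp
qed

section \<open>The point mass at the vertex\<close>

lemma integral_scaling:
  fixes f :: "'a::euclidean_space \<Rightarrow> real"
  assumes "c > 0" "f \<in> borel_measurable borel"
  shows "(LINT z|lborel. f z) = (LINT y|lborel. c ^ DIM('a) * f (c *\<^sub>R y))"
proof -
  have "(LINT z|lborel. f z) = (LINT z|distr lborel borel (\<lambda>x. 0 + c *\<^sub>R x). \<bar>c\<bar> ^ DIM('a) * f z)"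
    using assms by (subst lborel_affine[of c 0]) (auto simp: integral_density)
  also have "\<dots> = (LINT y|lborel. c ^ DIM('a) * f (c *\<^sub>R y))"
    using assms by (subst integral_distr) auto
  finally show ?thesis .
qed

text \<open>Minus the Laplacian of the regularised potential 1/sqrt(|y|^2 + 1). Rescaled by
  \<epsilon>, it is the term of the hyperboloid identity for m(s) = 1/s that concentrates at the
  vertex.\<close>

definition newton_kernel :: "real ^ 3 \<Rightarrow> real" where
  "newton_kernel y = 3 * (1 / sqrt ((norm y)\<^sup>2 + 1)) ^ 5"

text \<open>The value is \<open>4\<pi>\<close>, but only positivity matters.\<close>

definition newton_const :: real where
  "newton_const = (LINT y|lborel. newton_kernel y)"

lemma newton_kernel_pos: "newton_kernel y > 0"
  unfolding newton_kernel_def by (intro mult_pos_pos zero_less_power divide_pos_pos) (auto simp: add_nonneg_pos)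

lemma continuous_newton_kernel: "continuous_on UNIV newton_kernel"
  unfolding newton_kernel_def
  by (intro continuous_intros) (auto simp: add_nonneg_pos less_imp_neq[symmetric])

text \<open>On the shell 2^n <= sqrt(|y|^2 + 1) < 2^(n+1) the kernel is at most 3 * 32^(-n), and the
  enclosing ball has radius 2^(n+1). Expressing both with the index n+1 gives the constant 96 = 3 *
  32.\<close>

lemma integrable_newton_kernel: "integrable lborel newton_kernel"
proof (rule integrable_ball_cover[of _ "\<lambda>n. 96 * (1/32) ^ n" "\<lambda>n. 2 ^ n"])
  show "newton_kernel \<in> borel_measurable borel"
    by (rule borel_measurable_continuous_onI[OF continuous_newton_kernel])
  fix z :: "real^3"
  have s: "sqrt ((norm z)\<^sup>2 + 1) \<ge> 1" "sqrt ((norm z)\<^sup>2 + 1) \<ge> norm z" by (auto intro: real_le_rsqrt)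
  obtain n where n: "2 ^ n \<le> sqrt ((norm z)\<^sup>2 + 1)" "sqrt ((norm z)\<^sup>2 + 1) < 2 ^ Suc n"
    using power_two_interval[OF s(1)] by blast
  have "(1 / sqrt ((norm z)\<^sup>2 + 1)) ^ 5 \<le> (1 / 2 ^ n) ^ 5"
    using n(1) s(1) by (intro power_mono divide_left_mono mult_pos_pos) (auto simp: add_nonneg_pos)
  also have "\<dots> = (1/32::real) ^ n"
    by (simp add: power_divide power_mult[symmetric] mult.commute[of n 5] power_mult[of 2 5])
  finally have "\<bar>newton_kernel z\<bar> \<le> 96 * (1/32) ^ Suc n"
    using newton_kernel_pos[of z] by (simp add: newton_kernel_def)
  moreover have "norm z \<le> 2 ^ Suc n" using n(2) s(2) by linarith
  ultimately show "\<exists>n. norm z \<le> 2 ^ n \<and> \<bar>newton_kernel z\<bar> \<le> 96 * (1/32) ^ n" by blast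
next
  have "(\<lambda>n. 96 * (1/32) ^ n * (2 ^ n) ^ DIM(real^3)) = (\<lambda>n. 96 * (1/4::real) ^ n)"
  proof
    fix n
    have "((2 ^ n) ^ 3 :: real) = 8 ^ n" by (simp add: power3_eq_cube power_mult_distrib[symmetric])
    then show "96 * (1/32) ^ n * (2 ^ n) ^ DIM(real^3) = 96 * (1/4::real) ^ n"
      by (simp add: power_mult_distrib[symmetric])
  qed
  then show "summable (\<lambda>n. 96 * (1/32) ^ n * (2 ^ n :: real) ^ DIM(real^3))"
    by (simp only:) (intro summable_mult summable_geometric, simp)
qed auto

lemma newton_const_pos: "newton_const > 0"
proof -
  have nn: "AE y in lborel. 0 \<le> newton_kernel y" using newton_kernel_pos by (auto simp: less_imp_le)
  have "newton_const \<noteq> 0"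
  proof
    assume "newton_const = 0"
    then have "AE y in lborel. newton_kernel y = 0"
      using integral_nonneg_eq_0_iff_AE[OF integrable_newton_kernel nn] by (simp add: newton_const_def)
    then have "AE y in (lborel :: (real^3) measure). False"
      by eventually_elim (use newton_kernel_pos in \<open>auto simp: less_imp_neq[symmetric]\<close>)
    then have "emeasure (lborel :: (real^3) measure) UNIV = 0"
      by (subst (asm) AE_iff_measurable[OF _ refl]) auto
    then show False by (simp add: emeasure_lborel_UNIV)
  qed
  moreover have "newton_const \<ge> 0" unfolding newton_const_def using nn by (rule integral_nonneg_AE)
  ultimately show ?thesis by simp
qed

lemma newton_kernel_scaling:
  assumes "\<epsilon> > 0"
  shows "\<epsilon> ^ 3 * (3 * \<epsilon>\<^sup>2 * (1 / sqrt ((norm (\<epsilon> *\<^sub>R y))\<^sup>2 + \<epsilon>\<^sup>2)) ^ 5) = newton_kernel y"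
proof -
  have "(norm (\<epsilon> *\<^sub>R y))\<^sup>2 + \<epsilon>\<^sup>2 = \<epsilon>\<^sup>2 * ((norm y)\<^sup>2 + 1)"
    by (simp add: power_mult_distrib algebra_simps)
  then have "sqrt ((norm (\<epsilon> *\<^sub>R y))\<^sup>2 + \<epsilon>\<^sup>2) = \<epsilon> * sqrt ((norm y)\<^sup>2 + 1)"
    using assms by (simp add: real_sqrt_mult)
  then have "(1 / sqrt ((norm (\<epsilon> *\<^sub>R y))\<^sup>2 + \<epsilon>\<^sup>2)) ^ 5 = (1 / \<epsilon>) ^ 5 * (1 / sqrt ((norm y)\<^sup>2 + 1)) ^ 5"
    by (simp add: power_mult_distrib[symmetric])
  moreover have "\<epsilon> ^ 3 * (3 * \<epsilon>\<^sup>2 * ((1 / \<epsilon>) ^ 5 * c)) = 3 * c" for c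
    using assms by (simp add: power_divide field_simps power_numeral_reduce)
  ultimately show ?thesis by (simp only: newton_kernel_def)
qed

text \<open>After the substitution z = \<epsilon> y the weight becomes the fixed integrable function
  \<open>newton_kernel\<close>, while the arguments of \<open>g\<close> tend to \<open>p\<close>: an
  approximate identity at the vertex.\<close>

lemma newton_kernel_limit:
  assumes g: "smooth g" and T: "vanishes_after T (g :: spacetime \<Rightarrow> real)"
  shows "(\<lambda>n. LINT z|lborel. g (p + (hyp n z, z)) * (3 * (1 / Suc n)\<^sup>2 * (1 / hyp n z) ^ 5))
    \<longlonglongrightarrow> newton_const * g p"
proof -
  define e where "e n = 1 / real (Suc n)" for n
  have e: "e n > 0" "e n \<le> 1" for n by (auto simp: e_def)
  have e0: "e \<longlonglongrightarrow> 0" unfolding e_def by (rule inverse_Suc_tendsto)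
  define s where "s n z = sqrt ((norm z)\<^sup>2 + (e n)\<^sup>2)" for n and z :: "real^3"
  have spos: "s n z > 0" for n z unfolding s_def using e(1)[of n] by (simp add: add_nonneg_pos)
  obtain B r where B: "B \<ge> 0" "\<And>\<epsilon> z. 0 \<le> \<epsilon> \<Longrightarrow> \<epsilon> \<le> 1 \<Longrightarrow>
      \<bar>g (p + (sqrt ((norm z)\<^sup>2 + \<epsilon>\<^sup>2), z))\<bar> \<le> B * indicator (cball 0 r) z"
    using hyperboloid_bound[OF g T, where p=p] by metis
  have gB: "\<bar>g (p + (s n z, z))\<bar> \<le> B" for n z
  proof -
    have "B * indicator (cball 0 r) z \<le> B" using B(1) by (auto simp: indicator_def)
    with B(2)[of "e n" z] e[of n] show ?thesis by (auto simp: s_def)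
  qed
  have cs: "continuous_on UNIV (s n)" for n unfolding s_def by (intro continuous_intros)
  have cg: "continuous_on UNIV (\<lambda>z. g (p + (s n z, z)))" for n
    by (rule continuous_on_cone[OF smooth_continuous_on[OF g] cs])
  have cc: "continuous_on UNIV (\<lambda>z. g (p + (s n z, z)) * (3 * (e n)\<^sup>2 * (1 / s n z) ^ 5))" for n
    by (intro continuous_on_mult cg continuous_on_const continuous_on_power continuous_on_divide cs)
       (use spos in \<open>auto simp: less_imp_neq[symmetric]\<close>)
  have eq: "(LINT z|lborel. g (p + (s n z, z)) * (3 * (e n)\<^sup>2 * (1 / s n z) ^ 5))
      = (LINT y|lborel. g (p + (s n (e n *\<^sub>R y), e n *\<^sub>R y)) * newton_kernel y)" for n
    using integral_scaling[OF e(1)[of n] borel_measurable_continuous_onI[OF cc[of n]]]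
      newton_kernel_scaling[OF e(1)[of n]]
    by (simp add: mult.left_commute[of _ "g _"] s_def)
  have cl: "continuous_on UNIV (\<lambda>y. g (p + (s n (e n *\<^sub>R y), e n *\<^sub>R y)))" for n
    by (rule continuous_on_compose2[OF cg[of n], of _ "\<lambda>y. e n *\<^sub>R y"]) (auto intro!: continuous_intros)
  have "(\<lambda>n. LINT y|lborel. g (p + (s n (e n *\<^sub>R y), e n *\<^sub>R y)) * newton_kernel y)
      \<longlonglongrightarrow> (LINT y|lborel. g p * newton_kernel y)"
  proof (rule integral_dominated_convergence[where w="\<lambda>y. B * newton_kernel y"])
    note mk = borel_measurable_continuous_onI[OF continuous_newton_kernel]
    show "(\<lambda>y. g (p + (s n (e n *\<^sub>R y), e n *\<^sub>R y)) * newton_kernel y) \<in> borel_measurable lborel" for n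
      using borel_measurable_times[OF borel_measurable_continuous_onI[OF cl[of n]] mk] by simp
    show "(\<lambda>y. g p * newton_kernel y) \<in> borel_measurable lborel" using mk by simp
    show "integrable lborel (\<lambda>y. B * newton_kernel y)" using integrable_newton_kernel by simp
    show "AE y in lborel. (\<lambda>n. g (p + (s n (e n *\<^sub>R y), e n *\<^sub>R y)) * newton_kernel y) \<longlonglongrightarrow> g p * newton_kernel y"
    proof (intro AE_I2 tendsto_mult tendsto_const)
      fix y :: "real^3"
      have "isCont g p" using smooth_differentiable[OF g] by (rule differentiable_imp_continuous_within)
      moreover have "(\<lambda>n. p + (s n (e n *\<^sub>R y), e n *\<^sub>R y)) \<longlonglongrightarrow> p + (sqrt ((norm (0 *\<^sub>R y))\<^sup>2 + 0\<^sup>2), 0 *\<^sub>R y)"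
        unfolding s_def by (intro tendsto_intros e0)
      ultimately show "(\<lambda>n. g (p + (s n (e n *\<^sub>R y), e n *\<^sub>R y))) \<longlonglongrightarrow> g p"
        by (intro isCont_tendsto_compose[of p g]) (auto simp: zero_prod_def[symmetric])
    qed
    show "AE y in lborel. norm (g (p + (s n (e n *\<^sub>R y), e n *\<^sub>R y)) * newton_kernel y) \<le> B * newton_kernel y" for n
      using gB newton_kernel_pos by (auto simp: abs_mult less_imp_le intro!: mult_right_mono)
  qed
  then show ?thesis unfolding eq[symmetric] by (simp add: s_def e_def newton_const_def mult.commute)
qed

text \<open>In the hyperboloid identity with m(s) = 1/s the error terms carry \<epsilon>^2/s^3,
  \<epsilon>^2/s^4 and \<epsilon>^2/s^5. The first two weights are dominated by 1/|z| and 3/|z|^2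
  and disappear in the limit; the third tends to 0 off the vertex but keeps its mass and yields the
  value of \<open>g\<close> there. Thus the weight 1/|z| inverts the wave operator up to a
  constant.\<close>

lemma cone_integral_wave_op:
  assumes g: "smooth g" and T: "vanishes_after T g"
  shows "cone_integral (\<lambda>z. 1 / norm z) (wave_op g) p = newton_const * g p"
proof -
  let ?tt = "dir_deriv (1, 0) (dir_deriv (1, 0) g)"
  let ?t = "dir_deriv (1, 0) g"
  let ?w0 = "\<lambda>n z. 1 / hyp n z"
  let ?w1 = "\<lambda>n z. (1 / Suc n)\<^sup>2 * (1 / hyp n z) ^ 3"
  let ?w2 = "\<lambda>n z. 3 * (1 / Suc n)\<^sup>2 * (1 / hyp n z) ^ 4"
  let ?w3 = "\<lambda>n z. 3 * (1 / Suc n)\<^sup>2 * (1 / hyp n z) ^ 5"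
  note gtt = smooth_dir_deriv[OF smooth_dir_deriv[OF g]] vanishes_after_dir_deriv[OF vanishes_after_dir_deriv[OF T]]
  note gt = smooth_dir_deriv[OF g] vanishes_after_dir_deriv[OF T]
  note gw = smooth_wave_op[OF g] vanishes_after_wave_op[OF T]
  have u0: "1 / hyp n z \<ge> 0" for n and z :: "real^3" using hyp_pos[of z n] by simp
  have eu: "(1 / Suc n)\<^sup>2 * (1 / hyp n z) ^ 2 \<le> 1" for n and z :: "real^3"
    using power_mono[OF inverse_hyp_le2[of n z], of 2] u0[of z n]
    by (simp add: power_mult_distrib[symmetric])
  have b1: "\<bar>?w1 n z\<bar> \<le> 1 / norm z" if "z \<noteq> 0" for n and z :: "real^3"
  proof -
    have "?w1 n z = ((1 / Suc n)\<^sup>2 * (1 / hyp n z) ^ 2) * (1 / hyp n z)"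
      by (simp add: power3_eq_cube power2_eq_square)
    also have "\<dots> \<le> 1 / hyp n z" using mult_right_mono[OF eu u0, of n z] by simp
    finally have "?w1 n z \<le> 1 / norm z" using inverse_hyp_le[OF that, of n] by linarith
    moreover have "?w1 n z \<ge> 0" using u0 by (intro mult_nonneg_nonneg zero_le_power) auto
    ultimately show ?thesis by simp
  qed
  have b2: "\<bar>?w2 n z\<bar> \<le> 3 * (1 / (norm z)\<^sup>2)" if "z \<noteq> 0" for n and z :: "real^3"
  proof -
    have "?w2 n z = 3 * (((1 / Suc n)\<^sup>2 * (1 / hyp n z) ^ 2) * (1 / hyp n z) ^ 2)"
      by (simp add: power4_eq_xxxx power2_eq_square)
    also have "\<dots> \<le> 3 * (1 / hyp n z) ^ 2"
      using mult_right_mono[OF eu[of n z] zero_le_power[OF u0[of z n], of 2]] by simp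
    also have "\<dots> \<le> 3 * (1 / norm z) ^ 2"
      using inverse_hyp_le[OF that, of n] u0[of z n] by (intro mult_left_mono power_mono) auto
    finally have "?w2 n z \<le> 3 * (1 / (norm z)\<^sup>2)" by (simp add: power_divide)
    moreover have "?w2 n z \<ge> 0" using u0 by (intro mult_nonneg_nonneg zero_le_power) auto
    ultimately show ?thesis by simp
  qed
  have l0: "(\<lambda>n. ?w0 n z) \<longlonglongrightarrow> 1 / norm z" if "z \<noteq> 0" for z :: "real^3"
    using that by (intro tendsto_intros hyp_tendsto) auto
  have lz: "(\<lambda>n. c * (1 / Suc n)\<^sup>2 * (1 / hyp n z) ^ k) \<longlonglongrightarrow> 0" if "z \<noteq> 0" for z :: "real^3" and k c
  proof -
    have "(\<lambda>n. c * (1 / Suc n)\<^sup>2 * (1 / hyp n z) ^ k) \<longlonglongrightarrow> c * 0\<^sup>2 * (1 / norm z) ^ k"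
      by (intro tendsto_intros hyp_tendsto inverse_Suc_tendsto) (use that in auto)
    then show ?thesis by simp
  qed
  have M2: "locally_integrable (\<lambda>z::real^3. 3 * (1 / (norm z)\<^sup>2))"
    by (rule locally_integrable_mono[OF locally_integrable_inverse_norm_square]) (auto intro!: exI[of _ 3])
  note L0 = hyperboloid_limit[OF gw locally_integrable_inverse_norm, where \<phi> = ?w0 and \<phi>'="\<lambda>z. 1 / norm z" and p=p, OF _ _ l0]
  note L1 = hyperboloid_limit[OF gtt locally_integrable_inverse_norm, where \<phi> = ?w1 and \<phi>'="\<lambda>z. 0" and p=p, OF _ _ _ b1]
  note L2 = hyperboloid_limit[OF gt M2, where \<phi> = ?w2 and \<phi>'="\<lambda>z. 0" and p=p, OF _ _ lz b2]
  have I0: "integrable lborel (\<lambda>z. wave_op g (p + (hyp n z, z)) * ?w0 n z)"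
    and T0: "(\<lambda>n. LINT z|lborel. wave_op g (p + (hyp n z, z)) * ?w0 n z) \<longlonglongrightarrow> cone_integral (\<lambda>z. 1 / norm z) (wave_op g) p" for n
    by (rule L0; use inverse_hyp_le u0 in \<open>auto simp: abs_of_nonneg\<close>)+
  have I1: "integrable lborel (\<lambda>z. ?tt (p + (hyp n z, z)) * ?w1 n z)"
    and T1: "(\<lambda>n. LINT z|lborel. ?tt (p + (hyp n z, z)) * ?w1 n z) \<longlonglongrightarrow> cone_integral (\<lambda>_. 0) ?tt p" for n
    by (rule L1; use lz[of _ 1 3] in simp)+
  have I2: "integrable lborel (\<lambda>z. ?t (p + (hyp n z, z)) * ?w2 n z)"
    and T2: "(\<lambda>n. LINT z|lborel. ?t (p + (hyp n z, z)) * ?w2 n z) \<longlonglongrightarrow> cone_integral (\<lambda>_. 0) ?t p" for n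
    by (rule L2; simp)+
  have I3: "integrable lborel (\<lambda>z. g (p + (hyp n z, z)) * ?w3 n z)" for n
  proof (rule integrable_continuous_bounded_support)
    show "continuous_on UNIV (\<lambda>z. g (p + (hyp n z, z)) * ?w3 n z)"
    proof (rule continuous_on_mult)
      show "continuous_on UNIV (\<lambda>z. g (p + (hyp n z, z)))"
        by (rule continuous_on_cone[OF smooth_continuous_on[OF g]]) (intro continuous_intros)
      show "continuous_on UNIV (\<lambda>z::real^3. ?w3 n z)"
        using hyp_pos by (intro continuous_intros) (auto simp: less_imp_neq[symmetric])
    qed
    show "g (p + (hyp n z, z)) * ?w3 n z = 0" if "norm z > T - fst p" for z
    proof -
      have "norm z \<le> hyp n z" by (rule real_le_rsqrt) simp
      then have "T < fst p + hyp n z" using that by linarith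
      then have "g (p + (hyp n z, z)) = 0" by (intro vanishes_afterD[OF T]) simp
      then show ?thesis by simp
    qed
  qed
  have "(LINT z|lborel. wave_op g (p + (hyp n z, z)) * ?w0 n z)
      - (LINT z|lborel. ?tt (p + (hyp n z, z)) * ?w1 n z)
      + (LINT z|lborel. ?t (p + (hyp n z, z)) * ?w2 n z)
      - (LINT z|lborel. g (p + (hyp n z, z)) * ?w3 n z) = 0" for n
  proof -
    have D1: "((\<lambda>\<sigma>. 1 / \<sigma>) has_real_derivative - (1 / \<sigma>\<^sup>2)) (at \<sigma>)" if "\<sigma> > 0" for \<sigma> :: real
      using that by (auto intro!: derivative_eq_intros simp: power2_eq_square)
    have D2: "((\<lambda>\<sigma>. - (1 / \<sigma>\<^sup>2)) has_real_derivative 2 / \<sigma> ^ 3) (at \<sigma>)" if "\<sigma> > 0" for \<sigma> :: real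
      using that by (auto intro!: derivative_eq_intros simp: power2_eq_square power3_eq_cube field_simps)
    have C3: "continuous_on {0<..} (\<lambda>\<sigma>::real. 2 / \<sigma> ^ 3)" by (intro continuous_intros) auto
    \<comment> \<open>With |z|^2 = s^2 - \<epsilon>^2 everything free of \<epsilon> collapses to the
      wave operator divided by s. In the coefficients of g_t and g the contributions cancel as 3 - 1
      - 2 = 0, where 3 is the dimension.\<close>
    have alg: "1 / \<sigma> * (R * (1 / \<sigma>) ^ 2 * a - b)
        + c * (1 / \<sigma> * (3 * (1 / \<sigma>) - R * (1 / \<sigma>) ^ 3) + 2 * - (1 / \<sigma>\<^sup>2) * R * (1 / \<sigma>) ^ 2)
        + d * (3 * - (1 / \<sigma>\<^sup>2) * (1 / \<sigma>) - - (1 / \<sigma>\<^sup>2) * R * (1 / \<sigma>) ^ 3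
            + 2 / \<sigma> ^ 3 * R * (1 / \<sigma>) ^ 2)
        = (a - b) * (1 / \<sigma>) - a * (\<epsilon>\<^sup>2 * (1 / \<sigma>) ^ 3) + c * (3 * \<epsilon>\<^sup>2 * (1 / \<sigma>) ^ 4)
          - d * (3 * \<epsilon>\<^sup>2 * (1 / \<sigma>) ^ 5)"
      if "\<sigma> > 0" "R = \<sigma>\<^sup>2 - \<epsilon>\<^sup>2" for a b c d R \<sigma> \<epsilon> :: real
    proof -
      define u where "u = 1 / \<sigma>"
      have "R * u\<^sup>2 = 1 - \<epsilon>\<^sup>2 * u\<^sup>2"
        using that by (simp add: u_def power_divide diff_divide_distrib)
      then have R: "R * (u * u) = 1 - \<epsilon> * \<epsilon> * (u * u)" by (simp add: power2_eq_square)
      have "u * (R * u ^ 2 * a - b) + c * (u * (3 * u - R * u ^ 3) + 2 * - (u ^ 2) * R * u ^ 2)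
        + d * (3 * - (u ^ 2) * u - - (u ^ 2) * R * u ^ 3 + 2 * u ^ 3 * R * u ^ 2)
        = u * ((R * (u * u)) * a - b) + c * u * u * (3 - 3 * (R * (u * u))) - 3 * d * u * u * u * (1 - R * (u * u))"
        by (simp add: algebra_simps power2_eq_square power3_eq_cube)
      also have "\<dots> = (a - b) * u - a * (\<epsilon>\<^sup>2 * u ^ 3) + c * (3 * \<epsilon>\<^sup>2 * u ^ 4) - d * (3 * \<epsilon>\<^sup>2 * u ^ 5)"
        unfolding R by (simp add: algebra_simps power2_eq_square power3_eq_cube power4_eq_xxxx power_numeral_reduce)
      finally have *: "u * (R * u ^ 2 * a - b) + c * (u * (3 * u - R * u ^ 3) + 2 * - (u ^ 2) * R * u ^ 2)
        + d * (3 * - (u ^ 2) * u - - (u ^ 2) * R * u ^ 3 + 2 * u ^ 3 * R * u ^ 2)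
        = (a - b) * u - a * (\<epsilon>\<^sup>2 * u ^ 3) + c * (3 * \<epsilon>\<^sup>2 * u ^ 4) - d * (3 * \<epsilon>\<^sup>2 * u ^ 5)" .
      have e: "1 / \<sigma>\<^sup>2 = u ^ 2" "2 / \<sigma> ^ 3 = 2 * u ^ 3" by (simp_all add: u_def power_divide)
      show ?thesis unfolding e using * by (simp only: u_def[symmetric])
    qed
    have "norm z ^ 2 = (hyp n z)\<^sup>2 - (1 / real (Suc n))\<^sup>2" for z :: "real^3" by simp
    note * = alg[OF hyp_pos this]
    have dim: "real DIM(real ^ 3) = 3" and "1 / real (Suc n) > 0" by simp_all
    note H = hyperboloid_identity[OF this(2) g T D1 D2 C3, where p=p,
        unfolded laplace_def[symmetric] dim]
    show ?thesis
      unfolding Bochner_Integration.integral_diff[OF I0 I1, symmetric]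
        Bochner_Integration.integral_add[OF Bochner_Integration.integrable_diff[OF I0 I1] I2, symmetric]
        Bochner_Integration.integral_diff[OF Bochner_Integration.integrable_add[OF Bochner_Integration.integrable_diff[OF I0 I1] I2] I3, symmetric]
      unfolding wave_op_laplace
      by (rule trans[OF Bochner_Integration.integral_cong[OF refl *[symmetric]] H])
  qed
  then have "(\<lambda>n. 0) \<longlonglongrightarrow> cone_integral (\<lambda>z. 1 / norm z) (wave_op g) p - cone_integral (\<lambda>_. 0) ?tt p
      + cone_integral (\<lambda>_. 0) ?t p - newton_const * g p"
    using tendsto_diff[OF tendsto_add[OF tendsto_diff[OF T0 T1] T2] newton_kernel_limit[OF g T, of p]] by simp
  then have "0 = cone_integral (\<lambda>z. 1 / norm z) (wave_op g) p - cone_integral (\<lambda>_. 0) ?tt p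
      + cone_integral (\<lambda>_. 0) ?t p - newton_const * g p"
    by (simp add: LIMSEQ_const_iff)
  then show ?thesis by (simp add: cone_integral_def)
qed

section \<open>The representation formula\<close>

lemma test_fun_iff:
  "test_fun (\<phi> :: 'a::euclidean_space \<Rightarrow> real) \<longleftrightarrow> smooth \<phi> \<and> (\<exists>r. \<forall>z. norm z > r \<longrightarrow> \<phi> z = 0)"
proof (intro iffI conjI)
  assume t: "test_fun \<phi>"
  then show "smooth \<phi>" by (simp add: test_fun_def)
  from t have "bounded (supp \<phi>)" by (simp add: test_fun_def compact_imp_bounded)
  then obtain r where r: "\<And>z. z \<in> supp \<phi> \<Longrightarrow> norm z \<le> r" unfolding bounded_iff by blast
  have "\<phi> z = 0" if "norm z > r" for z
    using r[of z] that closure_subset[of "{x. \<phi> x \<noteq> 0}"] unfolding supp_def by force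
  then show "\<exists>r. \<forall>z. norm z > r \<longrightarrow> \<phi> z = 0" by blast
next
  assume "smooth \<phi> \<and> (\<exists>r. \<forall>z. norm z > r \<longrightarrow> \<phi> z = 0)"
  then obtain r where s: "smooth \<phi>" and r: "\<And>z. norm z > r \<Longrightarrow> \<phi> z = 0" by blast
  then have "{x. \<phi> x \<noteq> 0} \<subseteq> cball 0 r" by (auto simp: not_less[symmetric])
  then have "bounded {x. \<phi> x \<noteq> 0}" by (rule bounded_subset[OF bounded_cball])
  then show "test_fun \<phi>" using s by (simp add: test_fun_def supp_def compact_closure)
qed

lemma wave_op_cong_open:
  assumes "open S" "z \<in> S" "\<And>y. y \<in> S \<Longrightarrow> f y = g y"
  shows "wave_op f z = wave_op g z"
proof -
  have "dir_deriv u (dir_deriv v f) z = dir_deriv u (dir_deriv v g) z" for u v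
    by (rule dir_deriv_cong_open[OF assms(1,2)], rule dir_deriv_cong_open[OF assms(1) _ assms(3)])
  then show ?thesis by (simp add: wave_op_def)
qed

lemma test_fun_wave_op: assumes "test_fun \<phi>" shows "test_fun (wave_op \<phi>)"
proof -
  obtain r where s: "smooth \<phi>" and r: "\<And>z. norm z > r \<Longrightarrow> \<phi> z = 0"
    using assms unfolding test_fun_iff by blast
  have "wave_op \<phi> z = 0" if "norm z > r" for z
  proof -
    have "open {z::spacetime. norm z > r}" by (intro open_Collect_less continuous_intros)
    then have "wave_op \<phi> z = wave_op (\<lambda>_. 0) z"
      by (rule wave_op_cong_open) (use that r in auto)
    also have "\<dots> = 0"
    proof -
      have "dir_deriv v (\<lambda>_::spacetime. 0::real) = (\<lambda>_. 0)" for v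
        by (intro ext dir_deriv_eqI[where f'="\<lambda>_. 0"]) auto
      then show ?thesis by (simp add: wave_op_def)
    qed
    finally show ?thesis .
  qed
  then show ?thesis using smooth_wave_op[OF s] unfolding test_fun_iff by blast
qed

lemma test_fun_mult_smooth:
  assumes "test_fun \<phi>" "smooth f" shows "test_fun (\<lambda>z. f z * \<phi> z)"
  using assms unfolding test_fun_iff by (auto intro!: smooth_mult)

lemma test_fun_vanishes_after:
  assumes "test_fun \<phi>" obtains T where "vanishes_after T \<phi>"
proof -
  obtain r where r: "\<And>z. norm z > r \<Longrightarrow> \<phi> z = 0" using assms unfolding test_fun_iff by blast
  have "vanishes_after r \<phi>" unfolding vanishes_after_def
  proof (intro allI impI)
    fix t :: real and x assume "t > r"
    then show "\<phi> (t, x) = 0" using norm_fst_le[of t x] by (intro r) simp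
  qed
  then show ?thesis by (rule that)
qed

lemma open_inside_cone: "open inside_cone"
proof -
  have "open {z::spacetime. norm (snd z) < fst z}" by (intro open_Collect_less continuous_intros)
  then show ?thesis by (simp add: inside_cone_def case_prod_beta')
qed

lemma closed_closed_cone: "closed closed_cone"
proof -
  have "closed {z::spacetime. norm (snd z) \<le> fst z}" by (intro closed_Collect_le continuous_intros)
  then show ?thesis by (simp add: closed_cone_def case_prod_beta')
qed

lemma inside_closed_cone: "inside_cone \<subseteq> closed_cone"
  by (auto simp: inside_cone_def closed_cone_def)

lemma compact_truncated_cone: "compact (closed_cone \<inter> {z. fst z \<le> T})"
proof (rule compact_eq_bounded_closed[THEN iffD2], rule conjI)
  show "closed (closed_cone \<inter> {z. fst z \<le> T})"
    by (intro closed_Int closed_closed_cone closed_Collect_le continuous_intros)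
  have "norm z \<le> 2 * T" if "z \<in> closed_cone \<inter> {z. fst z \<le> T}" for z
  proof -
    obtain t x where z: "z = (t, x)" by (cases z)
    with that have "norm x \<le> t" "t \<le> T" by (auto simp: closed_cone_def)
    moreover have "norm (t, x) \<le> \<bar>t\<bar> + norm x"
      using norm_triangle_ineq[of "(t, 0)" "(0, x)"] by (simp add: norm_Pair)
    ultimately show ?thesis using norm_ge_zero[of x] z by simp
  qed
  then show "bounded (closed_cone \<inter> {z. fst z \<le> T})" unfolding bounded_iff by blast
qed

text \<open>Continuity is asked for on the closed cone only, as this is what the regular parts have;
  the truncated cone is compact, so vanishing at late times is enough.\<close>

lemma cone_set_integrable:
  fixes F :: "spacetime \<Rightarrow> real"
  assumes "continuous_on closed_cone F" "\<And>z. z \<in> closed_cone \<Longrightarrow> fst z > T \<Longrightarrow> F z = 0"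
  shows "set_integrable lborel inside_cone F"
proof -
  let ?K = "closed_cone \<inter> {z. fst z \<le> T}"
  have "set_integrable lborel ?K F" unfolding set_integrable_def
    by (intro borel_integrable_compact compact_truncated_cone continuous_on_subset[OF assms(1)]) auto
  then have "set_integrable lborel (inside_cone \<inter> ?K) F"
  proof (rule set_integrable_subset)
    have "inside_cone \<in> sets borel" "?K \<in> sets borel"
      using open_inside_cone compact_imp_closed[OF compact_truncated_cone] by auto
    then show "inside_cone \<inter> ?K \<in> sets lborel" by (simp add: sets.Int)
  qed auto
  moreover have "(\<lambda>z. indicator (inside_cone \<inter> ?K) z *\<^sub>R F z) = (\<lambda>z. indicator inside_cone z *\<^sub>R F z)"
    using assms(2) subsetD[OF inside_closed_cone] by (auto simp: fun_eq_iff indicator_def not_le[symmetric])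
  ultimately show ?thesis by (simp only: set_integrable_def)
qed

lemma cone_surface_integrable:
  fixes A :: "real ^ 3 \<Rightarrow> real" and \<phi> :: "spacetime \<Rightarrow> real"
  assumes "continuous_on UNIV A" "continuous_on UNIV \<phi>" "vanishes_after T \<phi>"
  shows "integrable lborel (\<lambda>x. A x * (\<phi> (norm x, x) / (4 * pi * norm x)))"
proof -
  have "integrable lborel (\<lambda>x. (A x * \<phi> (norm x, x) / (4 * pi)) * (1 / norm x))"
  proof (rule integrable_locally_mult[OF locally_integrable_inverse_norm])
    have "continuous_on UNIV (\<lambda>x::real^3. \<phi> (norm x, x))"
      by (rule continuous_on_compose2[OF assms(2)]) (auto intro!: continuous_intros)
    then show "continuous_on UNIV (\<lambda>x. A x * \<phi> (norm x, x) / (4 * pi))"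
      by (intro continuous_on_divide continuous_on_mult assms(1) continuous_on_const) auto
    show "A x * \<phi> (norm x, x) / (4 * pi) = 0" if "norm x > T" for x
      using vanishes_afterD[OF assms(3), of "(norm x, x)"] that by simp
  qed
  then show ?thesis by (simp add: divide_simps mult_ac)
qed

lemma smooth_snd: "smooth f \<Longrightarrow> smooth (\<lambda>z::real \<times> 'a::euclidean_space. f (snd z))"
  by (rule smooth_compose_linear) (auto intro: bounded_linear_snd)

lemma regular_part_continuous:
  assumes "regular_part P U R" shows "continuous_on closed_cone R"
  using assms by (simp add: regular_part_def solves_characteristic_bvp_def C1_up_to_cone_def)

lemma continuous_on_potential_mult:
  fixes R :: "spacetime \<Rightarrow> real ^ 2"
  assumes "\<And>i j. smooth (\<lambda>x. P x $ i $ j)" "continuous_on S R"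
  shows "continuous_on S (\<lambda>z. (P (snd z) *v R z) $ i)"
proof -
  have "continuous_on S (\<lambda>z. \<Sum>j\<in>UNIV. P (snd z) $ i $ j * R z $ j)"
    by (intro continuous_on_sum continuous_on_mult smooth_continuous_on[OF smooth_snd[OF assms(1)]]
        continuous_on_component assms(2))
  then show ?thesis by (simp add: matrix_vector_mult_def)
qed

text \<open>Inserts the decomposition of \<open>U\<close> into the weak equation. The singular part
  is the same in both components, so the potential meets it only through its row sums.\<close>

lemma regular_part_equation:
  assumes P: "\<And>i j. smooth (\<lambda>x. P x $ i $ j)"
    and ivp: "solves_ivp P U" and reg: "regular_part P U R" and \<phi>: "test_fun \<phi>"
  shows "cone_delta (wave_op \<phi>) + (LINT z:inside_cone|lborel. R z $ i * wave_op \<phi> z)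
    = \<phi> (0, 0) + (LINT x|lborel. (\<Sum>j\<in>UNIV. P x $ i $ j) * (\<phi> (norm x, x) / (4 * pi * norm x)))
      + (LINT z:inside_cone|lborel. (P (snd z) *v R z) $ i * \<phi> z)"
proof -
  have cR: "continuous_on closed_cone R" by (rule regular_part_continuous[OF reg])
  have s\<phi>: "smooth \<phi>" using \<phi> by (simp add: test_fun_def)
  obtain T where T: "vanishes_after T \<phi>" using test_fun_vanishes_after[OF \<phi>] .
  have U: "U i \<psi> = cone_delta \<psi> + (LINT z:inside_cone|lborel. R z $ i * \<psi> z)" if "test_fun \<psi>" for i \<psi>
    using reg that by (simp add: regular_part_def)
  have tP: "test_fun (\<lambda>z. P (snd z) $ i $ j * \<phi> z)" for i j
    by (rule test_fun_mult_smooth[OF \<phi> smooth_snd[OF P]])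
  have cd: "cone_delta (\<lambda>z. P (snd z) $ i $ j * \<phi> z)
      = (LINT x|lborel. P x $ i $ j * (\<phi> (norm x, x) / (4 * pi * norm x)))" for j
    by (simp add: cone_delta_def)
  have i1: "integrable lborel (\<lambda>x. P x $ i $ j * (\<phi> (norm x, x) / (4 * pi * norm x)))" for j
    by (rule cone_surface_integrable[OF smooth_continuous_on[OF P] smooth_continuous_on[OF s\<phi>] T])
  have i2: "set_integrable lborel inside_cone (\<lambda>z. R z $ j * (P (snd z) $ i $ j * \<phi> z))" for j
  proof (rule cone_set_integrable[where T=T])
    show "continuous_on closed_cone (\<lambda>z. R z $ j * (P (snd z) $ i $ j * \<phi> z))"
      by (intro continuous_on_mult continuous_on_component cR smooth_continuous_on[OF smooth_snd[OF P]]
          smooth_continuous_on[OF s\<phi>])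
  qed (simp add: vanishes_afterD[OF T])
  have "U i (wave_op \<phi>) - (\<Sum>j\<in>UNIV. U j (\<lambda>(t, x). P x $ i $ j * \<phi> (t, x))) = \<phi> (0, 0)"
    using ivp \<phi> unfolding solves_ivp_def by blast
  also have "(\<lambda>j. \<lambda>(t, x). P x $ i $ j * \<phi> (t, x)) = (\<lambda>j z. P (snd z) $ i $ j * \<phi> z)"
    by (auto simp: fun_eq_iff)
  finally have "U i (wave_op \<phi>) - (\<Sum>j\<in>UNIV. U j (\<lambda>z. P (snd z) $ i $ j * \<phi> z)) = \<phi> (0, 0)" 
    by (simp add: case_prod_beta')
  moreover have "(\<Sum>j\<in>UNIV. U j (\<lambda>z. P (snd z) $ i $ j * \<phi> z))
      = (\<Sum>j\<in>UNIV. LINT x|lborel. P x $ i $ j * (\<phi> (norm x, x) / (4 * pi * norm x)))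
        + (\<Sum>j\<in>UNIV. LINT z:inside_cone|lborel. R z $ j * (P (snd z) $ i $ j * \<phi> z))"
    by (simp add: U[OF tP] cd sum.distrib)
  moreover have "(\<Sum>j\<in>UNIV. LINT x|lborel. P x $ i $ j * (\<phi> (norm x, x) / (4 * pi * norm x)))
      = (LINT x|lborel. (\<Sum>j\<in>UNIV. P x $ i $ j) * (\<phi> (norm x, x) / (4 * pi * norm x)))"
    by (subst Bochner_Integration.integral_sum[symmetric], rule i1) (simp only: sum_distrib_right)
  moreover have "(\<Sum>j\<in>UNIV. LINT z:inside_cone|lborel. R z $ j * (P (snd z) $ i $ j * \<phi> z))
      = (LINT z:inside_cone|lborel. (P (snd z) *v R z) $ i * \<phi> z)"
  proof -
    have "(\<Sum>j\<in>UNIV. LINT z:inside_cone|lborel. R z $ j * (P (snd z) $ i $ j * \<phi> z))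
        = (LINT z:inside_cone|lborel. (\<Sum>j\<in>UNIV. R z $ j * (P (snd z) $ i $ j * \<phi> z)))"
      unfolding set_lebesgue_integral_def scaleR_sum_right
      by (rule Bochner_Integration.integral_sum[symmetric]) (use i2 in \<open>auto simp: set_integrable_def\<close>)
    also have "(\<lambda>z. \<Sum>j\<in>UNIV. R z $ j * (P (snd z) $ i $ j * \<phi> z)) = (\<lambda>z. (P (snd z) *v R z) $ i * \<phi> z)"
      by (simp add: matrix_vector_mult_def sum_distrib_left sum_distrib_right mult_ac)
    finally show ?thesis .
  qed
  ultimately show ?thesis using U[OF test_fun_wave_op[OF \<phi>]] by simp
qed

text \<open>The terms \<open>cone_delta (wave_op \<phi>)\<close> and \<open>\<phi> (0, 0)\<close> do
  not involve the potential and cancel on subtraction. What remains of the singular part is the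
  surface integral with the row sums of the difference of the potentials.\<close>

lemma difference_equation:
  fixes P1 P2 :: potential
  assumes P1: "\<And>i j. smooth (\<lambda>x. P1 x $ i $ j)" and P2: "\<And>i j. smooth (\<lambda>x. P2 x $ i $ j)"
    and ivp: "solves_ivp P1 U1" "solves_ivp P2 U2"
    and reg: "regular_part P1 U1 R1" "regular_part P2 U2 R2" and \<phi>: "test_fun \<phi>"
  shows "(LINT z:inside_cone|lborel. (R1 z - R2 z) $ i * wave_op \<phi> z)
    = (LINT x|lborel. (\<Sum>j\<in>UNIV. P1 x $ i $ j - P2 x $ i $ j) * (\<phi> (norm x, x) / (4 * pi * norm x)))
      + (LINT z:inside_cone|lborel. (P1 (snd z) *v R1 z - P2 (snd z) *v R2 z) $ i * \<phi> z)"
proof -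
  have c: "continuous_on closed_cone R1" "continuous_on closed_cone R2"
    using reg regular_part_continuous by blast+
  have s\<phi>: "smooth \<phi>" using \<phi> by (simp add: test_fun_def)
  obtain T where T: "vanishes_after T \<phi>" using test_fun_vanishes_after[OF \<phi>] .
  have ci: "set_integrable lborel inside_cone (\<lambda>z. F z * \<psi> z)"
    if "continuous_on closed_cone F" "smooth \<psi>" "vanishes_after T \<psi>" for F \<psi>
    by (rule cone_set_integrable[where T=T])
       (use that in \<open>simp_all add: continuous_on_mult smooth_continuous_on vanishes_afterD\<close>)
  have w: "set_integrable lborel inside_cone (\<lambda>z. R z $ i * wave_op \<phi> z)"
    if "continuous_on closed_cone R" for R :: "spacetime \<Rightarrow> real^2"
    by (rule ci[OF continuous_on_component[OF that] smooth_wave_op[OF s\<phi>] vanishes_after_wave_op[OF T]])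
  have p: "set_integrable lborel inside_cone (\<lambda>z. (P (snd z) *v R z) $ i * \<phi> z)"
    if "\<And>i j. smooth (\<lambda>x. P x $ i $ j)" "continuous_on closed_cone R" for P :: potential and R
    by (rule ci[OF continuous_on_potential_mult[OF that] s\<phi> T])
  have s: "integrable lborel (\<lambda>x. (\<Sum>j\<in>UNIV. P x $ i $ j) * (\<phi> (norm x, x) / (4 * pi * norm x)))"
    if "\<And>i j. smooth (\<lambda>x. P x $ i $ j)" for P :: potential
    by (rule cone_surface_integrable[OF _ smooth_continuous_on[OF s\<phi>] T])
       (intro continuous_on_sum smooth_continuous_on that)
  have "(LINT z:inside_cone|lborel. (R1 z - R2 z) $ i * wave_op \<phi> z)
     = (LINT z:inside_cone|lborel. R1 z $ i * wave_op \<phi> z) - (LINT z:inside_cone|lborel. R2 z $ i * wave_op \<phi> z)"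
    by (subst set_integral_diff(2)[symmetric, OF w[OF c(1)] w[OF c(2)]]) (simp add: left_diff_distrib)
  moreover have "(LINT z:inside_cone|lborel. (P1 (snd z) *v R1 z - P2 (snd z) *v R2 z) $ i * \<phi> z)
     = (LINT z:inside_cone|lborel. (P1 (snd z) *v R1 z) $ i * \<phi> z) - (LINT z:inside_cone|lborel. (P2 (snd z) *v R2 z) $ i * \<phi> z)"
    by (subst set_integral_diff(2)[symmetric, OF p[OF P1 c(1)] p[OF P2 c(2)]]) (simp add: left_diff_distrib)
  moreover have "(LINT x|lborel. (\<Sum>j\<in>UNIV. P1 x $ i $ j - P2 x $ i $ j) * (\<phi> (norm x, x) / (4 * pi * norm x)))
     = (LINT x|lborel. (\<Sum>j\<in>UNIV. P1 x $ i $ j) * (\<phi> (norm x, x) / (4 * pi * norm x)))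
     - (LINT x|lborel. (\<Sum>j\<in>UNIV. P2 x $ i $ j) * (\<phi> (norm x, x) / (4 * pi * norm x)))"
    by (subst Bochner_Integration.integral_diff[symmetric, OF s[OF P1] s[OF P2]])
       (simp only: sum_subtractf left_diff_distrib)
  ultimately show ?thesis
    using regular_part_equation[OF P1 ivp(1) reg(1) \<phi>, of i]
      regular_part_equation[OF P2 ivp(2) reg(2) \<phi>, of i] by linarith
qed

abbreviation newton :: "(spacetime \<Rightarrow> real) \<Rightarrow> spacetime \<Rightarrow> real" where
  "newton \<equiv> cone_integral (\<lambda>z. 1 / norm z)"

lemmas smooth_newton = smooth_cone_integral[OF locally_integrable_inverse_norm]

lemma wave_op_newton:
  assumes "smooth g" "vanishes_after T g" shows "wave_op (newton g) p = newton_const * g p"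
  using wave_op_cone_integral[OF locally_integrable_inverse_norm assms] cone_integral_wave_op[OF assms]
  by simp

text \<open>Needed because \<open>newton g\<close> spreads into the past and is not itself a test
  function. Agreement on an open set around the closed cone is what transfers \<open>wave_op\<close>
  as well as the values.\<close>

lemma cutoff_exists:
  assumes g: "smooth (g :: spacetime \<Rightarrow> real)" and T: "vanishes_after T g"
  obtains \<phi> S where "test_fun \<phi>" "open S" "closed_cone \<subseteq> S" "\<And>z. z \<in> S \<Longrightarrow> \<phi> z = g z"
proof -
  obtain s :: "real \<Rightarrow> real" where s: "smooth s" "\<And>u. u \<le> 0 \<Longrightarrow> s u = 0" "\<And>u. u \<ge> 1 \<Longrightarrow> s u = 1"
    using smooth_step_exists by metis
  \<comment> \<open>Points of the closed cone up to time T satisfy |z|^2 <= 2 T^2 < C - 1, and there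
    the cutoff factor equals 1; at later times \<open>g\<close> is zero anyway.\<close>
  define C where "C = 2 * T\<^sup>2 + 2"
  define \<phi> where "\<phi> z = s (C - (norm z)\<^sup>2) * g z" for z
  define S where "S = {z. (norm z)\<^sup>2 < C - 1} \<union> {z::spacetime. fst z > T}"
  have "smooth \<phi>" unfolding \<phi>_def
    by (intro smooth_mult g smooth_compose_real[OF s(1)] smooth_diff smooth_const smooth_norm_square)
  moreover have "\<phi> z = 0" if "norm z > C" for z
  proof -
    have "C \<ge> 1" by (simp add: C_def)
    then have "(norm z)\<^sup>2 \<ge> C" using that power2_eq_square[of "norm z"] mult_mono[of 1 "norm z" C "norm z"] by simp
    then show ?thesis by (simp add: \<phi>_def s(2))
  qed
  ultimately have "test_fun \<phi>" unfolding test_fun_iff by blast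
  moreover have "open S" unfolding S_def
    by (intro open_Un open_Collect_less continuous_intros)
  moreover have "closed_cone \<subseteq> S"
  proof
    fix z assume "z \<in> closed_cone"
    then obtain t x where z: "z = (t, x)" "norm x \<le> t" by (auto simp: closed_cone_def)
    show "z \<in> S"
    proof (cases "t > T")
      case False
      have "(norm z)\<^sup>2 = t\<^sup>2 + (norm x)\<^sup>2" by (simp add: z(1) norm_Pair)
      moreover have "(norm x)\<^sup>2 \<le> t\<^sup>2" "t\<^sup>2 \<le> T\<^sup>2"
        using z(2) False order.trans[OF norm_ge_zero z(2)] by (auto intro!: power_mono)
      ultimately show ?thesis by (simp add: S_def C_def)
    qed (simp add: S_def z)
  qed
  moreover have "\<phi> z = g z" if "z \<in> S" for z
    using that vanishes_afterD[OF T, of z] by (auto simp: S_def \<phi>_def s(3))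
  ultimately show ?thesis by (rule that)
qed

text \<open>The test function is a cutoff of \<open>newton g\<close>: inside the cone
  \<open>wave_op\<close> turns it into a multiple of \<open>g\<close>. So any smooth
  \<open>g\<close> vanishing at late times can be placed against the difference of the regular
  parts, without differentiating the latter.\<close>

lemma representation_formula:
  fixes P1 P2 :: potential
  assumes P1: "\<And>i j. smooth (\<lambda>x. P1 x $ i $ j)" and P2: "\<And>i j. smooth (\<lambda>x. P2 x $ i $ j)"
    and ivp: "solves_ivp P1 U1" "solves_ivp P2 U2"
    and reg: "regular_part P1 U1 R1" "regular_part P2 U2 R2"
    and g: "smooth g" and T: "vanishes_after T g"
  shows "newton_const * (LINT z:inside_cone|lborel. (R1 z - R2 z) $ i * g z)
    = (LINT x|lborel. (\<Sum>j\<in>UNIV. P1 x $ i $ j - P2 x $ i $ j) * (newton g (norm x, x) / (4 * pi * norm x)))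
      + (LINT z:inside_cone|lborel. (P1 (snd z) *v R1 z - P2 (snd z) *v R2 z) $ i * newton g z)"
proof -
  obtain \<phi> S where \<phi>: "test_fun \<phi>" "open S" "closed_cone \<subseteq> S" "\<And>z. z \<in> S \<Longrightarrow> \<phi> z = newton g z"
    using cutoff_exists[OF smooth_newton[OF g T] vanishes_after_cone_integral[OF T]] by metis
  have 1: "wave_op \<phi> z = newton_const * g z" if "z \<in> inside_cone" for z
  proof -
    have "z \<in> S" using that inside_closed_cone \<phi>(3) by blast
    from wave_op_cong_open[OF \<phi>(2) this \<phi>(4)] show ?thesis using wave_op_newton[OF g T, of z] by simp
  qed
  have 2: "\<phi> z = newton g z" if "z \<in> closed_cone" for z using that \<phi>(3,4) by blast
  have 3: "\<phi> (norm x, x) = newton g (norm x, x)" for x by (rule 2) (simp add: closed_cone_def)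
  have m: "inside_cone \<in> sets lborel" using open_inside_cone by simp
  have "newton_const * (LINT z:inside_cone|lborel. (R1 z - R2 z) $ i * g z)
     = (LINT z:inside_cone|lborel. (R1 z - R2 z) $ i * wave_op \<phi> z)"
    by (subst set_integral_mult_right[symmetric], rule set_lebesgue_integral_cong[OF m])
       (simp add: 1 mult.left_commute)
  also have "\<dots> = (LINT x|lborel. (\<Sum>j\<in>UNIV. P1 x $ i $ j - P2 x $ i $ j) * (\<phi> (norm x, x) / (4 * pi * norm x)))
      + (LINT z:inside_cone|lborel. (P1 (snd z) *v R1 z - P2 (snd z) *v R2 z) $ i * \<phi> z)"
    by (rule difference_equation[OF P1 P2 ivp reg \<phi>(1)])
  also have "(LINT z:inside_cone|lborel. (P1 (snd z) *v R1 z - P2 (snd z) *v R2 z) $ i * \<phi> z)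
      = (LINT z:inside_cone|lborel. (P1 (snd z) *v R1 z - P2 (snd z) *v R2 z) $ i * newton g z)"
    by (rule set_lebesgue_integral_cong[OF m]) (use 2 inside_closed_cone in auto)
  finally show ?thesis by (simp only: 3)
qed

section \<open>Exponentially weighted sources\<close>

lemma smooth_fst: "smooth f \<Longrightarrow> smooth (\<lambda>z::real \<times> 'a::euclidean_space. f (fst z))"
  by (rule smooth_compose_linear) (auto intro: bounded_linear_fst)

text \<open>Time profile of the test sources and its primitive. The exponential makes every
  integration in time gain a factor \<open>1 / l\<close>, which replaces a Gronwall argument.\<close>

definition decay :: "real \<Rightarrow> real \<Rightarrow> real \<Rightarrow> real" where
  "decay T l t = exp (- l * t) * bump 0 (T - t)"

definition decay_rate :: "real \<Rightarrow> real \<Rightarrow> real \<Rightarrow> real" where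
  "decay_rate T l t = exp (- l * t) * (l * bump 0 (T - t) + bump 2 (T - t))"

lemma smooth_bump_diff: "smooth (\<lambda>t::real. bump k (T - t))"
  by (rule smooth_compose_real[OF smooth_bump])
     (intro smooth_diff smooth_const smooth_linear bounded_linear_ident)

lemma smooth_decay: "smooth (decay T l)"
  unfolding decay_def[abs_def] by (intro smooth_mult smooth_exp_scale smooth_bump_diff)

lemma smooth_decay_rate: "smooth (decay_rate T l)"
  unfolding decay_rate_def[abs_def]
  by (intro smooth_mult smooth_add smooth_const smooth_exp_scale smooth_bump_diff)

lemma decay_deriv: "(decay T l has_real_derivative - decay_rate T l t) (at t)"
proof -
  have "((\<lambda>t. bump 0 (T - t)) has_real_derivative bump 2 (T - t) * (0 - 1)) (at t)"
    using bump_deriv[of 0 "T - t"] by (intro DERIV_chain2[of "bump 0"]) (auto intro!: derivative_eq_intros simp: numeral_2_eq_2)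
  then show ?thesis
    unfolding decay_def[abs_def] decay_rate_def by (auto intro!: derivative_eq_intros simp: algebra_simps)
qed

text \<open>The term with \<open>bump 2\<close> comes from differentiating the cutoff at time T and
  has the favourable sign, since the cutoff factor decreases in time. So the cutoff does not spoil
  the gain of 1/l.\<close>

lemma decay_le: "l > 0 \<Longrightarrow> decay T l t \<le> decay_rate T l t / l"
  using bump_nonneg[of 2 "T - t"] by (simp add: decay_def decay_rate_def field_simps)

lemma decay_rate_nonneg: "l > 0 \<Longrightarrow> decay_rate T l t \<ge> 0"
  by (simp add: decay_rate_def bump_nonneg)

lemma decay_rate_pos: "l > 0 \<Longrightarrow> t < T \<Longrightarrow> decay_rate T l t > 0"
  unfolding decay_rate_def using bump_nonneg[of 2 "T - t"] bump_pos_iff[of 0 "T - t"]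
  by (intro mult_pos_pos add_pos_nonneg) auto

lemma decay_zero: "t \<ge> T \<Longrightarrow> decay T l t = 0" "t \<ge> T \<Longrightarrow> decay_rate T l t = 0"
  by (simp_all add: decay_def decay_rate_def)

locale weight =
  fixes T l :: real and \<rho> :: "real ^ 3 \<Rightarrow> real"
  assumes l: "l > 0" and \<rho>: "smooth \<rho>" and \<rho>_nonneg: "\<And>x. \<rho> x \<ge> 0"
begin

definition source :: "spacetime \<Rightarrow> real" where
  "source z = decay_rate T l (fst z) * \<rho> (snd z)"

definition primitive :: "spacetime \<Rightarrow> real" where
  "primitive z = decay T l (fst z) * \<rho> (snd z)"

lemma smooth_source: "smooth source"
  unfolding source_def[abs_def] by (intro smooth_mult smooth_fst smooth_snd smooth_decay_rate \<rho>)

lemma smooth_primitive: "smooth primitive"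
  unfolding primitive_def[abs_def] by (intro smooth_mult smooth_fst smooth_snd smooth_decay \<rho>)

lemma vanishes_after_source: "vanishes_after T source"
  and vanishes_after_primitive: "vanishes_after T primitive"
  by (simp_all add: vanishes_after_def source_def primitive_def decay_zero)

lemma source_nonneg: "source z \<ge> 0"
  by (simp add: source_def \<rho>_nonneg decay_rate_nonneg l)

lemma dir_deriv_primitive: "dir_deriv (1, 0) primitive = (\<lambda>z. - source z)"
proof
  fix z :: spacetime
  have "((\<lambda>t. primitive (z + t *\<^sub>R (1, 0))) has_real_derivative dir_deriv (1, 0) primitive z) (at 0)"
    using dir_deriv_line[OF smooth_primitive, of z "(1,0)" 0]
    by (simp add: has_real_derivative_iff_has_vector_derivative zero_prod_def[symmetric])
  moreover have "((\<lambda>t. decay T l (fst z + t)) has_real_derivative - decay_rate T l (fst z)) (at 0)"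
    using decay_deriv[of T l "fst z + 0"] DERIV_shift[of "decay T l" _ 0 "fst z"]
    by (simp add: add.commute)
  then have "((\<lambda>t. primitive (z + t *\<^sub>R (1, 0))) has_real_derivative - source z) (at 0)"
    unfolding primitive_def source_def by (auto intro!: derivative_eq_intros)
  ultimately show "dir_deriv (1, 0) primitive z = - source z" by (rule DERIV_unique)
qed

definition w :: "spacetime \<Rightarrow> real" where "w = newton source"

lemma smooth_w: "smooth w"
  unfolding w_def by (rule smooth_newton[OF smooth_source vanishes_after_source])

lemma vanishes_after_w: "vanishes_after T w"
  unfolding w_def by (rule vanishes_after_cone_integral[OF vanishes_after_source])

lemma w_nonneg: "w z \<ge> 0"
  unfolding w_def cone_integral_def by (rule integral_nonneg_AE) (simp add: source_nonneg)

text \<open>Integrating \<open>primitive\<close> over the light cone amounts to integrating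
  \<open>source\<close> over the solid forward cone: in three space dimensions the fundamental
  solution of the squared wave operator is constant inside the cone. The proof recognises the
  right-hand cone integral as a function whose \<open>wave_op\<close> is \<open>2 * w\<close> and
  then inverts \<open>wave_op\<close>.\<close>

lemma newton_w: "newton w p = newton_const / 2 * cone_integral (\<lambda>_. 1) primitive p"
proof -
  let ?G = "cone_integral (\<lambda>_. 1) primitive"
  have "wave_op ?G = (\<lambda>q. 2 * w q)"
  proof
    fix q
    have "newton (\<lambda>z. - source z) q = - w q"
      unfolding w_def cone_integral_def by simp
    then show "wave_op ?G q = 2 * w q"
      using wave_op_cone_integral[OF locally_integrable_1 smooth_primitive vanishes_after_primitive]
        cone_integral_1_wave_op[OF smooth_primitive vanishes_after_primitive, of q]
      by (simp add: dir_deriv_primitive)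
  qed
  moreover have "newton (wave_op ?G) p = newton_const * ?G p"
    by (rule cone_integral_wave_op[OF smooth_cone_integral[OF locally_integrable_1 smooth_primitive vanishes_after_primitive]
        vanishes_after_cone_integral[OF vanishes_after_primitive]])
  moreover have "newton (\<lambda>q. 2 * w q) p = 2 * newton w p"
    unfolding cone_integral_def by (simp flip: integral_mult_right_zero)
  ultimately show ?thesis by simp
qed

text \<open>Along the cone \<open>primitive\<close> is at most \<open>source\<close> divided by l,
  which is the gain. The missing weight 1/|z| is supplied by T/|z| >= 1: from a vertex at
  nonnegative time, the source is met only for |z| <= T.\<close>

lemma newton_w_le:
  assumes "fst p \<ge> 0" shows "newton w p \<le> newton_const * T / (2 * l) * w p"
proof -
  have AE0: "AE z in lborel. z \<noteq> (0::real^3)" by (rule AE_lborel_singleton)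
  have "cone_integral (\<lambda>_. 1) primitive p \<le> T / l * w p"
    unfolding w_def cone_integral_def integral_mult_right_zero[symmetric]
  proof (rule integral_mono_AE)
    show "integrable lborel (\<lambda>z. primitive (p + (norm z, z)) * 1)"
      by (rule cone_integrable[OF locally_integrable_1 smooth_continuous_on[OF smooth_primitive] vanishes_after_primitive])
    show "integrable lborel (\<lambda>z. T / l * (source (p + (norm z, z)) * (1 / norm z)))"
      using cone_integrable[OF locally_integrable_inverse_norm smooth_continuous_on[OF smooth_source] vanishes_after_source, where p=p]
      by (rule Bochner_Integration.integrable_mult_right)
    show "AE z in lborel. primitive (p + (norm z, z)) * 1 \<le> T / l * (source (p + (norm z, z)) * (1 / norm z))"
      using AE0
    proof eventually_elim
      fix z :: "real^3" assume z: "z \<noteq> 0"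
      show "primitive (p + (norm z, z)) * 1 \<le> T / l * (source (p + (norm z, z)) * (1 / norm z))"
      proof (cases "norm z \<le> T")
        case True
        have "primitive (p + (norm z, z)) \<le> 1 / l * source (p + (norm z, z))"
          unfolding primitive_def source_def
          using mult_right_mono[OF decay_le[OF l, of T "fst p + norm z"] \<rho>_nonneg[of "snd p + z"]] by simp
        also have "\<dots> = 1 * (1 / l * source (p + (norm z, z)))" by simp
        also have "\<dots> \<le> (T / norm z) * (1 / l * source (p + (norm z, z)))"
          using True z l source_nonneg[of "p + (norm z, z)"] by (intro mult_right_mono) auto
        finally show ?thesis by (simp add: field_simps)
      next
        case False
        then have "fst p + norm z \<ge> T" using assms by linarith
        then show ?thesis by (simp add: primitive_def source_def decay_zero)
      qed
    qed
  qed
  then have "newton_const / 2 * cone_integral (\<lambda>_. 1) primitive p \<le> newton_const / 2 * (T / l * w p)"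
    using newton_const_pos by (intro mult_left_mono) auto
  then show ?thesis by (simp add: newton_w)
qed

lemma newton_primitive_le: "newton primitive p \<le> w p / l"
proof -
  have "newton primitive p \<le> 1 / l * w p"
    unfolding w_def cone_integral_def integral_mult_right_zero[symmetric]
  proof (rule integral_mono_AE)
    show "integrable lborel (\<lambda>z. primitive (p + (norm z, z)) * (1 / norm z))"
      by (rule cone_integrable[OF locally_integrable_inverse_norm smooth_continuous_on[OF smooth_primitive] vanishes_after_primitive])
    show "integrable lborel (\<lambda>z. 1 / l * (source (p + (norm z, z)) * (1 / norm z)))"
      using cone_integrable[OF locally_integrable_inverse_norm smooth_continuous_on[OF smooth_source] vanishes_after_source, where p=p]
      by (rule Bochner_Integration.integrable_mult_right)
    have "primitive (p + (norm z, z)) \<le> 1 / l * source (p + (norm z, z))" for z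
      unfolding primitive_def source_def
      using mult_right_mono[OF decay_le[OF l, of T "fst p + norm z"] \<rho>_nonneg[of "snd p + z"]] by simp
    then have "primitive (p + (norm z, z)) * (1 / norm z) \<le> 1 / l * source (p + (norm z, z)) * (1 / norm z)" for z
      by (rule mult_right_mono) simp
    then show "AE z in lborel. primitive (p + (norm z, z)) * (1 / norm z) \<le> 1 / l * (source (p + (norm z, z)) * (1 / norm z))"
      by (simp only: mult.assoc) simp
  qed
  then show ?thesis by simp
qed

text \<open>The fundamental solution commutes with the time derivative, so minus
  \<open>newton primitive\<close> is an antiderivative of \<open>w\<close> in time. At time T it
  vanishes, which leaves the value on the cone.\<close>

lemma integral_w_time:
  "(LINT t|lborel. indicator inside_cone (t, x) * w (t, x)) = newton primitive (norm x, x)"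
proof (cases "norm x \<le> T")
  case False
  then have "(LINT t|lborel. indicator inside_cone (t, x) * w (t, x)) = (LINT t|(lborel::real measure). 0)"
    using vanishes_afterD[OF vanishes_after_w, of "(t, x)" for t]
    by (intro Bochner_Integration.integral_cong) (auto simp: indicator_def inside_cone_def)
  moreover have "newton primitive (norm x, x) = 0"
    using vanishes_afterD[OF vanishes_after_cone_integral[OF vanishes_after_primitive], of "(norm x, x)"] False by simp
  ultimately show ?thesis by simp
next
  case True
  have d: "((\<lambda>t. - newton primitive (t, x)) has_real_derivative w (t, x)) (at t)" for t
  proof -
    have "((\<lambda>s. newton primitive ((0, x) + s *\<^sub>R (1, 0))) has_real_derivative dir_deriv (1, 0) (newton primitive) ((0, x) + t *\<^sub>R (1, 0))) (at t)"
      using dir_deriv_line[OF smooth_newton[OF smooth_primitive vanishes_after_primitive], of "(0, x)" "(1, 0)" t]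
      by (simp add: has_real_derivative_iff_has_vector_derivative)
    moreover have "dir_deriv (1, 0) (newton primitive) q = - w q" for q
      by (simp add: dir_deriv_cone_integral[OF locally_integrable_inverse_norm smooth_primitive vanishes_after_primitive]
         dir_deriv_primitive w_def cone_integral_def)
    ultimately show ?thesis using DERIV_minus by fastforce
  qed
  have cw: "continuous_on UNIV (\<lambda>t. w (t, x))"
    by (rule continuous_on_compose2[OF smooth_continuous_on[OF smooth_w, of UNIV]]) (auto intro!: continuous_intros)
  have "AE t in lborel. t \<noteq> norm x" "AE t in lborel. t \<noteq> T" by (rule AE_lborel_singleton)+
  then have "AE t in lborel. indicator inside_cone (t, x) * w (t, x) = w (t, x) * indicator {norm x..T} t"
  proof eventually_elim
    fix t assume "t \<noteq> norm x" "t \<noteq> T"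
    then show "indicator inside_cone (t, x) * w (t, x) = w (t, x) * indicator {norm x..T} t"
      using vanishes_afterD[OF vanishes_after_w, of "(t, x)"] by (auto simp: indicator_def inside_cone_def)
  qed
  then have "(LINT t|lborel. indicator inside_cone (t, x) * w (t, x)) = (LINT t|lborel. w (t, x) * indicator {norm x..T} t)"
  proof (rule integral_cong_AE[rotated 2])
    have m: "(\<lambda>t. w (t, x)) \<in> borel_measurable borel" by (rule borel_measurable_continuous_onI[OF cw])
    have "(\<lambda>t. indicator inside_cone (t, x) * w (t, x)) = (\<lambda>t. indicator {norm x<..} t * w (t, x))"
      by (auto simp: indicator_def inside_cone_def)
    then show "(\<lambda>t. indicator inside_cone (t, x) * w (t, x)) \<in> borel_measurable lborel"
      using m by simp
    show "(\<lambda>t. w (t, x) * indicator {norm x..T} t) \<in> borel_measurable lborel" using m by simp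
  qed
  also have "\<dots> = - newton primitive (T, x) - - newton primitive (norm x, x)"
    by (rule integral_FTC_Icc_real[OF True])
       (use d cw in \<open>auto simp: continuous_on_eq_continuous_at\<close>)
  also have "newton primitive (T, x) = 0"
    unfolding cone_integral_def primitive_def by (simp add: decay_zero)
  finally show ?thesis by simp
qed

text \<open>As \<open>D\<close> does not depend on time, Fubini reduces the solid integral to time
  integrals of \<open>w\<close>, which are values on the light cone again, smaller by 1/l. The
  weight 1/|x| of the surface integral is bought with T/|x| >= 1.\<close>

lemma cone_integral_w_le:
  assumes D: "continuous_on UNIV D" "\<And>x. D x \<ge> 0" and T: "T > 0"
  shows "(LINT z:inside_cone|lborel. D (snd z) * w z)
    \<le> 4 * pi * T / l * (LINT x|lborel. D x * (w (norm x, x) / (4 * pi * norm x)))"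
proof -
  have int: "set_integrable lborel inside_cone (\<lambda>z. D (snd z) * w z)"
  proof (rule cone_set_integrable[where T=T])
    have "continuous_on UNIV (\<lambda>z::spacetime. D (snd z))"
      by (rule continuous_on_compose2[OF D(1)]) (auto intro!: continuous_intros)
    then show "continuous_on closed_cone (\<lambda>z. D (snd z) * w z)"
      by (intro continuous_on_mult smooth_continuous_on[OF smooth_w]) (rule continuous_on_subset, auto)
  qed (simp add: vanishes_afterD[OF vanishes_after_w])
  define f where "f t x = indicator inside_cone (t, x) *\<^sub>R (D x * w (t, x))" for t x
  have "integrable (lborel \<Otimes>\<^sub>M lborel) (case_prod f)"
    using int unfolding set_integrable_def lborel_prod f_def by (simp add: case_prod_beta')
  from lborel_pair.integral_snd[OF this]
  have "(LINT x|lborel. (LINT t|lborel. f t x)) = (LINT z:inside_cone|lborel. D (snd z) * w z)"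
    unfolding set_lebesgue_integral_def lborel_prod f_def by (simp add: case_prod_beta')
  moreover have "(LINT t|lborel. f t x) = D x * newton primitive (norm x, x)" for x
    unfolding f_def integral_w_time[symmetric] integral_mult_right_zero[symmetric]
    by (simp add: mult.left_commute)
  ultimately have "(LINT z:inside_cone|lborel. D (snd z) * w z) = (LINT x|lborel. D x * newton primitive (norm x, x))" by simp
  also have "\<dots> \<le> (LINT x|lborel. 4 * pi * T / l * (D x * (w (norm x, x) / (4 * pi * norm x))))"
  proof (rule integral_mono_AE)
    show "integrable lborel (\<lambda>x. 4 * pi * T / l * (D x * (w (norm x, x) / (4 * pi * norm x))))"
      by (rule Bochner_Integration.integrable_mult_right[OF cone_surface_integrable[OF D(1) smooth_continuous_on[OF smooth_w] vanishes_after_w]])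
    note sp = smooth_newton[OF smooth_primitive vanishes_after_primitive]
    have "continuous_on UNIV (\<lambda>x::real^3. newton primitive (norm x, x))"
      by (rule continuous_on_compose2[OF smooth_continuous_on[OF sp, of UNIV]]) (auto intro!: continuous_intros)
    then have "continuous_on UNIV (\<lambda>x. D x * newton primitive (norm x, x))" by (intro continuous_on_mult D(1))
    then show "integrable lborel (\<lambda>x. D x * newton primitive (norm x, x))"
    proof (rule integrable_continuous_bounded_support[where r=T])
      show "D x * newton primitive (norm x, x) = 0" if "norm x > T" for x
        using vanishes_afterD[OF vanishes_after_cone_integral[OF vanishes_after_primitive], of "(norm x, x)"] that by simp
    qed
    have "AE x in lborel. x \<noteq> (0::real^3)" by (rule AE_lborel_singleton)
    then show "AE x in lborel. D x * newton primitive (norm x, x) \<le> 4 * pi * T / l * (D x * (w (norm x, x) / (4 * pi * norm x)))"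
    proof eventually_elim
      fix x :: "real^3" assume x: "x \<noteq> 0"
      have "newton primitive (norm x, x) \<le> T / l * (w (norm x, x) / norm x)"
      proof (cases "norm x \<le> T")
        case True
        have "newton primitive (norm x, x) \<le> 1 * (w (norm x, x) / l)" using newton_primitive_le by simp
        also have "\<dots> \<le> (T / norm x) * (w (norm x, x) / l)"
          using True x l w_nonneg by (intro mult_right_mono) auto
        finally show ?thesis by (simp add: field_simps)
      next
        case False
        then show ?thesis
          using vanishes_afterD[OF vanishes_after_cone_integral[OF vanishes_after_primitive], of "(norm x, x)"]
            vanishes_afterD[OF vanishes_after_w, of "(norm x, x)"] by simp
      qed
      from mult_left_mono[OF this D(2)[of x]]
      show "D x * newton primitive (norm x, x) \<le> 4 * pi * T / l * (D x * (w (norm x, x) / (4 * pi * norm x)))"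
        by (simp add: mult_ac)
    qed
  qed
  also have "\<dots> = 4 * pi * T / l * (LINT x|lborel. D x * (w (norm x, x) / (4 * pi * norm x)))"
    by (rule integral_mult_right_zero)
  finally show ?thesis .
qed

end

section \<open>The weighted estimate\<close>

lemma set_integral_abs_le:
  fixes f g :: "_ \<Rightarrow> real"
  assumes f: "set_integrable M A f" and g: "set_integrable M A g" and "\<And>x. x \<in> A \<Longrightarrow> \<bar>f x\<bar> \<le> g x"
  shows "\<bar>LINT x:A|M. f x\<bar> \<le> (LINT x:A|M. g x)"
proof -
  have "(LINT x:A|M. f x) \<le> (LINT x:A|M. g x)"
    using assms(3) by (intro set_integral_mono f g) (auto simp: abs_le_iff)
  moreover have "(LINT x:A|M. (-1) * f x) \<le> (LINT x:A|M. g x)"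
    using assms(3) by (intro set_integral_mono g set_integrable_mult_right f) (auto simp: abs_le_iff)
  then have "- (LINT x:A|M. f x) \<le> (LINT x:A|M. g x)" by (simp only: set_integral_mult_right)
  ultimately show ?thesis by linarith
qed

lemma cone_mult_integrable:
  fixes F :: "spacetime \<Rightarrow> real"
  assumes "continuous_on closed_cone F" "smooth \<psi>" "vanishes_after T \<psi>"
  shows "set_integrable lborel inside_cone (\<lambda>z. F z * \<psi> z)"
  by (rule cone_set_integrable[where T=T])
     (use assms in \<open>simp_all add: continuous_on_mult smooth_continuous_on vanishes_afterD\<close>)

locale wave_pair =
  fixes P1 P2 :: potential and U1 U2 :: vec_distribution and R1 R2 :: "spacetime \<Rightarrow> real ^ 2"
  assumes P1: "\<And>i j. smooth (\<lambda>x. P1 x $ i $ j)" and P2: "\<And>i j. smooth (\<lambda>x. P2 x $ i $ j)"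
    and ivp: "solves_ivp P1 U1" "solves_ivp P2 U2"
    and reg: "regular_part P1 U1 R1" "regular_part P2 U2 R2"
    and ge: "\<And>x i j. P1 x $ i $ j \<ge> P2 x $ i $ j"
begin

definition gap :: "2 \<Rightarrow> real ^ 3 \<Rightarrow> real" where
  "gap i x = (\<Sum>j\<in>UNIV. P1 x $ i $ j - P2 x $ i $ j)"

definition diff_R :: "2 \<Rightarrow> spacetime \<Rightarrow> real" where
  "diff_R i z = (R1 z - R2 z) $ i"

definition diff_PR :: "2 \<Rightarrow> spacetime \<Rightarrow> real" where
  "diff_PR i z = (P1 (snd z) *v R1 z - P2 (snd z) *v R2 z) $ i"

lemma gap_nonneg: "gap i x \<ge> 0"
  unfolding gap_def by (intro sum_nonneg) (simp add: ge)

lemma continuous_gap: "continuous_on S (gap i)"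
  unfolding gap_def[abs_def]
  by (intro continuous_on_sum continuous_on_diff smooth_continuous_on[OF P1] smooth_continuous_on[OF P2])

lemmas continuous_R = regular_part_continuous[OF reg(1)] regular_part_continuous[OF reg(2)]

lemma continuous_diff_R: "continuous_on closed_cone (diff_R i)"
  unfolding diff_R_def by (intro continuous_on_component continuous_on_diff continuous_R)

lemma continuous_diff_PR: "continuous_on closed_cone (diff_PR i)"
  using continuous_on_diff[OF continuous_on_potential_mult[OF P1 continuous_R(1), of i]
      continuous_on_potential_mult[OF P2 continuous_R(2), of i]]
  by (simp add: diff_PR_def[abs_def])

lemma representation:
  assumes "smooth g" "vanishes_after T g"
  shows "newton_const * (LINT z:inside_cone|lborel. diff_R i z * g z)
    = (LINT x|lborel. gap i x * (newton g (norm x, x) / (4 * pi * norm x)))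
      + (LINT z:inside_cone|lborel. diff_PR i z * newton g z)"
  unfolding gap_def diff_R_def diff_PR_def by (rule representation_formula[OF P1 P2 ivp reg assms])

text \<open>Splits P1 R1 - P2 R2 into (P1 - P2) R2 + P1 (R1 - R2), with \<open>R2\<close> and
  \<open>P1\<close> bounded on the truncated cone. The entries of P1 - P2 are nonnegative, so their
  absolute values add up to the gap itself.\<close>

lemma diff_PR_bound:
  obtains M where "M \<ge> 0"
    "\<And>i z. z \<in> closed_cone \<Longrightarrow> fst z \<le> T \<Longrightarrow>
      \<bar>diff_PR i z\<bar> \<le> M * gap i (snd z) + M * (\<Sum>j\<in>UNIV. \<bar>diff_R j z\<bar>)"
proof -
  let ?K = "closed_cone \<inter> {z. fst z \<le> T}"
  have bdd: "\<exists>B. \<forall>z\<in>?K. \<bar>f z\<bar> \<le> B" if "continuous_on closed_cone f" for f :: "spacetime \<Rightarrow> real"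
  proof -
    have "bounded (f ` ?K)"
      by (intro compact_imp_bounded compact_continuous_image compact_truncated_cone continuous_on_subset[OF that]) auto
    then show ?thesis unfolding bounded_iff by auto
  qed
  have "\<exists>B. \<forall>z\<in>?K. \<bar>P1 (snd z) $ i $ j\<bar> \<le> B" for i j
    by (rule bdd[OF smooth_continuous_on[OF smooth_snd[OF P1]]])
  then obtain A where A: "\<And>i j z. z \<in> ?K \<Longrightarrow> \<bar>P1 (snd z) $ i $ j\<bar> \<le> A i j" by metis
  have "\<exists>B. \<forall>z\<in>?K. \<bar>R2 z $ j\<bar> \<le> B" for j
    by (rule bdd[OF continuous_on_component[OF continuous_R(2)]])
  then obtain B where B: "\<And>j z. z \<in> ?K \<Longrightarrow> \<bar>R2 z $ j\<bar> \<le> B j" by metis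
  define M where "M = (\<Sum>i\<in>UNIV. \<Sum>j\<in>UNIV. \<bar>A i j\<bar>) + (\<Sum>j\<in>UNIV. \<bar>B j\<bar>)"
  have nn: "(\<Sum>i\<in>UNIV. \<Sum>j\<in>UNIV. \<bar>A i j\<bar>) \<ge> 0" "(\<Sum>j\<in>UNIV. \<bar>B j\<bar>) \<ge> 0" by (auto intro!: sum_nonneg)
  have MA: "\<bar>A i j\<bar> \<le> M" for i j
  proof -
    have "\<bar>A i j\<bar> \<le> (\<Sum>j\<in>UNIV. \<bar>A i j\<bar>)" by (rule member_le_sum) auto
    also have "\<dots> \<le> (\<Sum>i\<in>UNIV. \<Sum>j\<in>UNIV. \<bar>A i j\<bar>)"
      by (rule member_le_sum[of i _ "\<lambda>i. \<Sum>j\<in>UNIV. \<bar>A i j\<bar>"]) (auto intro!: sum_nonneg)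
    finally show ?thesis using nn unfolding M_def by linarith
  qed
  have MB: "\<bar>B j\<bar> \<le> M" for j
  proof -
    have "\<bar>B j\<bar> \<le> (\<Sum>j\<in>UNIV. \<bar>B j\<bar>)" by (rule member_le_sum) auto
    then show ?thesis using nn unfolding M_def by linarith
  qed
  show ?thesis
  proof (rule that[of M])
    show "M \<ge> 0" using nn by (simp add: M_def)
    fix i z assume "z \<in> closed_cone" "fst z \<le> T"
    then have z: "z \<in> ?K" by simp
    have "diff_PR i z = (\<Sum>j\<in>UNIV. (P1 (snd z) $ i $ j - P2 (snd z) $ i $ j) * R2 z $ j + P1 (snd z) $ i $ j * diff_R j z)"
      by (simp add: diff_PR_def diff_R_def matrix_vector_mult_def sum_subtractf[symmetric] algebra_simps)
    also have "\<bar>\<dots>\<bar> \<le> (\<Sum>j\<in>UNIV. M * (P1 (snd z) $ i $ j - P2 (snd z) $ i $ j) + M * \<bar>diff_R j z\<bar>)"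
    proof (intro order.trans[OF sum_abs] sum_mono order.trans[OF abs_triangle_ineq] add_mono)
      fix j
      have "\<bar>R2 z $ j\<bar> \<le> M" using B[OF z, of j] MB[of j] by linarith
      then show "\<bar>(P1 (snd z) $ i $ j - P2 (snd z) $ i $ j) * R2 z $ j\<bar> \<le> M * (P1 (snd z) $ i $ j - P2 (snd z) $ i $ j)"
        using ge[of "snd z" i j] by (simp add: abs_mult mult.commute mult_right_mono)
      have "\<bar>P1 (snd z) $ i $ j\<bar> \<le> M" using A[OF z, of i j] MA[of i j] by linarith
      then show "\<bar>P1 (snd z) $ i $ j * diff_R j z\<bar> \<le> M * \<bar>diff_R j z\<bar>"
        by (simp add: abs_mult mult_right_mono)
    qed
    also have "\<dots> = M * gap i (snd z) + M * (\<Sum>j\<in>UNIV. \<bar>diff_R j z\<bar>)"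
      by (simp only: gap_def sum.distrib sum_distrib_left[symmetric])
    finally show "\<bar>diff_PR i z\<bar> \<le> M * gap i (snd z) + M * (\<Sum>j\<in>UNIV. \<bar>diff_R j z\<bar>)" .
  qed
qed

end

locale weighted_wave_pair = wave_pair P1 P2 U1 U2 R1 R2 + weight T l \<rho>
  for P1 P2 U1 U2 R1 R2 T l \<rho> +
  assumes T: "T > 0"
begin

text \<open>The quantity to be bounded. Of the three integrals that follow, \<open>data_term\<close>
  is controlled by the observation near e, and the other two are errors to be absorbed.\<close>

definition surface_term :: "2 \<Rightarrow> real" where
  "surface_term i = (LINT x|lborel. gap i x * (w (norm x, x) / (4 * pi * norm x)))"

definition data_term :: "2 \<Rightarrow> real" where
  "data_term i = (LINT z:inside_cone|lborel. diff_R i z * source z)"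

definition R_term :: "2 \<Rightarrow> real" where
  "R_term i = (LINT z:inside_cone|lborel. \<bar>diff_R i z\<bar> * w z)"

definition PR_term :: "2 \<Rightarrow> real" where
  "PR_term i = (LINT z:inside_cone|lborel. \<bar>diff_PR i z\<bar> * w z)"

lemma surface_term_nonneg: "surface_term i \<ge> 0"
  unfolding surface_term_def by (rule integral_nonneg_AE) (simp add: gap_nonneg w_nonneg)

lemmas w_integrable = cone_mult_integrable[OF _ smooth_w vanishes_after_w]

text \<open>The representation for \<open>source\<close>, solved for the surface integral; the
  remaining terms are estimated by absolute values.\<close>

lemma surface_term_le: "surface_term i \<le> newton_const * \<bar>data_term i\<bar> + PR_term i"
proof -
  have "\<bar>LINT z:inside_cone|lborel. diff_PR i z * w z\<bar> \<le> PR_term i" unfolding PR_term_def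
    by (rule set_integral_abs_le)
       (auto intro!: w_integrable continuous_diff_PR continuous_on_rabs simp: abs_mult w_nonneg)
  moreover have "newton_const * data_term i = surface_term i + (LINT z:inside_cone|lborel. diff_PR i z * w z)"
    unfolding data_term_def surface_term_def
    using representation[OF smooth_source vanishes_after_source, of i] by (simp add: w_def)
  moreover have "newton_const * data_term i \<le> newton_const * \<bar>data_term i\<bar>"
    using newton_const_pos by (intro mult_left_mono) auto
  ultimately show ?thesis by linarith
qed

text \<open>The part of the error that contains the gap lives on the solid cone but returns to the
  surface with a factor 1/l; the part that contains R is left to \<open>R_term_le\<close>.\<close>

lemma PR_term_le:
  assumes M: "M \<ge> 0"
    "\<And>i z. z \<in> closed_cone \<Longrightarrow> fst z \<le> T \<Longrightarrow>
      \<bar>diff_PR i z\<bar> \<le> M * gap i (snd z) + M * (\<Sum>j\<in>UNIV. \<bar>diff_R j z\<bar>)"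
  shows "PR_term i \<le> M * (4 * pi * T / l * surface_term i) + M * (\<Sum>j\<in>UNIV. R_term j)"
proof -
  have cg: "continuous_on closed_cone (\<lambda>z. gap i (snd z))"
    by (rule continuous_on_compose2[OF continuous_gap[of UNIV]]) (auto intro!: continuous_intros)
  have i1: "set_integrable lborel inside_cone (\<lambda>z. gap i (snd z) * w z)" by (rule w_integrable[OF cg])
  have i2: "set_integrable lborel inside_cone (\<lambda>z. \<bar>diff_R j z\<bar> * w z)" for j
    by (rule w_integrable) (intro continuous_on_rabs continuous_diff_R)
  have i3: "set_integrable lborel inside_cone (\<lambda>z. \<Sum>j\<in>UNIV. \<bar>diff_R j z\<bar> * w z)"
    using i2 unfolding set_integrable_def scaleR_sum_right by (intro Bochner_Integration.integrable_sum)
  have "PR_term i \<le> (LINT z:inside_cone|lborel. M * (gap i (snd z) * w z) + M * (\<Sum>j\<in>UNIV. \<bar>diff_R j z\<bar> * w z))"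
    unfolding PR_term_def
  proof (rule set_integral_mono)
    show "set_integrable lborel inside_cone (\<lambda>z. \<bar>diff_PR i z\<bar> * w z)"
      by (rule w_integrable) (intro continuous_on_rabs continuous_diff_PR)
    show "set_integrable lborel inside_cone (\<lambda>z. M * (gap i (snd z) * w z) + M * (\<Sum>j\<in>UNIV. \<bar>diff_R j z\<bar> * w z))"
      by (intro set_integral_add(1) set_integrable_mult_right i1 i3)
    fix z assume z: "z \<in> inside_cone"
    show "\<bar>diff_PR i z\<bar> * w z \<le> M * (gap i (snd z) * w z) + M * (\<Sum>j\<in>UNIV. \<bar>diff_R j z\<bar> * w z)"
    proof (cases "fst z \<le> T")
      case True
      then have "\<bar>diff_PR i z\<bar> * w z \<le> (M * gap i (snd z) + M * (\<Sum>j\<in>UNIV. \<bar>diff_R j z\<bar>)) * w z"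
        using z inside_closed_cone by (intro mult_right_mono M(2) w_nonneg) auto
      then show ?thesis by (simp add: sum_distrib_right distrib_right mult.assoc)
    qed (use vanishes_afterD[OF vanishes_after_w, of z] in simp)
  qed
  also have "\<dots> = M * (LINT z:inside_cone|lborel. gap i (snd z) * w z)
      + M * (LINT z:inside_cone|lborel. (\<Sum>j\<in>UNIV. \<bar>diff_R j z\<bar> * w z))"
    by (subst set_integral_add(2)) (auto intro!: set_integrable_mult_right i1 i3)
  also have "(LINT z:inside_cone|lborel. (\<Sum>j\<in>UNIV. \<bar>diff_R j z\<bar> * w z)) = (\<Sum>j\<in>UNIV. R_term j)"
    unfolding R_term_def set_lebesgue_integral_def scaleR_sum_right
    by (rule Bochner_Integration.integral_sum) (use i2 in \<open>simp add: set_integrable_def\<close>)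
  also have "(LINT z:inside_cone|lborel. gap i (snd z) * w z) \<le> 4 * pi * T / l * surface_term i"
    unfolding surface_term_def by (rule cone_integral_w_le[OF continuous_gap gap_nonneg T])
  finally show ?thesis using M(1) by (simp add: mult_left_mono)
qed

text \<open>Testing with \<open>g = p w\<close>, where \<open>p\<close> is a polynomial approximation of the sign of \<open>diff_R i\<close>;
  here the positivity of the fundamental solution enters.\<close>

lemma R_term_approx:
  assumes \<delta>: "\<delta> > 0"
  shows "newton_const * (R_term i - \<delta> * (LINT z:inside_cone|lborel. 1 * w z) - \<delta> * R_term i)
    \<le> (1 + \<delta>) * (newton_const * T / (2 * l)) * (surface_term i + PR_term i)"
proof -
  let ?K = "closed_cone \<inter> {z. fst z \<le> T}"
  define C where "C = newton_const * T / (2 * l)"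
  have C: "C \<ge> 0" using newton_const_pos T l by (simp add: C_def)
  \<comment> \<open>A continuous substitute for the sign: it is bounded by 1, and its product with r
    = \<open>diff_R i z\<close> is at least |r| - \<delta>.\<close>
  define \<theta> where "\<theta> z = diff_R i z / (\<bar>diff_R i z\<bar> + \<delta>)" for z
  have "continuous_on ?K \<theta>" unfolding \<theta>_def
    by (intro continuous_on_divide continuous_on_add continuous_on_rabs continuous_on_const
        continuous_on_subset[OF continuous_diff_R]) (use \<delta> in \<open>auto simp: add_nonneg_eq_0_iff\<close>)
  \<comment> \<open>The function \<open>g\<close> has to be smooth, while \<theta> is merely
    continuous; a polynomial close to \<theta> on the compact truncated cone repairs this.\<close>
  then obtain p where p: "real_polynomial_function p" "\<And>z. z \<in> ?K \<Longrightarrow> \<bar>\<theta> z - p z\<bar> < \<delta>"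
    using Stone_Weierstrass_real_polynomial_function[OF compact_truncated_cone _ \<delta>] by metis
  have sp: "smooth p" by (rule smooth_real_polynomial_function[OF p(1)])
  define g where "g z = p z * w z" for z
  have sg: "smooth g" unfolding g_def by (rule smooth_mult[OF sp smooth_w])
  have vg: "vanishes_after T g" using vanishes_after_w by (simp add: vanishes_after_def g_def)
  have p1: "\<bar>p z\<bar> \<le> 1 + \<delta>" if "z \<in> ?K" for z
  proof -
    have "\<bar>\<theta> z\<bar> \<le> 1" using \<delta> by (simp add: \<theta>_def abs_divide)
    then show ?thesis using p(2)[OF that] by linarith
  qed
  have ng: "\<bar>newton g z\<bar> \<le> (1 + \<delta>) * C * w z" if z: "z \<in> closed_cone" for z
  proof -
    have ig: "integrable lborel (\<lambda>y. g (z + (norm y, y)) * (1 / norm y))"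
      by (rule cone_integrable[OF locally_integrable_inverse_norm smooth_continuous_on[OF sg] vg])
    have iw: "integrable lborel (\<lambda>y. w (z + (norm y, y)) * (1 / norm y))"
      by (rule cone_integrable[OF locally_integrable_inverse_norm smooth_continuous_on[OF smooth_w] vanishes_after_w])
    have "\<bar>newton g z\<bar> \<le> (LINT y|lborel. \<bar>g (z + (norm y, y)) * (1 / norm y)\<bar>)"
      unfolding cone_integral_def by (rule integral_abs_bound)
    also have "\<dots> \<le> (LINT y|lborel. (1 + \<delta>) * (w (z + (norm y, y)) * (1 / norm y)))"
    proof (rule integral_mono[OF integrable_abs[OF ig] Bochner_Integration.integrable_mult_right[OF iw]])
      fix y :: "real^3"
      \<comment> \<open>Forward cones with vertex in the closed cone stay in it, so only values of
        \<open>p\<close> on the truncated cone matter, where the bound 1 + \<delta> holds.\<close>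
      have y: "z + (norm y, y) \<in> closed_cone"
        using z norm_triangle_ineq[of "snd z" y] by (cases z) (simp add: closed_cone_def)
      have "\<bar>g (z + (norm y, y))\<bar> \<le> (1 + \<delta>) * w (z + (norm y, y))"
      proof (cases "fst (z + (norm y, y)) \<le> T")
        case True
        then show ?thesis using p1[of "z + (norm y, y)"] y w_nonneg
          by (simp add: g_def abs_mult mult_right_mono)
      next
        case False
        then have "w (z + (norm y, y)) = 0" by (intro vanishes_afterD[OF vanishes_after_w]) simp
        then show ?thesis by (simp add: g_def)
      qed
      then have "\<bar>g (z + (norm y, y))\<bar> * (1 / norm y) \<le> (1 + \<delta>) * w (z + (norm y, y)) * (1 / norm y)"
        by (rule mult_right_mono) simp
      then show "\<bar>g (z + (norm y, y)) * (1 / norm y)\<bar> \<le> (1 + \<delta>) * (w (z + (norm y, y)) * (1 / norm y))"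
        by (simp add: abs_mult)
    qed
    also have "\<dots> = (1 + \<delta>) * newton w z" unfolding cone_integral_def by (rule integral_mult_right_zero)
    also have "\<dots> \<le> (1 + \<delta>) * (C * w z)"
    proof (rule mult_left_mono)
      have "norm (snd z) \<le> fst z" using z by (cases z) (simp add: closed_cone_def)
      then have "fst z \<ge> 0" using norm_ge_zero[of "snd z"] by linarith
      then show "newton w z \<le> C * w z" unfolding C_def by (rule newton_w_le)
    qed (use \<delta> in simp)
    finally show ?thesis by simp
  qed
  have "(LINT x|lborel. gap i x * (newton g (norm x, x) / (4 * pi * norm x)))
      \<le> (LINT x|lborel. (1 + \<delta>) * C * (gap i x * (w (norm x, x) / (4 * pi * norm x))))"
  proof (rule integral_mono)
    show "integrable lborel (\<lambda>x. gap i x * (newton g (norm x, x) / (4 * pi * norm x)))"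
      by (rule cone_surface_integrable[OF continuous_gap smooth_continuous_on[OF smooth_newton[OF sg vg]]
          vanishes_after_cone_integral[OF vg]])
    show "integrable lborel (\<lambda>x. (1 + \<delta>) * C * (gap i x * (w (norm x, x) / (4 * pi * norm x))))"
      by (rule Bochner_Integration.integrable_mult_right[OF cone_surface_integrable[OF continuous_gap smooth_continuous_on[OF smooth_w] vanishes_after_w]])
    fix x :: "real^3"
    have "newton g (norm x, x) \<le> (1 + \<delta>) * C * w (norm x, x)"
      using ng[of "(norm x, x)"] by (simp add: closed_cone_def)
    then have "gap i x * (newton g (norm x, x) / (4 * pi * norm x)) \<le> gap i x * ((1 + \<delta>) * C * w (norm x, x) / (4 * pi * norm x))"
      by (intro mult_left_mono divide_right_mono gap_nonneg) auto
    then show "gap i x * (newton g (norm x, x) / (4 * pi * norm x)) \<le> (1 + \<delta>) * C * (gap i x * (w (norm x, x) / (4 * pi * norm x)))"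
      by (simp add: mult_ac)
  qed
  then have 1: "(LINT x|lborel. gap i x * (newton g (norm x, x) / (4 * pi * norm x))) \<le> (1 + \<delta>) * C * surface_term i"
    by (simp only: integral_mult_right_zero surface_term_def)
  have iPR: "set_integrable lborel inside_cone (\<lambda>z. \<bar>diff_PR i z\<bar> * w z)"
    by (rule w_integrable) (intro continuous_on_rabs continuous_diff_PR)
  have "(LINT z:inside_cone|lborel. diff_PR i z * newton g z) \<le> (LINT z:inside_cone|lborel. (1 + \<delta>) * C * (\<bar>diff_PR i z\<bar> * w z))"
  proof (rule set_integral_mono)
    show "set_integrable lborel inside_cone (\<lambda>z. diff_PR i z * newton g z)"
      by (rule cone_mult_integrable[OF continuous_diff_PR smooth_newton[OF sg vg] vanishes_after_cone_integral[OF vg]])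
    show "set_integrable lborel inside_cone (\<lambda>z. (1 + \<delta>) * C * (\<bar>diff_PR i z\<bar> * w z))"
      by (intro set_integrable_mult_right iPR)
    fix z assume "z \<in> inside_cone"
    then have "\<bar>newton g z\<bar> \<le> (1 + \<delta>) * C * w z" using inside_closed_cone by (intro ng) auto
    then have "\<bar>diff_PR i z\<bar> * \<bar>newton g z\<bar> \<le> \<bar>diff_PR i z\<bar> * ((1 + \<delta>) * C * w z)"
      by (rule mult_left_mono) simp
    then show "diff_PR i z * newton g z \<le> (1 + \<delta>) * C * (\<bar>diff_PR i z\<bar> * w z)"
      using abs_ge_self[of "diff_PR i z * newton g z"] by (simp add: abs_mult mult_ac)
  qed
  then have 2: "(LINT z:inside_cone|lborel. diff_PR i z * newton g z) \<le> (1 + \<delta>) * C * PR_term i"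
    by (simp only: set_integral_mult_right PR_term_def)
  have iR: "set_integrable lborel inside_cone (\<lambda>z. \<bar>diff_R i z\<bar> * w z)"
    by (rule w_integrable) (intro continuous_on_rabs continuous_diff_R)
  have i1: "set_integrable lborel inside_cone (\<lambda>z. 1 * w z)"
    by (rule w_integrable) (rule continuous_on_const)
  have "(LINT z:inside_cone|lborel. (\<bar>diff_R i z\<bar> * w z - \<delta> * (1 * w z)) - \<delta> * (\<bar>diff_R i z\<bar> * w z))
      \<le> (LINT z:inside_cone|lborel. diff_R i z * g z)"
  proof (rule set_integral_mono)
    show "set_integrable lborel inside_cone (\<lambda>z. (\<bar>diff_R i z\<bar> * w z - \<delta> * (1 * w z)) - \<delta> * (\<bar>diff_R i z\<bar> * w z))"
      by (intro set_integral_diff(1) set_integrable_mult_right iR i1)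
    show "set_integrable lborel inside_cone (\<lambda>z. diff_R i z * g z)"
      by (rule cone_mult_integrable[OF continuous_diff_R sg vg])
    fix z assume z: "z \<in> inside_cone"
    show "(\<bar>diff_R i z\<bar> * w z - \<delta> * (1 * w z)) - \<delta> * (\<bar>diff_R i z\<bar> * w z) \<le> diff_R i z * g z"
    proof (cases "fst z \<le> T")
      case True
      then have K: "z \<in> ?K" using z inside_closed_cone by auto
      define r where "r = diff_R i z"
      have "r * (\<theta> z - p z) \<le> \<bar>r\<bar> * \<bar>\<theta> z - p z\<bar>" by (metis abs_ge_self abs_mult)
      also have "\<dots> \<le> \<bar>r\<bar> * \<delta>" using p(2)[OF K] by (intro mult_left_mono) auto
      finally have "r * \<theta> z - \<delta> * \<bar>r\<bar> \<le> r * p z" by (simp add: algebra_simps)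
      moreover have "\<bar>r\<bar> - \<delta> \<le> r * \<theta> z"
      proof -
        have "(\<bar>r\<bar> - \<delta>) * (\<bar>r\<bar> + \<delta>) \<le> r * r" using \<delta> by (simp add: algebra_simps abs_mult_self_eq)
        then show ?thesis using \<delta> unfolding \<theta>_def r_def[symmetric] by (simp add: pos_le_divide_eq)
      qed
      ultimately have "(\<bar>r\<bar> - \<delta> - \<delta> * \<bar>r\<bar>) * w z \<le> r * p z * w z"
        by (intro mult_right_mono w_nonneg) linarith
      then show ?thesis unfolding r_def[symmetric] g_def by (simp add: algebra_simps)
    qed (use vanishes_afterD[OF vanishes_after_w, of z] in \<open>simp add: g_def\<close>)
  qed
  moreover have "(LINT z:inside_cone|lborel. (\<bar>diff_R i z\<bar> * w z - \<delta> * (1 * w z)) - \<delta> * (\<bar>diff_R i z\<bar> * w z))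
     = R_term i - \<delta> * (LINT z:inside_cone|lborel. 1 * w z) - \<delta> * R_term i"
    unfolding R_term_def
    by (subst set_integral_diff(2), (intro set_integral_diff(1) set_integrable_mult_right iR i1)+,
        subst set_integral_diff(2), (intro set_integrable_mult_right iR i1)+) (simp only: set_integral_mult_right)
  ultimately have "newton_const * (R_term i - \<delta> * (LINT z:inside_cone|lborel. 1 * w z) - \<delta> * R_term i)
      \<le> newton_const * (LINT z:inside_cone|lborel. diff_R i z * g z)"
    using newton_const_pos by (intro mult_left_mono) auto
  also have "\<dots> \<le> (1 + \<delta>) * C * (surface_term i + PR_term i)"
    unfolding representation[OF sg vg] distrib_left using 1 2 by linarith
  finally show ?thesis by (simp only: C_def)
qed

text \<open>Limit \<delta> -> 0 with the source and l fixed: the integrals do not depend on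
  \<delta>. Afterwards \<open>newton_const\<close> cancels.\<close>

lemma R_term_le: "R_term i \<le> T / (2 * l) * (surface_term i + PR_term i)"
proof -
  let ?W = "LINT z:inside_cone|lborel. 1 * w z"
  let ?S = "surface_term i + PR_term i"
  have "newton_const * (R_term i - 0 * ?W - 0 * R_term i) \<le> (1 + 0) * (newton_const * T / (2 * l)) * ?S"
  proof (rule tendsto_le[OF trivial_limit_at_right_real])
    show "((\<lambda>\<delta>. (1 + \<delta>) * (newton_const * T / (2 * l)) * ?S) \<longlongrightarrow> (1 + 0) * (newton_const * T / (2 * l)) * ?S) (at_right 0)"
      by (intro tendsto_intros)
    show "((\<lambda>\<delta>. newton_const * (R_term i - \<delta> * ?W - \<delta> * R_term i)) \<longlongrightarrow> newton_const * (R_term i - 0 * ?W - 0 * R_term i)) (at_right 0)"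
      by (intro tendsto_intros)
    show "\<forall>\<^sub>F \<delta> in at_right 0. newton_const * (R_term i - \<delta> * ?W - \<delta> * R_term i) \<le> (1 + \<delta>) * (newton_const * T / (2 * l)) * ?S"
      by (rule eventually_at_rightI[of 0 1], rule R_term_approx) auto
  qed
  then have "newton_const * R_term i \<le> newton_const * (T / (2 * l) * ?S)" by simp
  then show ?thesis using newton_const_pos by (simp only: mult_le_cancel_left_pos)
qed

text \<open>The estimates form a loop that closes for large l. With A, N, B the sums of the surface,
  PR and R terms, \<open>large\<close> makes 4 \<pi> T M / l and T M / l at most 1/8, hence N <= A/8
  + 2 M B and 2 M B <= (A + N)/8, the 2 being the number of components. This gives N <= 2 A/7, which
  is absorbed by A.\<close>

lemma surface_term_le_data_term:
  assumes M: "M \<ge> 0"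
    "\<And>i z. z \<in> closed_cone \<Longrightarrow> fst z \<le> T \<Longrightarrow>
      \<bar>diff_PR i z\<bar> \<le> M * gap i (snd z) + M * (\<Sum>j\<in>UNIV. \<bar>diff_R j z\<bar>)"
    and large: "l \<ge> 32 * pi * T * M"
  shows "(\<Sum>i\<in>UNIV. surface_term i) \<le> 2 * newton_const * (\<Sum>i\<in>UNIV. \<bar>data_term i\<bar>)"
proof -
  let ?A = "\<Sum>i\<in>UNIV. surface_term i" and ?N = "\<Sum>i\<in>UNIV. PR_term i" and ?B = "\<Sum>i\<in>UNIV. R_term i"
  have card: "(\<Sum>i\<in>(UNIV :: 2 set). c) = 2 * c" for c :: real by simp
  have A0: "?A \<ge> 0" by (intro sum_nonneg surface_term_nonneg)
  have "PR_term i \<ge> 0" for i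
    unfolding PR_term_def set_lebesgue_integral_def by (rule integral_nonneg_AE) (simp add: w_nonneg)
  then have N0: "?N \<ge> 0" by (intro sum_nonneg)
  have S0: "?A + ?N \<ge> 0" using A0 N0 by linarith
  have s1: "M * (4 * pi * T / l) \<le> 1 / 8" using large l by (simp add: field_simps)
  have "32 * T * M \<le> 32 * pi * T * M"
    using pi_gt3 T M(1) by (intro mult_right_mono mult_left_mono[of 1 pi 32, simplified]) auto
  then have s2: "M * (T / l) \<le> 1 / 8" using large l by (simp add: field_simps)
  have "?A \<le> (\<Sum>i\<in>UNIV. newton_const * \<bar>data_term i\<bar> + PR_term i)"
    by (intro sum_mono surface_term_le)
  then have 1: "?A \<le> newton_const * (\<Sum>i\<in>UNIV. \<bar>data_term i\<bar>) + ?N"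
    by (simp add: sum.distrib sum_distrib_left)
  have "?N \<le> (\<Sum>i\<in>UNIV. M * (4 * pi * T / l * surface_term i) + M * ?B)"
    by (intro sum_mono PR_term_le M)
  also have "\<dots> = M * (4 * pi * T / l) * ?A + 2 * (M * ?B)"
    unfolding sum.distrib card by (simp only: sum_distrib_left mult.assoc)
  also have "\<dots> \<le> 1 / 8 * ?A + 2 * (M * ?B)"
    using mult_right_mono[OF s1 A0] by linarith
  finally have 2: "?N \<le> 1 / 8 * ?A + 2 * (M * ?B)" .
  have "?B \<le> (\<Sum>i\<in>UNIV. T / (2 * l) * (surface_term i + PR_term i))"
    by (intro sum_mono R_term_le)
  also have "\<dots> = T / (2 * l) * (?A + ?N)" by (simp only: sum_distrib_left[symmetric] sum.distrib)
  finally have "M * ?B \<le> M * (T / (2 * l) * (?A + ?N))" using M(1) by (rule mult_left_mono)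
  also have "\<dots> = 1 / 2 * ((M * (T / l)) * (?A + ?N))" by simp
  also have "\<dots> \<le> 1 / 2 * (1 / 8 * (?A + ?N))"
    using mult_right_mono[OF s2 S0] by linarith
  finally have 3: "2 * (M * ?B) \<le> 1 / 8 * (?A + ?N)" by simp
  show ?thesis using 1 2 3 A0 N0 by (simp add: field_simps)
qed

end

section \<open>Vanishing of the gap\<close>

context weighted_wave_pair
begin

text \<open>The bound is proportional to the mass of \<rho>, as is the lower bound in
  \<open>w_ge\<close>; so the small factor \<eta> is not consumed when \<rho> concentrates.\<close>

lemma data_term_le:
  assumes C: "C \<ge> 0" "\<And>t. 0 \<le> t \<Longrightarrow> t \<le> T \<Longrightarrow> decay_rate T l t \<le> C" and \<eta>: "\<eta> \<ge> 0"
    and supp: "\<And>x. norm x > r \<Longrightarrow> \<rho> x = 0"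
    and small: "\<And>t x. norm x < t \<Longrightarrow> t \<le> T \<Longrightarrow> \<rho> x \<noteq> 0 \<Longrightarrow> \<bar>diff_R i (t, x)\<bar> \<le> \<eta>"
  shows "\<bar>data_term i\<bar> \<le> \<eta> * C * T * (LINT x|lborel. \<rho> x)"
proof -
  define f where "f t x = indicator ({0..T} \<times> cball 0 r) (t, x) *\<^sub>R (\<eta> * C * \<rho> x)" for t and x :: "real^3"
  have f_nonneg: "f t x \<ge> 0" for t x
    using C(1) \<eta> \<rho>_nonneg by (simp add: f_def)
  have "integrable lborel (\<lambda>z::spacetime. indicator ({0..T} \<times> cball 0 r) z *\<^sub>R (\<eta> * C * \<rho> (snd z)))"
    by (intro borel_integrable_compact compact_Times compact_Icc compact_cball continuous_on_mult
        continuous_on_const smooth_continuous_on[OF smooth_snd[OF \<rho>]])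
  then have fi: "integrable lborel (case_prod f)" by (simp add: f_def case_prod_beta')
  have "(LINT t|lborel. f t x) = \<eta> * C * T * \<rho> x" for x
  proof -
    have "f t x = indicator {0..T} t *\<^sub>R (\<eta> * C * \<rho> x)" for t
      using supp[of x] by (auto simp: f_def indicator_def not_le)
    then show ?thesis using T by simp
  qed
  moreover have "(LINT x|lborel. (LINT t|lborel. f t x)) = integral\<^sup>L lborel (case_prod f)"
    using lborel_pair.integral_snd[of f] fi by (simp add: lborel_prod)
  ultimately have If: "integral\<^sup>L lborel (case_prod f) = \<eta> * C * T * (LINT x|lborel. \<rho> x)" by simp
  let ?F = "\<lambda>z. indicator inside_cone z *\<^sub>R (diff_R i z * source z)"
  have Fi: "integrable lborel ?F"
    using cone_mult_integrable[OF continuous_diff_R smooth_source vanishes_after_source, of i]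
    by (simp add: set_integrable_def)
  have "\<bar>data_term i\<bar> \<le> (LINT z|lborel. \<bar>?F z\<bar>)"
    unfolding data_term_def set_lebesgue_integral_def by (rule integral_abs_bound)
  also have "\<dots> \<le> integral\<^sup>L lborel (case_prod f)"
  proof (rule integral_mono[OF integrable_abs[OF Fi] fi])
    fix z :: spacetime
    obtain t x where z: "z = (t, x)" by (cases z)
    show "\<bar>?F z\<bar> \<le> case_prod f z"
    proof (cases "norm x < t \<and> t \<le> T \<and> \<rho> x \<noteq> 0")
      case True
      then have t: "0 \<le> t" "t \<le> T" using norm_ge_zero[of x] by linarith+
      have "norm x \<le> r" using supp[of x] True by (auto simp: not_less[symmetric])
      then have fz: "f t x = \<eta> * (C * \<rho> x)" using t by (simp add: f_def)
      have "\<bar>diff_R i (t, x)\<bar> * source (t, x) \<le> \<eta> * (C * \<rho> x)"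
        using small[of x t] True C(2)[OF t] \<rho>_nonneg[of x] \<eta> source_nonneg[of "(t, x)"]
        by (intro mult_mono) (auto simp: source_def mult_right_mono)
      then show ?thesis using fz source_nonneg[of "(t, x)"] True
        by (simp add: z inside_cone_def abs_mult)
    next
      case False
      have "?F z = 0"
        using False decay_zero(2)[of T t l] by (auto simp: z inside_cone_def source_def indicator_def not_le)
      then have "\<bar>?F z\<bar> = 0" by (simp only: abs_zero)
      then show ?thesis using f_nonneg[of t x] unfolding z prod.case by linarith
    qed
  qed
  finally show ?thesis by (simp only: If)
qed

text \<open>This is where the ellipsoid originates: the cone from (|x|, x) meets the support of
  \<rho> at the time |x| + |z|, which is about |x| + |x - e| when \<rho> is concentrated near e. The
  weight 1/|z| >= 1/T leaves a multiple of the mass.\<close>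

lemma w_ge:
  assumes c: "c \<ge> 0" and int: "integrable lborel \<rho>"
    and near: "\<And>z. z \<noteq> 0 \<Longrightarrow> \<rho> (z + x) \<noteq> 0 \<Longrightarrow> norm z \<le> T \<and> c \<le> decay_rate T l (norm x + norm z)"
  shows "c / T * (LINT x|lborel. \<rho> x) \<le> w (norm x, x)"
proof -
  have m: "\<rho> \<in> borel_measurable borel" by (rule borel_measurable_continuous_onI[OF smooth_continuous_on[OF \<rho>]])
  have shift: "(LINT z|lborel. c / T * \<rho> (z + x)) = c / T * (LINT x|lborel. \<rho> x)"
    using integral_translation[OF m, of x] by simp
  have "(LINT z|lborel. c / T * \<rho> (z + x)) \<le> w (norm x, x)"
    unfolding w_def cone_integral_def
  proof (rule integral_mono_AE)
    show "integrable lborel (\<lambda>z. source ((norm x, x) + (norm z, z)) * (1 / norm z))"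
      by (rule cone_integrable[OF locally_integrable_inverse_norm smooth_continuous_on[OF smooth_source] vanishes_after_source])
    have "integrable (distr lborel borel ((+) x)) \<rho>" using int by (simp add: lborel_distr_plus)
    then have "integrable lborel (\<lambda>z. \<rho> (x + z))" by (subst (asm) integrable_distr_eq) (use m in auto)
    then show "integrable lborel (\<lambda>z. c / T * \<rho> (z + x))" by (simp add: add.commute)
    have "AE z in lborel. z \<noteq> (0::real^3)" by (rule AE_lborel_singleton)
    then show "AE z in lborel. c / T * \<rho> (z + x) \<le> source ((norm x, x) + (norm z, z)) * (1 / norm z)"
    proof eventually_elim
      fix z :: "real^3" assume z: "z \<noteq> 0"
      show "c / T * \<rho> (z + x) \<le> source ((norm x, x) + (norm z, z)) * (1 / norm z)"
      proof (cases "\<rho> (z + x) = 0")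
        case False
        from near[OF z this] have "norm z \<le> T" "c \<le> decay_rate T l (norm x + norm z)" by auto
        then have "(c * \<rho> (z + x)) * (1 / T) \<le> (decay_rate T l (norm x + norm z) * \<rho> (z + x)) * (1 / norm z)"
          using z c \<rho>_nonneg[of "z + x"] decay_rate_nonneg[OF l] T
          by (intro mult_mono mult_right_mono) (auto intro!: divide_left_mono)
        then show ?thesis by (simp add: source_def add.commute)
      qed (simp add: source_nonneg)
    qed
  qed
  then show ?thesis by (simp only: shift)
qed

text \<open>The integrand is nonnegative, so only the ball is kept, and there 1/|x| is at least
  1/T.\<close>

lemma surface_term_ge:
  assumes "a \<ge> 0" "b \<ge> 0"
    and near: "\<And>x. x \<in> ball x0 d \<Longrightarrow> norm x \<le> T \<and> a \<le> gap i x \<and> b \<le> w (norm x, x)"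
  shows "measure lborel (ball x0 d) * (a * (b / (4 * pi * T))) \<le> surface_term i"
proof -
  have fin: "emeasure lborel (ball x0 d) < \<infinity>" by (rule emeasure_bounded_finite) simp
  have "(LINT x|lborel. indicator (ball x0 d) x * (a * (b / (4 * pi * T)))) \<le> surface_term i"
    unfolding surface_term_def
  proof (rule integral_mono_AE)
    show "integrable lborel (\<lambda>x. indicator (ball x0 d) x * (a * (b / (4 * pi * T))))"
      using fin by (intro integrable_mult_left) (simp add: integrable_indicator_iff)
    show "integrable lborel (\<lambda>x. gap i x * (w (norm x, x) / (4 * pi * norm x)))"
      by (rule cone_surface_integrable[OF continuous_gap smooth_continuous_on[OF smooth_w] vanishes_after_w])
    have "AE x in lborel. x \<noteq> (0::real^3)" by (rule AE_lborel_singleton)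
    then show "AE x in lborel. indicator (ball x0 d) x * (a * (b / (4 * pi * T))) \<le> gap i x * (w (norm x, x) / (4 * pi * norm x))"
    proof eventually_elim
      fix x :: "real^3" assume x: "x \<noteq> 0"
      show "indicator (ball x0 d) x * (a * (b / (4 * pi * T))) \<le> gap i x * (w (norm x, x) / (4 * pi * norm x))"
      proof (cases "x \<in> ball x0 d")
        case True
        have "b / (4 * pi * T) \<le> w (norm x, x) / (4 * pi * norm x)"
          using near[OF True] x assms(2) T w_nonneg by (intro frac_le) auto
        then have "a * (b / (4 * pi * T)) \<le> gap i x * (w (norm x, x) / (4 * pi * norm x))"
          using near[OF True] assms T gap_nonneg by (intro mult_mono) auto
        then show ?thesis using True by simp
      qed (simp add: gap_nonneg w_nonneg)
    qed
  qed
  then show ?thesis by simp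
qed

end

text \<open>Left unnormalised, as the upper and the lower bound are both proportional to its
  integral. The squared distance keeps the argument of \<open>bump\<close> smooth at
  \<open>e\<close>.\<close>

definition peak :: "real ^ 3 \<Rightarrow> real \<Rightarrow> real ^ 3 \<Rightarrow> real" where
  "peak e \<epsilon> x = bump 0 (\<epsilon>\<^sup>2 - (norm (x - e))\<^sup>2)"

lemma smooth_peak: "smooth (peak e \<epsilon>)"
proof -
  have "(norm (x - e))\<^sup>2 = (norm x)\<^sup>2 - 2 * (x \<bullet> e) + (norm e)\<^sup>2" for x
    unfolding power2_norm_eq_inner by (simp add: inner_simps inner_commute)
  then show ?thesis unfolding peak_def[abs_def]
    by (simp only:) (intro smooth_compose_real[OF smooth_bump] smooth_diff smooth_add smooth_cmult
        smooth_const smooth_norm_square smooth_linear bounded_linear_inner_left)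
qed

lemma peak_nonneg: "peak e \<epsilon> x \<ge> 0"
  by (simp add: peak_def bump_nonneg)

lemma peak_eq_0_iff: "\<epsilon> > 0 \<Longrightarrow> peak e \<epsilon> x = 0 \<longleftrightarrow> norm (x - e) \<ge> \<epsilon>"
proof -
  assume e: "\<epsilon> > 0"
  have "peak e \<epsilon> x = 0 \<longleftrightarrow> \<not> (norm (x - e))\<^sup>2 < \<epsilon>\<^sup>2"
    using bump_pos_iff[of 0 "\<epsilon>\<^sup>2 - (norm (x - e))\<^sup>2"] bump_nonneg[of 0 "\<epsilon>\<^sup>2 - (norm (x - e))\<^sup>2"]
    by (auto simp: peak_def)
  also have "\<dots> \<longleftrightarrow> norm (x - e) \<ge> \<epsilon>"
    using e power2_le_iff_abs_le[of "norm (x - e)" \<epsilon>] by (simp add: not_less)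
  finally show ?thesis .
qed

lemma peak_support: "\<epsilon> > 0 \<Longrightarrow> norm x > norm e + \<epsilon> \<Longrightarrow> peak e \<epsilon> x = 0"
  using norm_triangle_ineq2[of x e] by (simp add: peak_eq_0_iff)

lemma integrable_peak: "\<epsilon> > 0 \<Longrightarrow> integrable lborel (peak e \<epsilon>)"
  by (rule integrable_continuous_bounded_support[OF smooth_continuous_on[OF smooth_peak] peak_support])

lemma integral_peak_pos:
  assumes "\<epsilon> > 0" shows "(LINT x|lborel. peak e \<epsilon> x) > 0"
proof -
  have nn: "AE x in lborel. 0 \<le> peak e \<epsilon> x" by (simp add: peak_nonneg)
  have "(LINT x|lborel. peak e \<epsilon> x) \<noteq> 0"
  proof
    assume "(LINT x|lborel. peak e \<epsilon> x) = 0"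
    then have "AE x in lborel. peak e \<epsilon> x = 0"
      using integral_nonneg_eq_0_iff_AE[OF integrable_peak[OF assms] nn] by simp
    then have "AE x in lborel. x \<notin> ball e \<epsilon>"
      by eventually_elim (use peak_eq_0_iff[OF assms] in \<open>auto simp: dist_norm norm_minus_commute\<close>)
    then have "ball e \<epsilon> \<in> null_sets lborel" by (subst AE_iff_null_sets) auto
    then have "emeasure lborel (ball e \<epsilon>) = 0" by (rule null_setsD1)
    then show False using content_ball_pos[OF assms, of e] by (simp add: measure_def)
  qed
  moreover have "(LINT x|lborel. peak e \<epsilon> x) \<ge> 0" using nn by (rule integral_nonneg_AE)
  ultimately show ?thesis by simp
qed

context wave_pair
begin

text \<open>If the gap were positive at \<open>x0\<close>, then for a source concentrated near the line \<open>x = e\<close> the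
  surface term would be at least of the order of its mass, while the data are of smaller order.\<close>

lemma gap_eq_0_inside:
  assumes T1: "T > 1" and e: "norm e = 1"
    and data: "\<And>t i. 1 < t \<Longrightarrow> t \<le> T \<Longrightarrow> diff_R i (t, e) = 0"
    and x0: "norm x0 + norm (x0 - e) < T"
  shows "gap i x0 = 0"
proof (rule ccontr)
  assume "gap i x0 \<noteq> 0"
  then have g0: "gap i x0 > 0" using gap_nonneg[of i x0] by simp
  have T0: "T > 0" using T1 by simp
  let ?K = "closed_cone \<inter> {z. fst z \<le> T}"
  obtain M where M: "M \<ge> 0" "\<And>i z. z \<in> closed_cone \<Longrightarrow> fst z \<le> T \<Longrightarrow>
      \<bar>diff_PR i z\<bar> \<le> M * gap i (snd z) + M * (\<Sum>j\<in>UNIV. \<bar>diff_R j z\<bar>)"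
    using diff_PR_bound[of T] by metis
  \<comment> \<open>Chosen before the source is concentrated, which is possible because M does not
    depend on the source. The summand 1 keeps l positive when M = 0.\<close>
  define l where "l = 32 * pi * T * M + 1"
  have "32 * pi * T * M \<ge> 0" using M(1) T0 by (intro mult_nonneg_nonneg) auto
  then have l_ge: "l > 0" "l \<ge> 32 * pi * T * M" unfolding l_def by linarith+
  have cr: "continuous_on S (decay_rate T l)" for S by (rule smooth_continuous_on[OF smooth_decay_rate])

  \<comment> \<open>The slack in the ellipsoid condition. One half keeps the times that matter away
    from T, where the profile vanishes; the other half is spent on moving away from x0 and
    e.\<close>
  define s where "s = T - (norm x0 + norm (x0 - e))"
  have s: "s > 0" using x0 by (simp add: s_def)
  obtain c where c: "c > 0" "\<And>t. 0 \<le> t \<Longrightarrow> t \<le> T - s / 2 \<Longrightarrow> c \<le> decay_rate T l t"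
  proof -
    have "0 \<le> T + (norm x0 + norm (x0 - e))" using T0 by (intro add_nonneg_nonneg) auto
    then have "T - s / 2 \<ge> 0" by (simp add: s_def field_simps)
    then have "{0..T - s / 2} \<noteq> {}" by simp
    then obtain t0 where t0: "t0 \<in> {0..T - s / 2}" "\<And>t. t \<in> {0..T - s / 2} \<Longrightarrow> decay_rate T l t0 \<le> decay_rate T l t"
      using continuous_attains_inf[OF compact_Icc _ cr] by blast
    show ?thesis
      by (rule that[of "decay_rate T l t0"]) (use t0 s l_ge decay_rate_pos[of l t0 T] in auto)
  qed
  have "isCont (gap i) x0" using continuous_gap[of UNIV i] by (simp add: continuous_on_eq_continuous_at)
  then obtain d0 where d0: "d0 > 0" "\<And>x. dist x x0 < d0 \<Longrightarrow> dist (gap i x) (gap i x0) < gap i x0 / 2"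
    unfolding continuous_at_eps_delta using g0 half_gt_zero by blast
  \<comment> \<open>The displacement of x from x0 enters twice and that of y from e once; with each
    at most s/6 they use up s/2.\<close>
  define d where "d = min d0 (s / 6)"
  have d: "d > 0" "d \<le> d0" "d \<le> s / 6" using d0 s by (auto simp: d_def)
  define c3 where "c3 = measure lborel (ball x0 d) * (gap i x0 / 2 * (c / T / (4 * pi * T)))"
  have c3: "c3 > 0"
    unfolding c3_def using d g0 c T0 by (intro mult_pos_pos) (auto simp: content_ball_pos)

  obtain C where C: "C > 0" "\<And>t. 0 \<le> t \<Longrightarrow> t \<le> T \<Longrightarrow> decay_rate T l t \<le> C"
  proof -
    have "bounded (decay_rate T l ` {0..T})"
      by (intro compact_imp_bounded compact_continuous_image cr compact_Icc)
    then obtain B where B: "\<And>t. t \<in> {0..T} \<Longrightarrow> \<bar>decay_rate T l t\<bar> \<le> B"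
      unfolding bounded_iff by (metis imageI real_norm_def)
    show ?thesis
    proof (rule that[of "\<bar>B\<bar> + 1"])
      show "decay_rate T l t \<le> \<bar>B\<bar> + 1" if "0 \<le> t" "t \<le> T" for t using B[of t] that by simp
    qed simp
  qed
  \<comment> \<open>The 8 is a factor 2 from \<open>surface_term_le_data_term\<close>, a factor 2
    for the two components, and a factor 2 to arrive at half of \<open>c3\<close>.\<close>
  define \<eta> where "\<eta> = c3 / (8 * newton_const * C * T)"
  have \<eta>: "\<eta> > 0" unfolding \<eta>_def using c3 C T0 newton_const_pos by (intro divide_pos_pos mult_pos_pos) auto

  \<comment> \<open>The boundary time t = 1 is reached by continuity up to the cone. It is needed
    because points (t, x) of the cone with x near e may have t < 1.\<close>
  have data1: "diff_R j (t, e) = 0" if "1 \<le> t" "t \<le> T" for j t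
  proof (cases "t = 1")
    case True
    define u where "u n = 1 + (T - 1) * (1 / real (Suc n))" for n
    have u: "1 < u n" "u n \<le> T" for n
    proof -
      have "0 < (T - 1) * (1 / real (Suc n))" using T1 by (intro mult_pos_pos) auto
      then show "1 < u n" by (simp add: u_def)
      have "(T - 1) * (1 / real (Suc n)) \<le> (T - 1) * 1" using T1 by (intro mult_left_mono) auto
      then show "u n \<le> T" by (simp add: u_def)
    qed
    have "u \<longlonglongrightarrow> 1 + (T - 1) * 0" unfolding u_def by (intro tendsto_intros inverse_Suc_tendsto)
    then have "(\<lambda>n. (u n, e)) \<longlonglongrightarrow> (1, e)" by (intro tendsto_Pair tendsto_const) simp
    then have "(\<lambda>n. diff_R j (u n, e)) \<longlonglongrightarrow> diff_R j (1, e)"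
    proof (rule continuous_on_tendsto_compose[OF continuous_diff_R])
      show "(1, e) \<in> closed_cone" by (simp add: closed_cone_def e)
      show "\<forall>\<^sub>F n in sequentially. (u n, e) \<in> closed_cone"
        using u(1) by (auto intro!: always_eventually simp: closed_cone_def e less_imp_le)
    qed
    then have "(\<lambda>n. 0) \<longlonglongrightarrow> diff_R j (1, e)" using data u by simp
    then show ?thesis using True by (simp add: LIMSEQ_const_iff)
  qed (use data that in auto)

  have "\<exists>d1>0. \<forall>z\<in>?K. \<forall>z'\<in>?K. dist z' z < d1 \<longrightarrow> dist (diff_R j z') (diff_R j z) < \<eta>" for j
    using compact_uniformly_continuous[OF continuous_on_subset[OF continuous_diff_R[of j]] compact_truncated_cone[of T]] \<eta>
    unfolding uniformly_continuous_on_def by auto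
  then obtain d1 where d1: "\<And>j. d1 j > 0"
    "\<And>j z z'. z \<in> ?K \<Longrightarrow> z' \<in> ?K \<Longrightarrow> dist z' z < d1 j \<Longrightarrow> dist (diff_R j z') (diff_R j z) < \<eta>" by metis
  \<comment> \<open>Halved because the comparison point used below differs by less than \<epsilon>
    in time and by less than \<epsilon> in space.\<close>
  define \<epsilon> where "\<epsilon> = min d (Min (range d1)) / 2"
  have \<epsilon>: "\<epsilon> > 0" "\<epsilon> \<le> d" "2 * \<epsilon> \<le> d1 j" for j
  proof -
    have "Min (range d1) > 0" using d1(1) by simp
    then show "\<epsilon> > 0" "\<epsilon> \<le> d" using d by (auto simp: \<epsilon>_def)
    have "Min (range d1) \<le> d1 j" by simp
    then show "2 * \<epsilon> \<le> d1 j" by (simp add: \<epsilon>_def min.coboundedI2)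
  qed
  interpret weighted_wave_pair P1 P2 U1 U2 R1 R2 T l "peak e \<epsilon>"
    by unfold_locales (rule l_ge smooth_peak peak_nonneg T0)+
  let ?m = "LINT x|lborel. peak e \<epsilon> x"
  have m: "?m > 0" by (rule integral_peak_pos[OF \<epsilon>(1)])

  have small: "\<bar>diff_R j (t, x)\<bar> \<le> \<eta>" if "norm x < t" "t \<le> T" "peak e \<epsilon> x \<noteq> 0" for j t x
  proof -
    have xe: "norm (x - e) < \<epsilon>" using that(3) peak_eq_0_iff[OF \<epsilon>(1)] by (simp add: not_le)
    have "1 - \<epsilon> \<le> norm x" using norm_triangle_ineq2[of e x] xe e by (simp add: norm_minus_commute)
    \<comment> \<open>Here t > |x| >= 1 - \<epsilon>. For t < 1 the point (t, e) is outside the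
      closed cone, hence the comparison with (max t 1, e).\<close>
    then have "\<bar>max t 1 - t\<bar> < \<epsilon>" using that(1) \<epsilon>(1) by (simp add: max_def)
    moreover have "dist (t, x) (max t 1, e) \<le> \<bar>max t 1 - t\<bar> + norm (x - e)"
      using norm_triangle_ineq[of "(t - max t 1, 0)" "(0, x - e)"]
      by (simp add: dist_norm norm_Pair abs_minus_commute)
    ultimately have "dist (t, x) (max t 1, e) < d1 j" using xe \<epsilon>(3)[of j] by linarith
    moreover have "(t, x) \<in> ?K" "(max t 1, e) \<in> ?K"
      using that T1 e by (auto simp: closed_cone_def)
    ultimately have "dist (diff_R j (t, x)) (diff_R j (max t 1, e)) < \<eta>" by (intro d1(2))
    moreover have "diff_R j (max t 1, e) = 0" using that T1 by (intro data1) auto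
    ultimately show ?thesis by (simp add: dist_norm)
  qed
  have dt: "\<bar>data_term j\<bar> \<le> \<eta> * C * T * ?m" for j
    by (rule data_term_le[where r="norm e + \<epsilon>"])
       (use C \<eta> small peak_support[OF \<epsilon>(1)] in \<open>auto simp: less_imp_le\<close>)
  have "c3 * ?m \<le> surface_term i"
  proof -
    have "measure lborel (ball x0 d) * (gap i x0 / 2 * (c / T * ?m / (4 * pi * T))) \<le> surface_term i"
    proof (rule surface_term_ge)
      show "0 \<le> gap i x0 / 2" "0 \<le> c / T * ?m" using g0 c T0 m by auto
      fix x assume "x \<in> ball x0 d"
      then have x: "norm (x - x0) < d" by (simp add: dist_norm norm_minus_commute)
      have near: "norm x + norm (y - x) \<le> T - s / 2" if "norm (y - e) < \<epsilon>" for y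
      proof -
        have "norm x \<le> norm x0 + norm (x - x0)" using norm_triangle_ineq[of x0 "x - x0"] by simp
        moreover have "norm (y - x) \<le> norm (y - e) + norm (x0 - e) + norm (x - x0)"
          using norm_triangle_ineq4[of "y - e" "x - e"] norm_triangle_ineq[of "x - x0" "x0 - e"] by simp
        moreover have "norm x0 + norm (x0 - e) = T - s" by (simp add: s_def)
        ultimately show ?thesis using x that \<epsilon>(2) d(3) by linarith
      qed
      have "norm x + norm (e - x) \<le> T - s / 2" using near[of e] \<epsilon>(1) by simp
      then have "norm x \<le> T" using s norm_ge_zero[of "e - x"] by linarith
      moreover have "dist (gap i x) (gap i x0) < gap i x0 / 2"
        using x d(2) by (intro d0(2)) (simp add: dist_norm)
      then have "gap i x0 / 2 \<le> gap i x" unfolding dist_real_def by linarith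
      moreover have "c / T * ?m \<le> w (norm x, x)"
      proof (rule w_ge[OF less_imp_le[OF c(1)] integrable_peak[OF \<epsilon>(1)]])
        fix z assume "peak e \<epsilon> (z + x) \<noteq> 0"
        then have "norm (z + x - e) < \<epsilon>" using peak_eq_0_iff[OF \<epsilon>(1)] by (simp add: not_le)
        from near[OF this] have n: "norm x + norm z \<le> T - s / 2" by simp
        then have "norm z \<le> T" using s norm_ge_zero[of x] by linarith
        with n show "norm z \<le> T \<and> c \<le> decay_rate T l (norm x + norm z)" by (auto intro!: c(2))
      qed
      ultimately show "norm x \<le> T \<and> gap i x0 / 2 \<le> gap i x \<and> c / T * ?m \<le> w (norm x, x)" by blast
    qed
    then show ?thesis by (simp add: c3_def mult_ac)
  qed
  also have "surface_term i \<le> (\<Sum>j\<in>UNIV. surface_term j)"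
    by (rule member_le_sum) (auto simp: surface_term_nonneg)
  also have "\<dots> \<le> 2 * newton_const * (\<Sum>j\<in>UNIV. \<bar>data_term j\<bar>)"
    by (rule surface_term_le_data_term[OF M l_ge(2)])
  also have "\<dots> \<le> 2 * newton_const * (\<Sum>j\<in>(UNIV :: 2 set). \<eta> * C * T * ?m)"
    using newton_const_pos by (intro mult_left_mono sum_mono dt) auto
  also have "\<dots> = c3 / 2 * ?m"
    using newton_const_pos C T0 by (simp add: \<eta>_def field_simps)
  finally show False using c3 m by simp
qed

text \<open>Points on the boundary of the ellipsoid are approached by shrinking towards the origin:
  at (1 - a) x the sum of the distances is at most (1 - a) T + a, which is below T because |e| = 1 <
  T. Continuity of the gap gives the limit.\<close>

lemma gap_eq_0:
  assumes T: "T > 1" and e: "norm e = 1"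
    and data: "\<And>t i. 1 < t \<Longrightarrow> t \<le> T \<Longrightarrow> diff_R i (t, e) = 0"
    and x: "norm x + norm (x - e) \<le> T"
  shows "gap i x = 0"
proof -
  define u where "u n = (1 - 1 / real (Suc n)) *\<^sub>R x" for n
  have "gap i (u n) = 0" for n
  proof (rule gap_eq_0_inside[OF T e data])
    define a where "a = 1 / real (Suc n)"
    have a: "0 < a" "a \<le> 1" by (auto simp: a_def)
    have "norm (u n - e) = norm ((1 - a) *\<^sub>R (x - e) - a *\<^sub>R e)"
      by (simp add: u_def a_def algebra_simps)
    also have "\<dots> \<le> (1 - a) * norm (x - e) + a"
      using norm_triangle_ineq4[of "(1 - a) *\<^sub>R (x - e)" "a *\<^sub>R e"] a e by simp
    finally have "norm (u n - e) \<le> (1 - a) * norm (x - e) + a" .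
    moreover have "norm (u n) = (1 - a) * norm x" using a unfolding u_def a_def[symmetric] by simp
    ultimately have "norm (u n) + norm (u n - e) \<le> (1 - a) * (norm x + norm (x - e)) + a"
      unfolding distrib_left by linarith
    also have "\<dots> \<le> (1 - a) * T + a" using x a by (intro add_right_mono mult_left_mono) auto
    also have "\<dots> < T" using a T mult_strict_left_mono[of 1 T a] by (simp add: algebra_simps)
    finally show "norm (u n) + norm (u n - e) < T" .
  qed
  moreover have "u \<longlonglongrightarrow> (1 - 0) *\<^sub>R x" unfolding u_def by (intro tendsto_intros inverse_Suc_tendsto)
  then have "(\<lambda>n. gap i (u n)) \<longlonglongrightarrow> gap i x"
    by (intro continuous_on_tendsto_compose[OF continuous_gap[of UNIV]]) auto
  ultimately show ?thesis by (simp add: LIMSEQ_const_iff)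
qed

end

theorem theorem1p3:
  fixes T :: real and e :: "real ^ 3"
    and P1 P2 :: "real ^ 3 \<Rightarrow> real ^ 2 ^ 2"
    and U1 U2 :: "2 \<Rightarrow> (real \<times> (real ^ 3) \<Rightarrow> real) \<Rightarrow> real"
    and R1 R2 :: "real \<times> (real ^ 3) \<Rightarrow> real ^ 2"
  assumes "T > 1"
    and "e = vector [1, 0, 0]"
    and "\<And>i j. smooth (\<lambda>x. P1 x $ i $ j)"
    and "\<And>i j. smooth (\<lambda>x. P2 x $ i $ j)"
    and "solves_ivp P1 U1"
    and "solves_ivp P2 U2"
    and "regular_part P1 U1 R1"
    and "regular_part P2 U2 R2"
    and "\<And>x i j. P1 x $ i $ j \<ge> P2 x $ i $ j"
    and "\<And>t. t \<in> {1<..T} \<Longrightarrow> R1 (t, e) = R2 (t, e)"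
  shows "\<forall>x. norm x + norm (x - e) \<le> T \<longrightarrow> P1 x = P2 x"
proof (intro allI impI)
  interpret wave_pair P1 P2 U1 U2 R1 R2
    by unfold_locales (use assms(3-9) in auto)
  fix x :: "real ^ 3"
  assume x: "norm x + norm (x - e) \<le> T"
  have e: "norm e = 1"
    by (simp add: assms(2) norm_vec_def L2_set_def sum_3)
  have "diff_R i (t, e) = 0" if "1 < t" "t \<le> T" for t i
    using assms(10)[of t] that by (simp add: diff_R_def)
  then have "gap i x = 0" for i
    by (rule gap_eq_0[OF assms(1) e _ x])
  \<comment> \<open>The sign hypothesis recovers the single entries from the row sums.\<close>
  then have "P1 x $ i $ j - P2 x $ i $ j = 0" for i j
    unfolding gap_def by (subst (asm) sum_nonneg_eq_0_iff) (auto simp: assms(9))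
  then show "P1 x = P2 x"
    by (simp add: vec_eq_iff)
qed

end
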